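(* Let $n\ge1$. The deformation derivatives ($\dot{}=d/dt$) of the semi-classical bi-orthogonal polynomials and of their reciprocal polynomials are $$\dot\phi_n(z)=\Big\{-\frac{\dot\kappa_n}{\kappa_n}-\sum_{j=1}^m\rho_j\frac{\dot z_j}{z_j}+\frac12\sum_{j=1}^m\rho_j\frac{\dot z_j}{z_j}z_j^{-n}\epsilon_n(z_j)\phi^*_n(z_j)\frac{z}{z-z_j}\Big\}\phi_n(z)-\Big\{\frac12\sum_{j=1}^m\rho_j\frac{\dot z_j}{z_j}z_j^{1-n}\epsilon_n(z_j)\phi_n(z_j)\frac{1}{z-z_j}\Big\}\phi^*_n(z),$$ $$\dot\phi^*_n(z)=\Big\{-\frac{\dot\kappa_n}{\kappa_n}+\frac12\sum_{j=1}^m\rho_j\frac{\dot z_j}{z_j}z_j^{1-n}\epsilon^*_n(z_j)\phi_n(z_j)\frac{1}{z-z_j}\Big\}\phi^*_n(z)-\Big\{\frac12\sum_{j=1}^m\rho_j\frac{\dot z_j}{z_j}z_j^{-n}\epsilon^*_n(z_j)\phi^*_n(z_j)\frac{z}{z-z_j}\Big\}\phi_n(z),$$ and those of the associated function and the reciprocal associated function are $$\dot\epsilon_n(z)=\Big\{-\frac{\dot\kappa_n}{\kappa_n}-\frac12\sum_{j=1}^m\rho_j\frac{\dot z_j}{z_j}z_j^{-n}\epsilon^*_n(z_j)\phi_n(z_j)\frac{z}{z-z_j}\Big\}\epsilon_n(z)+\Big\{\frac12\sum_{j=1}^m\rho_j\frac{\dot z_j}{z_j}z_j^{1-n}\epsilon_n(z_j)\phi_n(z_j)\frac{1}{z-z_j}\Big\}\epsilon^*_n(z),$$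 $$\dot\epsilon^*_n(z)=\Big\{-\frac{\dot\kappa_n}{\kappa_n}-\frac12\sum_{j=1}^m\rho_j\frac{\dot z_j}{z_j}z_j^{1-n}\epsilon_n(z_j)\phi^*_n(z_j)\frac{1}{z-z_j}\Big\}\epsilon^*_n(z)+\Big\{\frac12\sum_{j=1}^m\rho_j\frac{\dot z_j}{z_j}z_j^{-n}\epsilon^*_n(z_j)\phi^*_n(z_j)\frac{z}{z-z_j}\Big\}\epsilon_n(z).$$
   Context: Regular semi-classical weight depending on a deformation variable $t$: $w(z)=\prod_{j=1}^m(z-z_j(t))^{\rho_j}$ with $m\ge2$ distinct points $z_j=z_j(t)$ depending differentiably on $t$, and $t$-independent exponents $\rho_j\in\mathbb C\setminus\mathbb Z_{\ge0}$, so that $\dot w/w=-\sum_{j=1}^m\rho_j\dot z_j/(z-z_j)$. One singular point is fixed at the origin, $z_1=0$ for all $t$; correspondingly the $j=1$ term ($\dot z_1=0$) in every sum containing $\dot z_j/z_j$ is taken to be zero. A branch of $w$ analytic in a cut plane is fixed; let $\mathbb T=\{|\zeta|=1\}$ be parametrised by $\zeta=e^{i\theta}$, $\theta\in(-\pi,\pi]$, the cuts being such that on $\mathbb T$ the branch is analytic except possibly at $-1$ and at those $z_j$ lying on $\mathbb T$. For all $t$ assume $w(e^{\pi i})=w(e^{-\pi i})$, $z^jw,z^jw'\in L^1(\mathbb T)$ for all $j\in\mathbb Z$ (so $\mathrm{Re}\,\rho_j>0$ when $z_j\in\mathbb T$), and $\det[w_{j-k}]_{0\le j,k\le n-1}\neq0$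 for all $n\ge1$, where $w_k=\int_{\mathbb T}\frac{d\zeta}{2\pi i\zeta}w(\zeta)\zeta^{-k}$. The bi-orthonormal polynomials are $\phi_n(z)=\kappa_nz^n+\dots+\phi_n(0)$ and $\bar\phi_n(z)=\kappa_nz^n+\dots+\bar\phi_n(0)$ with $\kappa_n\neq0$ (chosen differentiable in $t$), satisfying $\int_{\mathbb T}\frac{d\zeta}{2\pi i\zeta}w(\zeta)\phi_m(\zeta)\bar\phi_n(\bar\zeta)=\delta_{m,n}$, $\bar\zeta=\zeta^{-1}$; the bar on $\bar\phi_n$ is notation, not complex conjugation. $\phi^*_n(z)=z^n\bar\phi_n(1/z)$. For $n\ge1$ and $z\notin\mathbb T$, $\epsilon_n(z)=\int_{\mathbb T}\frac{d\zeta}{2\pi i\zeta}\frac{\zeta+z}{\zeta-z}w(\zeta)\phi_n(\zeta)$ and $\epsilon^*_n(z)=-z^n\int_{\mathbb T}\frac{d\zeta}{2\pi i\zeta}\frac{\zeta+z}{\zeta-z}w(\zeta)\bar\phi_n(\bar\zeta)$; values at a point $z_j\in\mathbb T$ are understood as limiting values. *)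

theory Defs
  imports
    "HOL-Complex_Analysis.Complex_Analysis"
    "Jordan_Normal_Form.Determinant"
begin

text \<open>
  A deformation variable may be real or complex. Both cases are covered by taking the parameter
  set to be a set of complex numbers and differentiating with respect to \<open>at t within D\<close>:
  for open \<open>D\<close> this is the complex derivative, and for \<open>D\<close> the image of an open
  set of reals it is the ordinary derivative with respect to a real variable.
\<close>

definition deformation_set :: "complex set \<Rightarrow> bool" where
  "deformation_set D \<longleftrightarrow> open D \<or> (\<exists>I::real set. open I \<and> D = complex_of_real ` I)"

text \<open>Cuts are simple arcs, either bounded or running off to infinity.\<close>

definition is_cut :: "complex set \<Rightarrow> bool" where
  "is_cut C \<longleftrightarrow>
     (\<exists>g. arc g \<and> C = path_image g) \<or>
     (\<exists>g::real \<Rightarrow> complex. continuous_on {0..} g \<and> inj_on g {0..} \<and>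
        filterlim g at_infinity at_top \<and> C = g ` {0..})"

definition cut_plane :: "complex set \<Rightarrow> bool" where
  "cut_plane U \<longleftrightarrow> (\<exists>\<C>. finite \<C> \<and> (\<forall>C\<in>\<C>. is_cut C) \<and> U = - \<Union>\<C>)"

text \<open>
  \<open>w\<close> is an analytic branch on \<open>U\<close> of the multivalued function
  \<open>\<Prod>j=1..m. (x - a j) powr \<rho> j\<close>. The logarithms \<open>l j\<close> are only chosen pointwise: on a plane
  cut along an arc joining two of the points, the product may have an analytic branch although
  the individual factors have none. Analyticity of \<open>w\<close> forces the choices to fit together. The
  points \<open>a j\<close> themselves cannot belong to \<open>U\<close>, as \<open>exp\<close> has no zeros.
\<close>

definition is_power_product_branch ::
    "nat \<Rightarrow> (nat \<Rightarrow> complex) \<Rightarrow> (nat \<Rightarrow> complex) \<Rightarrow> complex set \<Rightarrow> (complex \<Rightarrow> complex) \<Rightarrow> bool" where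
  "is_power_product_branch m a \<rho> U w \<longleftrightarrow>
     w holomorphic_on U \<and>
     (\<forall>x\<in>U. \<exists>l. (\<forall>j\<in>{1..m}. exp (l j) = x - a j) \<and> w x = exp (\<Sum>j=1..m. \<rho> j * l j))"

text \<open>The integral of \<open>f(\<zeta>) d\<zeta> / (2 \<pi> \<i> \<zeta>)\<close> over the unit circle, with \<open>\<zeta> = cis \<theta>\<close>, \<open>-\<pi> \<le> \<theta> \<le> \<pi>\<close>.\<close>

definition circle_int :: "(complex \<Rightarrow> complex) \<Rightarrow> complex" where
  "circle_int f =
     contour_integral (part_circlepath 0 1 (-pi) pi) (\<lambda>\<zeta>. f \<zeta> / (2 * of_real pi * \<i> * \<zeta>))"

definition circle_L1 :: "(complex \<Rightarrow> complex) \<Rightarrow> bool" where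
  "circle_L1 f \<longleftrightarrow> (\<lambda>\<theta>. f (cis \<theta>)) absolutely_integrable_on {-pi..pi}"

definition fourier_coeff :: "(complex \<Rightarrow> complex) \<Rightarrow> int \<Rightarrow> complex" where
  "fourier_coeff w k = circle_int (\<lambda>\<zeta>. w \<zeta> * \<zeta> powi (-k))"

definition toeplitz_det :: "(complex \<Rightarrow> complex) \<Rightarrow> nat \<Rightarrow> complex" where
  "toeplitz_det w n =
     Determinant.det (Matrix.mat n n (\<lambda>(j, k). fourier_coeff w (int j - int k)))"

text \<open>
  \<open>p k\<close> and \<open>q k\<close> are the \<open>k\<close>-th polynomial and its barred partner, with common leading
  coefficient \<open>\<kappa> k\<close>. On the unit circle the conjugate of \<open>\<zeta>\<close> is \<open>inverse \<zeta>\<close>.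
\<close>

definition biorthonormal ::
    "(complex \<Rightarrow> complex) \<Rightarrow> (nat \<Rightarrow> complex) \<Rightarrow> (nat \<Rightarrow> complex poly) \<Rightarrow> (nat \<Rightarrow> complex poly) \<Rightarrow> bool" where
  "biorthonormal w \<kappa> p q \<longleftrightarrow>
     (\<forall>k. \<kappa> k \<noteq> 0 \<and>
        degree (p k) = k \<and> lead_coeff (p k) = \<kappa> k \<and>
        degree (q k) = k \<and> lead_coeff (q k) = \<kappa> k) \<and>
     (\<forall>i k. circle_int (\<lambda>\<zeta>. w \<zeta> * poly (p i) \<zeta> * poly (q k) (inverse \<zeta>)) = (if i = k then 1 else 0))"

text \<open>
  A polynomial \<open>q\<close> of exact degree \<open>n\<close> has as its reciprocal polynomial
  \<open>x ^ n * poly q (1 / x)\<close> the library's \<open>reflect_poly q\<close>.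
\<close>

lemma poly_reflect_poly_reciprocal:
  fixes q :: "complex poly"
  assumes "degree q = n" "x \<noteq> 0"
  shows "poly (reflect_poly q) x = x ^ n * poly q (1 / x)"
  using assms by (simp add: poly_reflect_poly_nz inverse_eq_divide)

text \<open>Off the unit circle \<open>off_circle_ext f\<close> is \<open>f\<close>; on the circle it is the limiting value.\<close>

definition off_circle_ext :: "(complex \<Rightarrow> complex) \<Rightarrow> complex \<Rightarrow> complex" where
  "off_circle_ext f x =
     (if x \<in> sphere 0 1 then Lim (at x within - sphere 0 1) f else f x)"

definition assoc_fun :: "(complex \<Rightarrow> complex) \<Rightarrow> complex poly \<Rightarrow> complex \<Rightarrow> complex" where
  "assoc_fun w p =
     off_circle_ext (\<lambda>x. circle_int (\<lambda>\<zeta>. (\<zeta> + x) / (\<zeta> - x) * w \<zeta> * poly p \<zeta>))"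

definition recip_assoc_fun ::
    "(complex \<Rightarrow> complex) \<Rightarrow> nat \<Rightarrow> complex poly \<Rightarrow> complex \<Rightarrow> complex" where
  "recip_assoc_fun w n q =
     off_circle_ext
       (\<lambda>x. - (x ^ n) * circle_int (\<lambda>\<zeta>. (\<zeta> + x) / (\<zeta> - x) * w \<zeta> * poly q (inverse \<zeta>)))"

end

theory Submission
  imports Defs
begin

text \<open>
  Write \<open>\<langle>f\<rangle>\<^sub>s\<close> for the integral of \<open>w\<^sub>s f\<close> over the circle, with respect to \<open>d\<zeta> / (2 \<pi> \<i> \<zeta>)\<close>,
  where \<open>w\<^sub>s\<close> is the weight at time \<open>s\<close>. The polynomial \<open>\<phi>\<^sub>n\<close> at time \<open>s\<close> is expanded in the basis
  \<open>\<phi>\<^sub>0, \<dots>, \<phi>\<^sub>n\<close> at time \<open>t\<close>. By bi-orthogonality the coefficients solve a linear system whose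
  matrix \<open>\<langle>\<phi>\<^sub>k(\<zeta>) \<phi>b\<^sub>j(1/\<zeta>)\<rangle>\<^sub>s\<close> is the identity at \<open>s = t\<close>. Once the moments are known to be
  differentiable, so are the coefficients (\<open>dual_basis_expansion_derivative\<close>), and at \<open>t\<close>
  \<open>\<phi>\<^sub>n' = - (\<kappa>\<^sub>n' / \<kappa>\<^sub>n) \<phi>\<^sub>n - \<Sum>\<^sub>k\<^sub>\<le>\<^sub>n M\<^sub>k \<phi>\<^sub>k\<close>, where the prime denotes \<open>d/dt\<close> and \<open>M\<^sub>k\<close> is the
  pairing of \<open>\<phi>\<^sub>n(\<zeta>) \<phi>b\<^sub>k(1/\<zeta>)\<close> against the derivative of the weight.

  Since \<open>w' / w = - \<Sum>\<^sub>j \<rho>\<^sub>j z\<^sub>j' / (\<zeta> - z\<^sub>j)\<close>, each \<open>M\<^sub>k\<close> is a combination of pairings with a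
  simple pole at a singularity. Orthogonality lets all powers of \<open>1/\<zeta>\<close> be exchanged for powers of
  \<open>1/z\<^sub>j\<close>, so that such a pairing is a polynomial value times one Cauchy transform of \<open>w \<phi>\<^sub>n\<close>
  (\<open>pairing_p_pole\<close>, \<open>pairing_q_pole\<close>), with one correction for \<open>k = n\<close>; up to the factor \<open>2 z\<^sub>j\<close>
  this transform is \<open>\<epsilon>\<^sub>n(z\<^sub>j)\<close>. The sum over \<open>k\<close> is then the Christoffel-Darboux kernel
  (\<open>christoffel_darboux\<close>), whose closed form has precisely the pole \<open>1 / (z - z\<^sub>j)\<close> and the two
  terms in \<open>\<phi>\<^sub>n(z)\<close> and \<open>\<phi>\<^sub>n\<^sup>*(z)\<close> of the assertion. The associated functions are Cauchy
  transforms of the same expansions; here the weight is differentiated as well, partial fractions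
  separate the poles at \<open>z\<close> and \<open>z\<^sub>j\<close>, and the identity \<open>\<phi>\<^sub>n\<^sup>* \<epsilon>\<^sub>n + \<phi>\<^sub>n \<epsilon>\<^sub>n\<^sup>* = 2 z\<^sup>n\<close>
  (\<open>casoratian\<close>) makes the remaining inhomogeneous terms cancel.

  The analytic work is needed because singularities may lie on the circle of integration, and may
  cross it or move along it as \<open>s\<close> varies. Two facts have to be established there.

  The moments are differentiable under the integral sign
  (\<open>circle_int_weight_has_field_derivative\<close>). The increment of the weight is dominated by
  \<open>|s - t|\<close> times a constant multiple of \<open>1 + |w\<^sub>t(\<zeta>)| \<Sum>\<^sub>j 1 / |\<zeta> - z\<^sub>j(t)|\<close>, which is integrable
  because \<open>w\<close> and its \<open>\<zeta>\<close>-derivative are. At a distance from the singularities large compared with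
  \<open>|s - t|\<close> the ratio \<open>w\<^sub>s / w\<^sub>t\<close> is an explicit product of powers. Closer to a singularity the
  two weights are bounded separately: \<open>w\<^sub>s(\<zeta>)\<close> is compared, along an arc on which \<open>w\<^sub>s\<close> has no
  singularity, with its value at a point where the ratio is under control.

  The Cauchy transform of \<open>w\<close> extends continuously to a singularity \<open>z\<^sub>j\<close> on the circle, from both
  sides and with the absolutely convergent integral as its value
  (\<open>tendsto_cauchy_transform_at_singularity\<close>). Integrability of \<open>w\<close> and its derivative forces
  \<open>Re \<rho>\<^sub>j > 0\<close>, whence \<open>w\<close> vanishes at \<open>z\<^sub>j\<close> and is Hoelder continuous nearby. This gives the
  limiting values \<open>\<epsilon>\<^sub>n(z\<^sub>j)\<close> and \<open>\<epsilon>\<^sub>n\<^sup>*(z\<^sub>j)\<close>.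

  Both facts rest on one estimate (\<open>norm_v_compare\<close>): along an arc free of singularities the
  weight is a constant times \<open>\<Prod>\<^sub>j (\<zeta> - z\<^sub>j) powr \<rho>\<^sub>j\<close> with continuous logarithms. It is valid
  across the point \<open>-1\<close>, where the two one-sided limits of the weight agree.
\<close>

section \<open>Integration over the unit circle\<close>

lemma circle_int_eq:
  "circle_int f = integral {-pi..pi} (\<lambda>\<theta>. f (cis \<theta>)) / (2 * of_real pi)"
proof -
  have "circle_int f =
      integral {-pi..pi} (\<lambda>\<theta>. f (cis \<theta>) * (1 / (2 * of_real pi)))"
    unfolding circle_int_def
    by (subst contour_integral_part_circlepath_eq) (auto simp: field_simps)
  then show ?thesis
    by simp
qed

definition circle_measure :: "real measure" where
  "circle_measure = lebesgue_on {-pi..pi}"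

lemma circle_L1_iff_integrable:
  "circle_L1 f \<longleftrightarrow> integrable circle_measure (\<lambda>\<theta>. f (cis \<theta>))"
  unfolding circle_L1_def circle_measure_def
  by (simp add: set_integrable_def integrable_restrict_space)

lemma circle_int_eq_lebesgue:
  assumes "circle_L1 f"
  shows "circle_int f = (\<integral>\<theta>. f (cis \<theta>) \<partial>circle_measure) / (2 * of_real pi)"
  using assms
  unfolding circle_int_eq circle_L1_iff_integrable circle_measure_def
  by (subst lebesgue_integral_eq_integral) auto

text \<open>
  The exceptional points \<open>-1\<close> and the singularities are points of the circle, while integrals are
  taken over angles. Finitely many points of the circle account for finitely many angles in a
  bounded interval, hence for a null set.
\<close>
lemma finite_cis_vimage: "finite S \<Longrightarrow> finite {\<theta> \<in> {a..b}. cis \<theta> \<in> S}"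
proof (induction S rule: finite_induct)
  case empty
  then show ?case by simp
next
  case (insert c S)
  have "finite {\<theta> \<in> {a..b}. cis \<theta> = c}"
  proof (cases "\<exists>\<alpha>. cis \<alpha> = c")
    case True
    then obtain \<alpha> where \<alpha>: "cis \<alpha> = c" by blast
    have "{\<theta> \<in> {a..b}. cis \<theta> = c} \<subseteq>
        (\<lambda>k. \<alpha> + 2 * pi * of_int k) ` {\<lfloor>(a - \<alpha>) / (2 * pi)\<rfloor>..\<lceil>(b - \<alpha>) / (2 * pi)\<rceil>}"
    proof safe
      fix \<theta> assume \<theta>: "\<theta> \<in> {a..b}" "c = cis \<theta>"
      then have "sin \<theta> = sin \<alpha> \<and> cos \<theta> = cos \<alpha>"
        using \<alpha> by (metis cis.sel)
      then obtain k where k: "\<theta> = \<alpha> + 2 * pi * of_int k"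
        using sin_cos_eq_iff by metis
      have "(a - \<alpha>) / (2 * pi) \<le> of_int k" "of_int k \<le> (b - \<alpha>) / (2 * pi)"
        using \<theta>(1) k pi_gt_zero by (auto simp: field_simps)
      then have "\<lfloor>(a - \<alpha>) / (2 * pi)\<rfloor> \<le> k" "k \<le> \<lceil>(b - \<alpha>) / (2 * pi)\<rceil>"
        by linarith+
      then show "\<theta> \<in> (\<lambda>k. \<alpha> + 2 * pi * of_int k) `
          {\<lfloor>(a - \<alpha>) / (2 * pi)\<rfloor>..\<lceil>(b - \<alpha>) / (2 * pi)\<rceil>}"
        using k by auto
    qed
    then show ?thesis
      using finite_surj by blast
  next
    case False
    then have "{\<theta> \<in> {a..b}. cis \<theta> = c} = {}" by blast
    then show ?thesis by (metis finite.emptyI)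
  qed
  moreover have "{\<theta> \<in> {a..b}. cis \<theta> \<in> insert c S} =
      {\<theta> \<in> {a..b}. cis \<theta> = c} \<union> {\<theta> \<in> {a..b}. cis \<theta> \<in> S}"
    by blast
  ultimately show ?case
    using insert.IH by simp
qed

lemma AE_circle_measure_finite:
  assumes "finite S" "\<And>\<zeta>. \<zeta> \<in> sphere 0 1 - S \<Longrightarrow> P \<zeta>"
  shows "AE \<theta> in circle_measure. P (cis \<theta>)"
proof -
  let ?N = "{\<theta> \<in> {-pi..pi}. cis \<theta> \<in> S}"
  have "negligible ?N"
    using finite_cis_vimage[OF assms(1)] by (rule negligible_finite)
  then have "?N \<in> null_sets circle_measure"
    unfolding circle_measure_def
    by (subst null_sets_restrict_space) (auto simp: negligible_iff_null_sets)
  then show ?thesis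
    by (rule AE_I') (use assms(2) in \<open>force simp: circle_measure_def\<close>)
qed

lemma cis_measurable: "cis \<in> borel_measurable circle_measure"
  unfolding circle_measure_def
  by (intro continuous_imp_measurable_on_sets_lebesgue continuous_intros) auto

lemma continuous_on_sphere_measurable:
  fixes g :: "complex \<Rightarrow> complex"
  assumes "continuous_on (sphere 0 1) g"
  shows "(\<lambda>\<theta>. g (cis \<theta>)) \<in> borel_measurable circle_measure"
  unfolding circle_measure_def
  by (intro continuous_imp_measurable_on_sets_lebesgue
      continuous_on_compose2[OF assms] continuous_intros) auto

lemma circle_L1_cong_finite:
  assumes "finite S" "\<And>\<zeta>. \<zeta> \<in> sphere 0 1 - S \<Longrightarrow> f \<zeta> = g \<zeta>"
  shows "circle_L1 f \<longleftrightarrow> circle_L1 g"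
proof -
  let ?N = "{\<theta> \<in> {-pi..pi}. cis \<theta> \<in> S}"
  have N: "negligible ?N"
    using finite_cis_vimage[OF assms(1)] by (rule negligible_finite)
  show ?thesis
    unfolding circle_L1_def
    by (intro absolutely_integrable_spike_eq[OF N]) (use assms(2) in auto)
qed

lemma circle_int_cong_finite:
  assumes "finite S" "\<And>\<zeta>. \<zeta> \<in> sphere 0 1 - S \<Longrightarrow> f \<zeta> = g \<zeta>"
  shows "circle_int f = circle_int g"
proof -
  let ?N = "{\<theta> \<in> {-pi..pi}. cis \<theta> \<in> S}"
  have N: "negligible ?N"
    using finite_cis_vimage[OF assms(1)] by (rule negligible_finite)
  show ?thesis
    unfolding circle_int_eq
    by (subst integral_spike[OF N, of _ "\<lambda>\<theta>. g (cis \<theta>)" "\<lambda>\<theta>. f (cis \<theta>)"]) (use assms(2) in auto)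
qed

lemma circle_L1_mult_continuous:
  assumes f: "circle_L1 f" and g: "continuous_on (sphere 0 1) g"
  shows "circle_L1 (\<lambda>\<zeta>. f \<zeta> * g \<zeta>)"
proof -
  have "compact (g ` sphere 0 1)"
    by (intro compact_continuous_image g compact_sphere)
  then obtain B where B: "\<And>\<zeta>. \<zeta> \<in> sphere 0 1 \<Longrightarrow> norm (g \<zeta>) \<le> B"
    using bounded_iff compact_imp_bounded by (metis imageI)
  have fi: "integrable circle_measure (\<lambda>\<theta>. f (cis \<theta>))"
    using f by (simp add: circle_L1_iff_integrable)
  show ?thesis
    unfolding circle_L1_iff_integrable
  proof (rule Bochner_Integration.integrable_bound)
    show "integrable circle_measure (\<lambda>\<theta>. B *\<^sub>R f (cis \<theta>))"
      using fi by simp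
    show "(\<lambda>\<theta>. f (cis \<theta>) * g (cis \<theta>)) \<in> borel_measurable circle_measure"
      using fi continuous_on_sphere_measurable[OF g] by measurable
    have "norm (g (cis \<theta>)) \<le> \<bar>B\<bar>" for \<theta>
      using B[of "cis \<theta>"] by simp
    then show "AE \<theta> in circle_measure. norm (f (cis \<theta>) * g (cis \<theta>)) \<le> norm (B *\<^sub>R f (cis \<theta>))"
      by (auto simp: norm_mult mult.commute[of "norm (f _)"] intro!: mult_right_mono)
  qed
qed

lemma circle_L1_add: "circle_L1 f \<Longrightarrow> circle_L1 g \<Longrightarrow> circle_L1 (\<lambda>\<zeta>. f \<zeta> + g \<zeta>)"
  by (simp add: circle_L1_iff_integrable)

lemma circle_L1_diff: "circle_L1 f \<Longrightarrow> circle_L1 g \<Longrightarrow> circle_L1 (\<lambda>\<zeta>. f \<zeta> - g \<zeta>)"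
  by (simp add: circle_L1_iff_integrable)

lemma circle_L1_cmult: "circle_L1 f \<Longrightarrow> circle_L1 (\<lambda>\<zeta>. c * f \<zeta>)"
  by (simp add: circle_L1_iff_integrable)

lemma circle_L1_sum:
  "(\<And>i. i \<in> A \<Longrightarrow> circle_L1 (f i)) \<Longrightarrow> circle_L1 (\<lambda>\<zeta>. \<Sum>i\<in>A. f i \<zeta>)"
  by (simp add: circle_L1_iff_integrable)

lemma circle_int_add:
  "circle_L1 f \<Longrightarrow> circle_L1 g \<Longrightarrow> circle_int (\<lambda>\<zeta>. f \<zeta> + g \<zeta>) = circle_int f + circle_int g"
  by (simp add: circle_int_eq_lebesgue circle_L1_add)
     (simp add: circle_L1_iff_integrable add_divide_distrib)

lemma circle_int_diff:
  "circle_L1 f \<Longrightarrow> circle_L1 g \<Longrightarrow> circle_int (\<lambda>\<zeta>. f \<zeta> - g \<zeta>) = circle_int f - circle_int g"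
  by (simp add: circle_int_eq_lebesgue circle_L1_diff)
     (simp add: circle_L1_iff_integrable diff_divide_distrib)

lemma circle_int_cmult: "circle_int (\<lambda>\<zeta>. c * f \<zeta>) = c * circle_int f"
  by (simp add: circle_int_eq)

lemma circle_int_sum:
  "finite A \<Longrightarrow> (\<And>i. i \<in> A \<Longrightarrow> circle_L1 (f i)) \<Longrightarrow>
     circle_int (\<lambda>\<zeta>. \<Sum>i\<in>A. f i \<zeta>) = (\<Sum>i\<in>A. circle_int (f i))"
  by (simp add: circle_int_eq_lebesgue circle_L1_sum)
     (simp add: circle_L1_iff_integrable sum_divide_distrib)

text \<open>
  Dominated convergence along the filter \<open>at t within D\<close>. The bound may fail on a finite set
  depending on \<open>s\<close>: the singularities of \<open>w\<^sub>s\<close> move with \<open>s\<close>.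
\<close>
lemma tendsto_circle_int_dominated:
  fixes f :: "complex \<Rightarrow> complex \<Rightarrow> complex" and g :: "complex \<Rightarrow> real"
  assumes L1: "\<forall>\<^sub>F s in at t within D. circle_L1 (f s)"
    and bound: "\<forall>\<^sub>F s in at t within D. \<exists>S. finite S \<and>
            (\<forall>\<zeta>\<in>sphere 0 1 - S. norm (f s \<zeta>) \<le> g \<zeta>)"
    and g: "integrable circle_measure (\<lambda>\<theta>. g (cis \<theta>))"
    and l: "circle_L1 l"
    and lim: "finite exc" "\<And>\<zeta>. \<zeta> \<in> sphere 0 1 - exc \<Longrightarrow> ((\<lambda>s. f s \<zeta>) \<longlongrightarrow> l \<zeta>) (at t within D)"
  shows "((\<lambda>s. circle_int (f s)) \<longlongrightarrow> circle_int l) (at t within D)"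
  unfolding tendsto_at_iff_sequentially
proof safe
  fix X assume X: "\<forall>i. X i \<in> D - {t}" "X \<longlonglongrightarrow> t"
  then have XF: "filterlim X (at t within D) sequentially"
    by (auto simp: filterlim_at)
  from eventually_conj[OF L1 bound]
  have "\<forall>\<^sub>F n in sequentially. circle_L1 (f (X n)) \<and>
      (\<exists>S. finite S \<and> (\<forall>\<zeta>\<in>sphere 0 1 - S. norm (f (X n) \<zeta>) \<le> g \<zeta>))"
    using XF by (rule eventually_compose_filterlim)
  then obtain N where N: "\<And>n. n \<ge> N \<Longrightarrow> circle_L1 (f (X n)) \<and>
      (\<exists>S. finite S \<and> (\<forall>\<zeta>\<in>sphere 0 1 - S. norm (f (X n) \<zeta>) \<le> g \<zeta>))"
    unfolding eventually_sequentially by blast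
  have L: "(\<lambda>n. \<integral>\<theta>. f (X (n + N)) (cis \<theta>) \<partial>circle_measure) \<longlonglongrightarrow> (\<integral>\<theta>. l (cis \<theta>) \<partial>circle_measure)"
  proof (rule integral_dominated_convergence[where w = "\<lambda>\<theta>. g (cis \<theta>)"])
    show "(\<lambda>\<theta>. l (cis \<theta>)) \<in> borel_measurable circle_measure"
      using l by (auto simp: circle_L1_iff_integrable)
    show "(\<lambda>\<theta>. f (X (n + N)) (cis \<theta>)) \<in> borel_measurable circle_measure" for n
      using N[of "n + N"] by (auto simp: circle_L1_iff_integrable)
    show "AE \<theta> in circle_measure. norm (f (X (n + N)) (cis \<theta>)) \<le> g (cis \<theta>)" for n
      using N[of "n + N"] AE_circle_measure_finite[of _ "\<lambda>\<zeta>. norm (f (X (n + N)) \<zeta>) \<le> g \<zeta>"]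
      by auto
    show "AE \<theta> in circle_measure. (\<lambda>n. f (X (n + N)) (cis \<theta>)) \<longlonglongrightarrow> l (cis \<theta>)"
    proof (rule AE_circle_measure_finite[OF lim(1), of "\<lambda>\<zeta>. (\<lambda>n. f (X (n + N)) \<zeta>) \<longlonglongrightarrow> l \<zeta>"])
      fix \<zeta> assume "\<zeta> \<in> sphere 0 1 - exc"
      from filterlim_compose[OF lim(2)[OF this] XF]
      show "(\<lambda>n. f (X (n + N)) \<zeta>) \<longlonglongrightarrow> l \<zeta>"
        by (rule LIMSEQ_ignore_initial_segment)
    qed
  qed (rule g)
  have "(\<lambda>n. circle_int (f (X (n + N)))) \<longlonglongrightarrow> circle_int l"
    using N L by (simp add: circle_int_eq_lebesgue l tendsto_divide)
  then have "(\<lambda>n. circle_int (f (X n))) \<longlonglongrightarrow> circle_int l"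
    by (rule LIMSEQ_offset)
  then show "((\<lambda>s. circle_int (f s)) \<circ> X) \<longlonglongrightarrow> circle_int l"
    by (simp add: o_def)
qed

section \<open>Orthogonality and the Christoffel-Darboux formula\<close>

lemma poly_eqI_off_finite:
  fixes f g :: "complex poly"
  assumes "finite S" "\<And>x. x \<notin> S \<Longrightarrow> poly f x = poly g x"
  shows "f = g"
proof (rule ccontr)
  assume "f \<noteq> g"
  then have "finite {x. poly (f - g) x = 0}"
    by (intro poly_roots_finite) simp
  moreover have "- S \<subseteq> {x. poly (f - g) x = 0}"
    using assms(2) by auto
  ultimately have "finite (- S \<union> S)"
    using assms(1) finite_subset by blast
  then show False
    by (simp add: infinite_UNIV_char_0)
qed

text \<open>
  The reversal \<open>x ^ n * f (1 / x)\<close> with \<open>n\<close> independent of \<open>degree f\<close>, hence linear in \<open>f\<close>,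
  whereas \<open>reflect_poly\<close> reverses with respect to the exact degree.
\<close>
definition rev_poly :: "nat \<Rightarrow> complex poly \<Rightarrow> complex poly" where
  "rev_poly n f = (\<Sum>i\<le>n. monom (coeff f i) (n - i))"

lemma poly_rev_poly:
  assumes "degree f \<le> n" "x \<noteq> 0"
  shows "poly (rev_poly n f) x = x ^ n * poly f (inverse x)"
proof -
  have "poly f (inverse x) = (\<Sum>i\<le>n. coeff f i * inverse x ^ i)"
    unfolding poly_altdef using assms(1)
    by (intro sum.mono_neutral_left) (auto simp: coeff_eq_0)
  then show ?thesis
    using assms(2)
    by (auto simp: rev_poly_def poly_sum poly_monom sum_distrib_left power_diff field_simps
        intro!: sum.cong)
qed

lemma rev_poly_eq_reflect_poly: "rev_poly (degree f) f = reflect_poly f"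
  by (rule poly_eqI_off_finite[of "{0}"])
     (auto simp: poly_rev_poly poly_reflect_poly_nz)

lemma rev_poly_sum: "rev_poly n (\<Sum>k\<in>A. Polynomial.smult (c k) (f k)) = (\<Sum>k\<in>A. Polynomial.smult (c k) (rev_poly n (f k)))"
  by (rule poly_eqI_off_finite[of "{}"])
     (simp_all add: rev_poly_def poly_sum poly_monom coeff_sum sum_distrib_left sum_distrib_right
       sum.swap[of _ A] mult_ac)

lemma expand_in_graded_basis:
  fixes b :: "nat \<Rightarrow> complex poly"
  assumes "\<And>k. degree (b k) = k" "\<And>k. coeff (b k) k \<noteq> 0" "degree g \<le> N"
  shows "\<exists>c. g = (\<Sum>k\<le>N. Polynomial.smult (c k) (b k)) \<and> c N = coeff g N / coeff (b N) N"
  using assms(3)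
proof (induction N arbitrary: g)
  case 0
  then have "g = Polynomial.smult (coeff g 0 / coeff (b 0) 0) (b 0)"
    using assms(1)[of 0] assms(2)[of 0]
    by (auto elim!: degree_eq_zeroE)
  then show ?case
    by (intro exI[of _ "\<lambda>_. coeff g 0 / coeff (b 0) 0"]) simp
next
  case (Suc N)
  let ?a = "coeff g (Suc N) / coeff (b (Suc N)) (Suc N)"
  define h where "h = g - Polynomial.smult ?a (b (Suc N))"
  have "degree h \<le> Suc N"
    unfolding h_def using Suc.prems assms(1)[of "Suc N"]
    by (intro degree_diff_le) (auto intro: order.trans[OF degree_smult_le])
  moreover have "coeff h (Suc N) = 0"
    using assms(2)[of "Suc N"] by (simp add: h_def)
  ultimately have "degree h \<le> N"
    by (metis degree_0 le_Suc_eq leading_coeff_0_iff zero_le)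
  from Suc.IH[OF this] obtain c where c: "h = (\<Sum>k\<le>N. Polynomial.smult (c k) (b k))"
    by blast
  have "g = (\<Sum>k\<le>Suc N. Polynomial.smult ((c(Suc N := ?a)) k) (b k))"
    using c by (simp add: h_def algebra_simps)
  then show ?case
    by (intro exI[of _ "c(Suc N := ?a)"]) simp
qed

text \<open>
  Facts at a fixed time that depend on the weight through its moments only.
\<close>
locale biorthonormal_weight =
  fixes w :: "complex \<Rightarrow> complex" and \<kappa> :: "nat \<Rightarrow> complex" and p q :: "nat \<Rightarrow> complex poly"
  assumes biorth: "biorthonormal w \<kappa> p q"
    and w_L1: "circle_L1 w"
begin

lemma \<kappa>_nz [simp]: "\<kappa> k \<noteq> 0"
  and degree_p [simp]: "degree (p k) = k"
  and degree_q [simp]: "degree (q k) = k"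
  and coeff_p [simp]: "coeff (p k) k = \<kappa> k"
  and coeff_q [simp]: "coeff (q k) k = \<kappa> k"
  using biorth unfolding biorthonormal_def by metis+

definition pairing :: "(complex \<Rightarrow> complex) \<Rightarrow> complex" where
  "pairing f = circle_int (\<lambda>\<zeta>. w \<zeta> * f \<zeta>)"

definition paired :: "(complex \<Rightarrow> complex) \<Rightarrow> bool" where
  "paired f \<longleftrightarrow> circle_L1 (\<lambda>\<zeta>. w \<zeta> * f \<zeta>)"

lemma paired_continuous: "continuous_on (sphere 0 1) f \<Longrightarrow> paired f"
  unfolding paired_def by (intro circle_L1_mult_continuous w_L1)

lemma paired_mult_continuous: "paired f \<Longrightarrow> continuous_on (sphere 0 1) g \<Longrightarrow> paired (\<lambda>\<zeta>. f \<zeta> * g \<zeta>)"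
  unfolding paired_def using circle_L1_mult_continuous[of "\<lambda>\<zeta>. w \<zeta> * f \<zeta>" g]
  by (simp add: mult.assoc)

lemma paired_add: "paired f \<Longrightarrow> paired g \<Longrightarrow> paired (\<lambda>\<zeta>. f \<zeta> + g \<zeta>)"
  unfolding paired_def by (simp add: distrib_left circle_L1_add)

lemma paired_diff: "paired f \<Longrightarrow> paired g \<Longrightarrow> paired (\<lambda>\<zeta>. f \<zeta> - g \<zeta>)"
  unfolding paired_def by (simp add: right_diff_distrib circle_L1_diff)

lemma paired_cmult: "paired f \<Longrightarrow> paired (\<lambda>\<zeta>. c * f \<zeta>)"
  unfolding paired_def using circle_L1_cmult[of "\<lambda>\<zeta>. w \<zeta> * f \<zeta>" c] by (simp add: mult.left_commute)

lemma pairing_add: "paired f \<Longrightarrow> paired g \<Longrightarrow> pairing (\<lambda>\<zeta>. f \<zeta> + g \<zeta>) = pairing f + pairing g"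
  unfolding pairing_def paired_def by (simp add: distrib_left circle_int_add)

lemma pairing_diff: "paired f \<Longrightarrow> paired g \<Longrightarrow> pairing (\<lambda>\<zeta>. f \<zeta> - g \<zeta>) = pairing f - pairing g"
  unfolding pairing_def paired_def by (simp add: right_diff_distrib circle_int_diff)

lemma pairing_cmult: "pairing (\<lambda>\<zeta>. c * f \<zeta>) = c * pairing f"
  unfolding pairing_def using circle_int_cmult[of c "\<lambda>\<zeta>. w \<zeta> * f \<zeta>"] by (simp add: mult.left_commute)

lemma pairing_sum:
  "finite A \<Longrightarrow> (\<And>i. i \<in> A \<Longrightarrow> paired (f i)) \<Longrightarrow>
    pairing (\<lambda>\<zeta>. \<Sum>i\<in>A. f i \<zeta>) = (\<Sum>i\<in>A. pairing (f i))"
  unfolding pairing_def paired_def by (simp add: sum_distrib_left circle_int_sum)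

lemma pairing_lincomb:
  "paired f \<Longrightarrow> paired g \<Longrightarrow>
    pairing (\<lambda>\<zeta>. a * f \<zeta> + b * g \<zeta>) = a * pairing f + b * pairing g"
  by (simp only: pairing_add paired_cmult pairing_cmult)

lemma pairing_lincomb_sum:
  "finite A \<Longrightarrow> (\<And>i. i \<in> A \<Longrightarrow> paired (f i)) \<Longrightarrow>
    pairing (\<lambda>\<zeta>. \<Sum>i\<in>A. c i * f i \<zeta>) = (\<Sum>i\<in>A. c i * pairing (f i))"
  by (simp only: pairing_sum paired_cmult pairing_cmult)

lemma pairing_cong:
  "finite S \<Longrightarrow> (\<And>\<zeta>. norm \<zeta> = 1 \<Longrightarrow> \<zeta> \<notin> S \<Longrightarrow> f \<zeta> = g \<zeta>) \<Longrightarrow> pairing f = pairing g"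
  unfolding pairing_def by (rule circle_int_cong_finite[of S]) auto

lemma paired_cong:
  "finite S \<Longrightarrow> (\<And>\<zeta>. norm \<zeta> = 1 \<Longrightarrow> \<zeta> \<notin> S \<Longrightarrow> f \<zeta> = g \<zeta>) \<Longrightarrow> paired f \<longleftrightarrow> paired g"
  unfolding paired_def by (rule circle_L1_cong_finite[of S]) auto

lemma sphere_nz: "\<forall>\<zeta>\<in>sphere 0 1. \<zeta> \<noteq> (0::complex)"
  by auto

lemmas poly_inverse_intros = continuous_intros continuous_on_poly sphere_nz

lemma paired_poly: "paired (\<lambda>\<zeta>. poly f \<zeta> * poly g (inverse \<zeta>))"
  by (intro paired_continuous poly_inverse_intros)

lemma pairing_p_q: "pairing (\<lambda>\<zeta>. poly (p i) \<zeta> * poly (q k) (inverse \<zeta>)) = (if i = k then 1 else 0)"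
  using biorth unfolding biorthonormal_def pairing_def by (simp add: mult.assoc)

text \<open>
  Only the component of \<open>g\<close> along \<open>q i\<close> survives, and that component is the quotient of the
  leading coefficients.
\<close>
lemma pairing_p:
  assumes "degree g \<le> i"
  shows "pairing (\<lambda>\<zeta>. poly (p i) \<zeta> * poly g (inverse \<zeta>)) = coeff g i / \<kappa> i"
proof -
  obtain c where c: "g = (\<Sum>k\<le>i. Polynomial.smult (c k) (q k))" "c i = coeff g i / \<kappa> i"
    using expand_in_graded_basis[of q g i] assms by auto
  have "pairing (\<lambda>\<zeta>. poly (p i) \<zeta> * poly g (inverse \<zeta>)) =
      pairing (\<lambda>\<zeta>. \<Sum>k\<le>i. c k * (poly (p i) \<zeta> * poly (q k) (inverse \<zeta>)))"
    by (subst c(1)) (simp add: poly_sum sum_distrib_left mult.left_commute)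
  also have "\<dots> = (\<Sum>k\<le>i. c k * (if i = k then 1 else 0))"
    by (subst pairing_lincomb_sum) (auto simp: pairing_p_q intro!: paired_poly)
  also have "\<dots> = c i"
    by (simp add: if_distrib[of "\<lambda>x. _ * x"] cong: if_cong)
  finally show ?thesis
    using c(2) by simp
qed

lemma pairing_q:
  assumes "degree f \<le> i"
  shows "pairing (\<lambda>\<zeta>. poly f \<zeta> * poly (q i) (inverse \<zeta>)) = coeff f i / \<kappa> i"
proof -
  obtain c where c: "f = (\<Sum>k\<le>i. Polynomial.smult (c k) (p k))" "c i = coeff f i / \<kappa> i"
    using expand_in_graded_basis[of p f i] assms by auto
  have "pairing (\<lambda>\<zeta>. poly f \<zeta> * poly (q i) (inverse \<zeta>)) =
      pairing (\<lambda>\<zeta>. \<Sum>k\<le>i. c k * (poly (p k) \<zeta> * poly (q i) (inverse \<zeta>)))"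
    by (subst c(1)) (simp add: poly_sum sum_distrib_left sum_distrib_right mult_ac)
  also have "\<dots> = (\<Sum>k\<le>i. c k * (if k = i then 1 else 0))"
    by (subst pairing_lincomb_sum) (auto simp: pairing_p_q intro!: paired_poly)
  also have "\<dots> = c i"
    by (simp add: if_distrib[of "\<lambda>x. _ * x"] cong: if_cong)
  finally show ?thesis
    using c(2) by simp
qed

lemma expand_p:
  assumes "degree f \<le> n"
  shows "f = (\<Sum>k\<le>n. Polynomial.smult (pairing (\<lambda>\<zeta>. poly f \<zeta> * poly (q k) (inverse \<zeta>))) (p k))"
proof -
  obtain c where c: "f = (\<Sum>k\<le>n. Polynomial.smult (c k) (p k))"
    using expand_in_graded_basis[of p f n] assms by auto
  have "pairing (\<lambda>\<zeta>. poly f \<zeta> * poly (q i) (inverse \<zeta>)) = c i" if "i \<le> n" for i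
  proof -
    have "pairing (\<lambda>\<zeta>. poly f \<zeta> * poly (q i) (inverse \<zeta>)) =
        pairing (\<lambda>\<zeta>. \<Sum>k\<le>n. c k * (poly (p k) \<zeta> * poly (q i) (inverse \<zeta>)))"
      by (subst c) (simp add: poly_sum sum_distrib_left sum_distrib_right mult_ac)
    also have "\<dots> = (\<Sum>k\<le>n. c k * (if k = i then 1 else 0))"
      by (subst pairing_lincomb_sum) (auto simp: pairing_p_q intro!: paired_poly)
    also have "\<dots> = c i"
      using that by (simp add: if_distrib[of "\<lambda>x. _ * x"] cong: if_cong)
    finally show ?thesis .
  qed
  then show ?thesis
    using c by (auto intro!: sum.cong)
qed

text \<open>
  The reciprocal polynomial \<open>\<phi>\<^sub>n\<^sup>*\<close>.
\<close>
abbreviation ps :: "nat \<Rightarrow> complex poly" where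
  "ps n \<equiv> reflect_poly (q n)"

lemma degree_ps: "degree (ps n) \<le> n"
  using degree_reflect_poly_le[of "q n"] by simp

lemma poly_ps: "x \<noteq> 0 \<Longrightarrow> poly (ps n) x = x ^ n * poly (q n) (inverse x)"
  by (simp add: poly_reflect_poly_nz)

lemma rev_poly_q: "rev_poly n (q n) = ps n"
  using rev_poly_eq_reflect_poly[of "q n"] by simp

lemma pairing_p_monom:
  "k \<le> n \<Longrightarrow> pairing (\<lambda>\<zeta>. poly (p n) \<zeta> * inverse \<zeta> ^ k) = (if k = n then 1 / \<kappa> n else 0)"
  using pairing_p[of "monom 1 k" n] by (simp add: poly_monom degree_monom_eq)

lemma pairing_q_monom:
  "k \<le> n \<Longrightarrow> pairing (\<lambda>\<zeta>. \<zeta> ^ k * poly (q n) (inverse \<zeta>)) = (if k = n then 1 / \<kappa> n else 0)"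
  using pairing_q[of "monom 1 k" n] by (simp add: poly_monom degree_monom_eq)

text \<open>
  Since \<open>rev_poly n (q k)\<close> takes the value \<open>z ^ n * q k (1 / z)\<close>, this is \<open>z ^ n\<close> times the
  Christoffel-Darboux kernel, polynomial in both variables.
\<close>
definition kernel :: "nat \<Rightarrow> complex \<Rightarrow> complex \<Rightarrow> complex" where
  "kernel n z x = (\<Sum>k\<le>n. poly (rev_poly n (q k)) z * poly (p k) x)"

text \<open>
  The right-hand side, as a polynomial \<open>N\<close> in \<open>x\<close>, vanishes at \<open>x = z\<close>; let \<open>Q\<close> be the quotient
  \<open>N / (x - z)\<close>. Multiplying a power of \<open>1 / \<zeta>\<close> by \<open>(\<zeta> - z) / \<zeta>\<close> shows, because \<open>p n\<close> and \<open>q n\<close>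
  are orthogonal to lower powers, that pairing \<open>Q\<close> with \<open>\<zeta> ^ (- k)\<close> gives \<open>z ^ (- k)\<close> times the
  pairing of \<open>Q\<close> with \<open>1\<close>, for \<open>k \<le> n\<close>. So \<open>Q\<close> reproduces polynomials in \<open>1 / \<zeta>\<close> of degree at most
  \<open>n\<close> up to a constant, which makes it a multiple of the kernel. Comparing leading coefficients
  fixes the constant, and this is where \<open>poly (ps n) z\<close> is divided out.
\<close>
lemma christoffel_darboux_generic:
  assumes z: "z \<noteq> 0" "poly (ps n) z \<noteq> 0"
  shows "(x - z) * kernel n z x = x * poly (p n) x * poly (ps n) z - z * poly (p n) z * poly (ps n) x"
proof -
  define N where "N = Polynomial.smult (poly (ps n) z) ([:0, 1:] * p n) - Polynomial.smult (z * poly (p n) z) (ps n)"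
  have "poly N z = 0"
    by (simp add: N_def)
  then obtain Q where Q: "N = [:- z, 1:] * Q"
    by (auto simp: poly_eq_0_iff_dvd dvd_def)
  have N_x: "poly N x = x * poly (p n) x * poly (ps n) z - z * poly (p n) z * poly (ps n) x" for x
    by (simp add: N_def)
  have NQ: "poly N x = (x - z) * poly Q x" for x
    by (simp add: Q algebra_simps)
  have degN: "degree N \<le> Suc n"
    unfolding N_def using degree_ps[of n] degree_mult_le[of "[:0, 1:]" "p n"]
    by (intro degree_diff_le) (auto intro!: order.trans[OF degree_smult_le])
  have degQ: "degree Q \<le> n"
  proof (cases "Q = 0")
    case False
    then have "degree N = Suc (degree Q)"
      unfolding Q by (subst degree_mult_eq) auto
    then show ?thesis using degN by simp
  qed simp
  have coeffQ: "coeff Q n = \<kappa> n * poly (ps n) z"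
  proof -
    have "coeff N (Suc n) = coeff Q n"
      using degQ by (subst Q) (simp add: coeff_eq_0)
    moreover have "coeff N (Suc n) = poly (ps n) z * \<kappa> n"
      using degree_ps[of n] by (simp add: N_def coeff_eq_0)
    ultimately have "coeff Q n = poly (ps n) z * \<kappa> n" by (rule subst)
    then show ?thesis by (simp only: mult.commute)
  qed
  define J where "J = (\<lambda>k. pairing (\<lambda>\<zeta>. poly Q \<zeta> * inverse \<zeta> ^ k))"
  have paired_k: "paired (\<lambda>\<zeta>. poly f \<zeta> * inverse \<zeta> ^ k)" for f k
    by (intro paired_continuous poly_inverse_intros)
  have paired_q_k: "paired (\<lambda>\<zeta>. \<zeta> ^ k * poly f (inverse \<zeta>))" for f k
    by (intro paired_continuous poly_inverse_intros)
  \<comment> \<open>The recursion for the pairings of \<open>Q\<close> with powers of \<open>1 / \<zeta>\<close> uses the orthogonality of \<open>p n\<close> to \<open>\<zeta> ^ k\<close> and of \<open>q n\<close> to \<open>\<zeta> ^ (n - Suc k)\<close>; both are of degree below \<open>n\<close> and exhaust the range \<open>k < n\<close>.\<close>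
  have J_Suc: "J k = z * J (Suc k)" if "k < n" for k
  proof -
    have "J k - z * J (Suc k) =
        pairing (\<lambda>\<zeta>. poly Q \<zeta> * inverse \<zeta> ^ k - z * (poly Q \<zeta> * inverse \<zeta> ^ Suc k))"
      unfolding J_def by (simp only: pairing_diff pairing_cmult paired_cmult paired_k)
    also have "\<dots> = pairing (\<lambda>\<zeta>. poly (ps n) z * (poly (p n) \<zeta> * inverse \<zeta> ^ k)
        - z * poly (p n) z * (\<zeta> ^ (n - Suc k) * poly (q n) (inverse \<zeta>)))"
    proof (rule pairing_cong[of "{}"])
      fix \<zeta> :: complex assume "norm \<zeta> = 1"
      then have nz: "\<zeta> \<noteq> 0" by auto
      have "\<zeta> ^ n = \<zeta> ^ Suc k * \<zeta> ^ (n - Suc k)"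
        using that by (simp add: power_add[symmetric] del: power_Suc)
      then have ps: "inverse \<zeta> ^ Suc k * poly (ps n) \<zeta> = \<zeta> ^ (n - Suc k) * poly (q n) (inverse \<zeta>)"
        using nz by (simp add: poly_ps field_simps)
      have "poly Q \<zeta> * inverse \<zeta> ^ k - z * (poly Q \<zeta> * inverse \<zeta> ^ Suc k) = poly N \<zeta> * inverse \<zeta> ^ Suc k"
        using nz by (simp add: NQ field_simps)
      also have "\<dots> = poly (ps n) z * (poly (p n) \<zeta> * inverse \<zeta> ^ k)
          - z * poly (p n) z * (inverse \<zeta> ^ Suc k * poly (ps n) \<zeta>)"
        using nz by (simp add: N_x field_simps)
      finally show "poly Q \<zeta> * inverse \<zeta> ^ k - z * (poly Q \<zeta> * inverse \<zeta> ^ Suc k) =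
          poly (ps n) z * (poly (p n) \<zeta> * inverse \<zeta> ^ k)
          - z * poly (p n) z * (\<zeta> ^ (n - Suc k) * poly (q n) (inverse \<zeta>))"
        by (simp only: ps)
    qed simp
    also have "\<dots> = poly (ps n) z * pairing (\<lambda>\<zeta>. poly (p n) \<zeta> * inverse \<zeta> ^ k)
        - z * poly (p n) z * pairing (\<lambda>\<zeta>. \<zeta> ^ (n - Suc k) * poly (q n) (inverse \<zeta>))"
      by (subst pairing_diff)
         (simp_all only: pairing_cmult paired_cmult paired_k paired_q_k)
    also have "\<dots> = 0"
      using that by (simp add: pairing_p_monom pairing_q_monom)
    finally show ?thesis by simp
  qed
  have J_eq: "J k = inverse z ^ k * J 0" if "k \<le> n" for k
    using that
  proof (induction k)
    case (Suc k)
    then have "J k = z * J (Suc k)" by (intro J_Suc) simp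
    then show ?case using Suc z(1) by (simp add: field_simps)
  qed simp
  have c: "pairing (\<lambda>\<zeta>. poly Q \<zeta> * poly (q k) (inverse \<zeta>)) = poly (q k) (inverse z) * J 0"
    if "k \<le> n" for k
  proof -
    have "pairing (\<lambda>\<zeta>. poly Q \<zeta> * poly (q k) (inverse \<zeta>)) =
        pairing (\<lambda>\<zeta>. \<Sum>i\<le>k. coeff (q k) i * (poly Q \<zeta> * inverse \<zeta> ^ i))"
      by (simp add: poly_altdef sum_distrib_left mult.left_commute)
    also have "\<dots> = (\<Sum>i\<le>k. coeff (q k) i * J i)"
      unfolding J_def by (intro pairing_lincomb_sum paired_k) simp
    also have "\<dots> = poly (q k) (inverse z) * J 0"
      unfolding poly_altdef sum_distrib_right degree_q
    proof (intro sum.cong refl)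
      fix i assume "i \<in> {..k}"
      then show "coeff (q k) i * J i = coeff (q k) i * inverse z ^ i * J 0"
        using J_eq[of i] that by simp
    qed
    finally show ?thesis .
  qed
  have Q_sum: "Q = (\<Sum>k\<le>n. Polynomial.smult (poly (q k) (inverse z) * J 0) (p k))"
    by (rule trans[OF expand_p[OF degQ]]) (intro sum.cong refl, simp add: c)
  have "coeff Q n = (\<Sum>k\<le>n. (poly (q k) (inverse z) * J 0) * coeff (p k) n)"
    by (subst Q_sum) (simp add: coeff_sum)
  also have "\<dots> = (\<Sum>k\<in>{n}. (poly (q k) (inverse z) * J 0) * coeff (p k) n)"
    by (rule sum.mono_neutral_right) (auto simp: coeff_eq_0)
  finally have "\<kappa> n * poly (ps n) z = poly (q n) (inverse z) * J 0 * \<kappa> n"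
    using coeffQ by simp
  then have J0: "J 0 = z ^ n"
    using z by (auto simp: poly_ps)
  have "poly Q x = kernel n z x"
    by (subst Q_sum) (auto simp: J0 kernel_def poly_sum poly_rev_poly z intro!: sum.cong)
  then show ?thesis
    using NQ[of x] N_x[of x] by simp
qed

text \<open>
  For fixed \<open>x\<close> both sides are polynomials in \<open>z\<close>, so the finitely many values of \<open>z\<close> excluded
  above are recovered.
\<close>
lemma christoffel_darboux:
  "(x - z) * kernel n z x = x * poly (p n) x * poly (ps n) z - z * poly (p n) z * poly (ps n) x"
proof -
  define L where "L = [:x, -1:] * (\<Sum>k\<le>n. Polynomial.smult (poly (p k) x) (rev_poly n (q k)))"
  define R where "R = Polynomial.smult (x * poly (p n) x) (ps n) - Polynomial.smult (poly (ps n) x) ([:0, 1:] * p n)"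
  have L: "poly L z = (x - z) * kernel n z x" for z
    by (simp add: L_def kernel_def poly_sum mult.commute left_diff_distrib)
  have R: "poly R z = x * poly (p n) x * poly (ps n) z - z * poly (p n) z * poly (ps n) x" for z
    by (simp add: R_def)
  have "ps n \<noteq> 0"
  proof
    assume "ps n = 0"
    then have "q n = 0" by (simp only: reflect_poly_eq_0_iff)
    then have "coeff (q n) n = 0" by (simp only: coeff_0)
    then show False by (simp only: coeff_q \<kappa>_nz)
  qed
  then have "finite (insert 0 {z. poly (ps n) z = 0})"
    by (simp add: poly_roots_finite)
  then have "L = R"
    by (rule poly_eqI_off_finite) (use christoffel_darboux_generic in \<open>auto simp: L R\<close>)
  then show ?thesis
    using L R by metis
qed

text \<open>
  Reproduction of the constant \<open>1\<close>.
\<close>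
lemma pairing_kernel: "pairing (kernel n z) = z ^ n"
proof -
  obtain a where a: "q 0 = [:a:]"
    using degree_q[of 0] degree_eq_zeroE by blast
  have pk: "pairing (poly (p k)) * a = (if k = 0 then 1 else 0)" for k
  proof -
    have "pairing (\<lambda>\<zeta>. a * poly (p k) \<zeta>) = (if k = 0 then 1 else 0)"
      using pairing_p_q[of k 0] by (simp add: a mult.commute)
    then show ?thesis
      by (simp add: pairing_cmult mult.commute)
  qed
  have a_nz: "a \<noteq> 0"
    using pk[of 0] by auto
  have "pairing (kernel n z) = (\<Sum>k\<le>n. poly (rev_poly n (q k)) z * pairing (poly (p k)))"
    unfolding kernel_def
    by (intro pairing_lincomb_sum paired_continuous poly_inverse_intros) simp
  also have "\<dots> = (\<Sum>k\<in>{0}. poly (rev_poly n (q k)) z * pairing (poly (p k)))"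
  proof (intro sum.mono_neutral_right ballI)
    fix k assume "k \<in> {..n} - {0}"
    then have "pairing (poly (p k)) = 0"
      using pk[of k] a_nz by auto
    then show "poly (rev_poly n (q k)) z * pairing (poly (p k)) = 0"
      by simp
  qed auto
  also have "\<dots> = z ^ n * (pairing (poly (p 0)) * a)"
  proof -
    have "rev_poly n (q 0) = monom a n"
      by (rule poly_eqI_off_finite[of "{0}"]) (auto simp: poly_rev_poly a poly_monom)
    then show ?thesis by (simp add: poly_monom)
  qed
  finally show ?thesis
    by (simp add: pk)
qed

end

section \<open>Pairings with a simple pole\<close>

context biorthonormal_weight
begin

text \<open>
  For \<open>z\<close> on the circle this is a genuine condition on the weight. It holds at singularities on
  the circle, where \<open>w\<close> vanishes to a positive order.
\<close>
definition pole_integrable :: "complex \<Rightarrow> bool" where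
  "pole_integrable z \<longleftrightarrow> paired (\<lambda>\<zeta>. 1 / (\<zeta> - z))"

text \<open>
  The Cauchy transform of \<open>w f\<close>. Both associated functions are multiples of such transforms.
\<close>
definition cauchy :: "complex poly \<Rightarrow> complex \<Rightarrow> complex" where
  "cauchy f z = pairing (\<lambda>\<zeta>. poly f \<zeta> / (\<zeta> - z))"

lemma pole_integrable_off_circle: "z \<notin> sphere 0 1 \<Longrightarrow> pole_integrable z"
  unfolding pole_integrable_def
  by (intro paired_continuous continuous_intros) auto

lemma paired_divide_pole:
  "pole_integrable z \<Longrightarrow> continuous_on (sphere 0 1) f \<Longrightarrow> paired (\<lambda>\<zeta>. f \<zeta> / (\<zeta> - z))"
  unfolding pole_integrable_def
  by (drule paired_mult_continuous) (auto simp: field_simps)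

lemma paired_poly_pole: "pole_integrable z \<Longrightarrow> paired (\<lambda>\<zeta>. poly f \<zeta> / (\<zeta> - z))"
  by (intro paired_divide_pole poly_inverse_intros)

lemma cauchy_smult: "cauchy (Polynomial.smult c f) z = c * cauchy f z"
  unfolding cauchy_def by (simp add: pairing_cmult[symmetric])

lemma cauchy_sum:
  assumes "pole_integrable z" "finite A"
  shows "cauchy (\<Sum>k\<in>A. Polynomial.smult (c k) (f k)) z = (\<Sum>k\<in>A. c k * cauchy (f k) z)"
proof -
  have "cauchy (\<Sum>k\<in>A. Polynomial.smult (c k) (f k)) z =
      pairing (\<lambda>\<zeta>. \<Sum>k\<in>A. c k * (poly (f k) \<zeta> / (\<zeta> - z)))"
    unfolding cauchy_def by (simp add: poly_sum sum_divide_distrib)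
  also have "\<dots> = (\<Sum>k\<in>A. c k * cauchy (f k) z)"
    unfolding cauchy_def using assms by (intro pairing_lincomb_sum paired_poly_pole)
  finally show ?thesis .
qed

text \<open>
  A factor \<open>\<zeta> = (\<zeta> - z) + z\<close> is moved out of the Cauchy transform.
\<close>
lemma cauchy_pCons:
  assumes "pole_integrable z"
  shows "cauchy (pCons c f) z = c * cauchy 1 z + pairing (poly f) + z * cauchy f z"
proof -
  have "cauchy (pCons c f) z =
      pairing (\<lambda>\<zeta>. poly f \<zeta> + (c * (poly 1 \<zeta> / (\<zeta> - z)) + z * (poly f \<zeta> / (\<zeta> - z))))"
    unfolding cauchy_def
    by (rule pairing_cong[of "{z}"]) (auto simp: divide_simps, auto simp: algebra_simps)
  also have "\<dots> = pairing (poly f) + (c * cauchy 1 z + z * cauchy f z)"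
  proof -
    note int = paired_poly_pole[OF assms, of 1] paired_poly_pole[OF assms, of f]
    have "paired (poly f)"
      by (intro paired_continuous poly_inverse_intros)
    then show ?thesis
      unfolding cauchy_def
      by (simp only: pairing_add pairing_cmult paired_add paired_cmult int)
  qed
  finally show ?thesis by simp
qed

lemma pairing_p_zero: "n \<ge> 1 \<Longrightarrow> pairing (poly (p n)) = 0"
  using pairing_p_monom[of 0 n] by simp

lemma pairing_q_zero: "n \<ge> 1 \<Longrightarrow> pairing (\<lambda>\<zeta>. poly (q n) (inverse \<zeta>)) = 0"
  using pairing_q_monom[of 0 n] by simp

text \<open>
  \<open>(\<zeta> + z) / (\<zeta> - z) = 1 + 2 * z / (\<zeta> - z)\<close>, and the constant is annihilated by orthogonality.
\<close>
lemma assoc_integral_eq_cauchy: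
  assumes "pole_integrable z" "n \<ge> 1"
  shows "circle_int (\<lambda>\<zeta>. (\<zeta> + z) / (\<zeta> - z) * w \<zeta> * poly (p n) \<zeta>) = 2 * z * cauchy (p n) z"
proof -
  have "circle_int (\<lambda>\<zeta>. (\<zeta> + z) / (\<zeta> - z) * w \<zeta> * poly (p n) \<zeta>) =
      pairing (\<lambda>\<zeta>. 1 * poly (p n) \<zeta> + 2 * z * (poly (p n) \<zeta> / (\<zeta> - z)))"
    unfolding pairing_def
    by (rule circle_int_cong_finite[of "{z}"]) (auto simp: divide_simps, auto simp: algebra_simps)
  also have "\<dots> = 1 * pairing (poly (p n)) + 2 * z * cauchy (p n) z"
    unfolding cauchy_def using assms(1)
    by (intro pairing_lincomb paired_poly_pole paired_continuous poly_inverse_intros)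
  finally show ?thesis
    using assms(2) by (simp add: pairing_p_zero)
qed

text \<open>
  Writing \<open>\<zeta> = (\<zeta> - z) + z\<close> exchanges a factor \<open>\<zeta>\<close> for \<open>z\<close>; the term without a pole vanishes by
  orthogonality as long as the power of \<open>\<zeta>\<close> is below \<open>n\<close>.
\<close>
lemma pairing_monom_q_pole:
  assumes "pole_integrable z" "k \<le> n"
  shows "pairing (\<lambda>\<zeta>. \<zeta> ^ k * poly (q n) (inverse \<zeta>) / (\<zeta> - z)) =
    z ^ k * pairing (\<lambda>\<zeta>. poly (q n) (inverse \<zeta>) / (\<zeta> - z))"
  using assms(2)
proof (induction k)
  case (Suc k)
  have "pairing (\<lambda>\<zeta>. \<zeta> ^ Suc k * poly (q n) (inverse \<zeta>) / (\<zeta> - z)) =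
      pairing (\<lambda>\<zeta>. 1 * (\<zeta> ^ k * poly (q n) (inverse \<zeta>)) + z * (\<zeta> ^ k * poly (q n) (inverse \<zeta>) / (\<zeta> - z)))"
    by (rule pairing_cong[of "{z}"]) (auto simp: divide_simps, auto simp: algebra_simps)
  also have "\<dots> = 1 * pairing (\<lambda>\<zeta>. \<zeta> ^ k * poly (q n) (inverse \<zeta>)) +
      z * pairing (\<lambda>\<zeta>. \<zeta> ^ k * poly (q n) (inverse \<zeta>) / (\<zeta> - z))"
    using assms(1)
    by (intro pairing_lincomb paired_divide_pole paired_continuous poly_inverse_intros)
  finally show ?case
    using Suc by (simp add: pairing_q_monom)
qed simp

lemma cauchy_ps:
  assumes "pole_integrable z"
  shows "cauchy (ps n) z = z ^ n * pairing (\<lambda>\<zeta>. poly (q n) (inverse \<zeta>) / (\<zeta> - z))"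
proof -
  have "cauchy (ps n) z = pairing (\<lambda>\<zeta>. \<zeta> ^ n * poly (q n) (inverse \<zeta>) / (\<zeta> - z))"
    unfolding cauchy_def by (rule pairing_cong[of "{0}"]) (auto simp: poly_ps)
  then show ?thesis
    using assms by (simp add: pairing_monom_q_pole)
qed

lemma recip_assoc_integral_eq_cauchy:
  assumes "pole_integrable z" "n \<ge> 1"
  shows "- (z ^ n) * circle_int (\<lambda>\<zeta>. (\<zeta> + z) / (\<zeta> - z) * w \<zeta> * poly (q n) (inverse \<zeta>)) =
    - 2 * z * cauchy (ps n) z"
proof -
  have "circle_int (\<lambda>\<zeta>. (\<zeta> + z) / (\<zeta> - z) * w \<zeta> * poly (q n) (inverse \<zeta>)) =
      pairing (\<lambda>\<zeta>. 1 * poly (q n) (inverse \<zeta>) + 2 * z * (poly (q n) (inverse \<zeta>) / (\<zeta> - z)))"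
    unfolding pairing_def
    by (rule circle_int_cong_finite[of "{z}"]) (auto simp: divide_simps, auto simp: algebra_simps)
  also have "\<dots> = 1 * pairing (\<lambda>\<zeta>. poly (q n) (inverse \<zeta>)) +
      2 * z * pairing (\<lambda>\<zeta>. poly (q n) (inverse \<zeta>) / (\<zeta> - z))"
    using assms(1)
    by (intro pairing_lincomb paired_divide_pole paired_continuous poly_inverse_intros)
  finally show ?thesis
    using assms by (simp add: pairing_q_zero cauchy_ps)
qed

text \<open>
  The closed form of the kernel expresses its pairing, which is \<open>z ^ n\<close>, through the two Cauchy
  transforms. In terms of the associated functions this is \<open>\<phi>\<^sub>n\<^sup>* \<epsilon>\<^sub>n + \<phi>\<^sub>n \<epsilon>\<^sub>n\<^sup>* = 2 z\<^sup>n\<close>.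
\<close>
lemma casoratian:
  assumes "pole_integrable z" "n \<ge> 1"
  shows "z * (poly (ps n) z * cauchy (p n) z - poly (p n) z * cauchy (ps n) z) = z ^ n"
proof -
  have "z ^ n = pairing (\<lambda>\<zeta>. 1 * (poly (ps n) z * poly (p n) \<zeta>)
      + z * (poly (ps n) z * (poly (p n) \<zeta> / (\<zeta> - z)) + (- poly (p n) z) * (poly (ps n) \<zeta> / (\<zeta> - z))))"
    unfolding pairing_kernel[symmetric, where z = z]
  proof (rule pairing_cong[of "{z}"])
    fix \<zeta> assume "\<zeta> \<notin> {z}"
    then have "kernel n z \<zeta> = (\<zeta> * poly (p n) \<zeta> * poly (ps n) z - z * poly (p n) z * poly (ps n) \<zeta>) / (\<zeta> - z)"
      by (simp add: christoffel_darboux[symmetric])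
    then show "kernel n z \<zeta> = 1 * (poly (ps n) z * poly (p n) \<zeta>)
      + z * (poly (ps n) z * (poly (p n) \<zeta> / (\<zeta> - z)) + (- poly (p n) z) * (poly (ps n) \<zeta> / (\<zeta> - z)))"
      using \<open>\<zeta> \<notin> {z}\<close> by (simp add: divide_simps) (simp add: algebra_simps)
  qed simp
  also have "\<dots> = 1 * (poly (ps n) z * pairing (poly (p n)))
      + z * (poly (ps n) z * cauchy (p n) z + (- poly (p n) z) * cauchy (ps n) z)"
  proof -
    note int = paired_poly_pole[OF assms(1), of "p n"] paired_poly_pole[OF assms(1), of "ps n"]
    have "paired (poly (p n))"
      by (intro paired_continuous poly_inverse_intros)
    then show ?thesis
      unfolding cauchy_def
      by (simp only: pairing_lincomb pairing_cmult paired_add paired_cmult int)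
  qed
  finally show ?thesis
    using assms(2) by (simp add: pairing_p_zero)
qed

text \<open>
  From \<open>1 / (\<zeta> * (\<zeta> - z)) = (1 / (\<zeta> - z) - 1 / \<zeta>) / z\<close>, each factor \<open>1 / \<zeta>\<close> is exchanged for
  \<open>1 / z\<close>. The leftover pairing is zero by orthogonality except at the last step, \<open>k = n\<close>.
\<close>
lemma pairing_p_monom_pole:
  assumes "pole_integrable z" "z \<noteq> 0" "k \<le> n"
  shows "pairing (\<lambda>\<zeta>. poly (p n) \<zeta> * inverse \<zeta> ^ k / (\<zeta> - z)) =
    inverse z ^ k * cauchy (p n) z - (if k = n \<and> n \<ge> 1 then 1 / (\<kappa> n * z) else 0)"
  using assms(3)
proof (induction k)
  case 0
  then show ?case by (cases n) (auto simp: cauchy_def)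
next
  case (Suc k)
  have "pairing (\<lambda>\<zeta>. poly (p n) \<zeta> * inverse \<zeta> ^ Suc k / (\<zeta> - z)) =
      pairing (\<lambda>\<zeta>. inverse z * (poly (p n) \<zeta> * inverse \<zeta> ^ k / (\<zeta> - z) - poly (p n) \<zeta> * inverse \<zeta> ^ Suc k))"
    by (rule pairing_cong[of "{z, 0}"]) (use assms(2) in \<open>auto simp: field_simps\<close>)
  also have "\<dots> = inverse z * (pairing (\<lambda>\<zeta>. poly (p n) \<zeta> * inverse \<zeta> ^ k / (\<zeta> - z)) -
      pairing (\<lambda>\<zeta>. poly (p n) \<zeta> * inverse \<zeta> ^ Suc k))"
    unfolding pairing_cmult using assms(1)
    by (subst pairing_diff; (intro paired_divide_pole paired_continuous poly_inverse_intros)?) simp_all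
  also have "\<dots> = inverse z * (inverse z ^ k * cauchy (p n) z - (if Suc k = n then 1 / \<kappa> n else 0))"
    using Suc.prems Suc.IH by (simp only: pairing_p_monom) simp
  finally show ?case
    using assms(2) Suc.prems by (auto simp: right_diff_distrib divide_inverse mult_ac)
qed

lemma pairing_p_pole:
  assumes "pole_integrable z" "z \<noteq> 0" "n \<ge> 1" "degree g \<le> n"
  shows "pairing (\<lambda>\<zeta>. poly (p n) \<zeta> * poly g (inverse \<zeta>) / (\<zeta> - z)) =
    poly g (inverse z) * cauchy (p n) z - coeff g n / (\<kappa> n * z)"
proof -
  have g: "poly g x = (\<Sum>i\<le>n. coeff g i * x ^ i)" for x
    unfolding poly_altdef using assms(4)
    by (intro sum.mono_neutral_left) (auto simp: coeff_eq_0)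
  have "pairing (\<lambda>\<zeta>. poly (p n) \<zeta> * poly g (inverse \<zeta>) / (\<zeta> - z)) =
      pairing (\<lambda>\<zeta>. \<Sum>i\<le>n. coeff g i * (poly (p n) \<zeta> * inverse \<zeta> ^ i / (\<zeta> - z)))"
    by (intro pairing_cong[of "{}"]) (simp_all add: g sum_distrib_left sum_divide_distrib mult_ac)
  also have "\<dots> = (\<Sum>i\<le>n. coeff g i * pairing (\<lambda>\<zeta>. poly (p n) \<zeta> * inverse \<zeta> ^ i / (\<zeta> - z)))"
    using assms(1)
    by (intro pairing_lincomb_sum paired_divide_pole poly_inverse_intros) simp_all
  also have "\<dots> = (\<Sum>i\<le>n. coeff g i * (inverse z ^ i * cauchy (p n) z
      - (if i = n then 1 / (\<kappa> n * z) else 0)))"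
    using assms by (intro sum.cong) (auto simp: pairing_p_monom_pole)
  also have "\<dots> = poly g (inverse z) * cauchy (p n) z - coeff g n / (\<kappa> n * z)"
    by (simp add: g right_diff_distrib sum_subtractf sum_distrib_right mult.assoc
        if_distrib[of "\<lambda>x. _ * x"] cong: if_cong)
  finally show ?thesis .
qed

lemma pairing_q_pole:
  assumes "pole_integrable z" "z \<noteq> 0" "degree f \<le> n"
  shows "pairing (\<lambda>\<zeta>. poly f \<zeta> * poly (q n) (inverse \<zeta>) / (\<zeta> - z)) =
    poly f z * cauchy (ps n) z / z ^ n"
proof -
  have f: "poly f x = (\<Sum>i\<le>n. coeff f i * x ^ i)" for x
    unfolding poly_altdef using assms(3)
    by (intro sum.mono_neutral_left) (auto simp: coeff_eq_0)
  have "pairing (\<lambda>\<zeta>. poly f \<zeta> * poly (q n) (inverse \<zeta>) / (\<zeta> - z)) =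
      pairing (\<lambda>\<zeta>. \<Sum>i\<le>n. coeff f i * (\<zeta> ^ i * poly (q n) (inverse \<zeta>) / (\<zeta> - z)))"
    by (intro pairing_cong[of "{}"]) (simp_all add: f sum_distrib_left sum_divide_distrib mult_ac)
  also have "\<dots> = (\<Sum>i\<le>n. coeff f i * pairing (\<lambda>\<zeta>. \<zeta> ^ i * poly (q n) (inverse \<zeta>) / (\<zeta> - z)))"
    using assms(1)
    by (intro pairing_lincomb_sum paired_divide_pole poly_inverse_intros) simp_all
  also have "\<dots> = poly f z * pairing (\<lambda>\<zeta>. poly (q n) (inverse \<zeta>) / (\<zeta> - z))"
    using assms(1) by (simp add: f sum_distrib_right pairing_monom_q_pole mult_ac)
  finally show ?thesis
    using assms by (simp add: cauchy_ps)
qed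

text \<open>
  The correction term in the pairing with a pole involves the coefficient of degree \<open>n\<close> and so
  occurs for \<open>k = n\<close> only. It is the source of the term \<open>- \<Sum>\<^sub>j \<rho>\<^sub>j z\<^sub>j' / z\<^sub>j\<close>, which the equation
  for \<open>\<phi>\<^sub>n\<close> has and the one for \<open>\<phi>\<^sub>n\<^sup>*\<close> lacks.
\<close>
lemma sum_pairing_p_pole:
  assumes "pole_integrable z" "z \<noteq> 0" "n \<ge> 1"
  shows "(\<Sum>k\<le>n. pairing (\<lambda>\<zeta>. poly (p n) \<zeta> * poly (q k) (inverse \<zeta>) / (\<zeta> - z)) * poly (p k) x) =
    cauchy (p n) z / z ^ n * kernel n z x - poly (p n) x / z"
proof -
  have "(\<Sum>k\<le>n. pairing (\<lambda>\<zeta>. poly (p n) \<zeta> * poly (q k) (inverse \<zeta>) / (\<zeta> - z)) * poly (p k) x) =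
      (\<Sum>k\<le>n. cauchy (p n) z / z ^ n * (poly (rev_poly n (q k)) z * poly (p k) x)
        - (if k = n then poly (p n) x / z else 0))"
  proof (rule sum.cong)
    fix k assume k: "k \<in> {..n}"
    then have "coeff (q k) n = (if k = n then \<kappa> n else 0)"
      by (auto simp: coeff_eq_0)
    moreover have "pairing (\<lambda>\<zeta>. poly (p n) \<zeta> * poly (q k) (inverse \<zeta>) / (\<zeta> - z)) =
        poly (q k) (inverse z) * cauchy (p n) z - coeff (q k) n / (\<kappa> n * z)"
      using k assms by (intro pairing_p_pole) auto
    moreover have "poly (rev_poly n (q k)) z = z ^ n * poly (q k) (inverse z)"
      using k assms by (intro poly_rev_poly) auto
    ultimately show "pairing (\<lambda>\<zeta>. poly (p n) \<zeta> * poly (q k) (inverse \<zeta>) / (\<zeta> - z)) * poly (p k) x =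
        cauchy (p n) z / z ^ n * (poly (rev_poly n (q k)) z * poly (p k) x)
        - (if k = n then poly (p n) x / z else 0)"
      using assms(2) by (simp add: left_diff_distrib)
  qed simp
  then show ?thesis
    by (simp add: kernel_def sum_subtractf sum_distrib_left)
qed

lemma sum_pairing_q_pole:
  assumes "pole_integrable z" "z \<noteq> 0"
  shows "(\<Sum>k\<le>n. pairing (\<lambda>\<zeta>. poly (p k) \<zeta> * poly (q n) (inverse \<zeta>) / (\<zeta> - z)) * poly (rev_poly n (q k)) x) =
    cauchy (ps n) z / z ^ n * kernel n x z"
  unfolding kernel_def sum_distrib_left using assms
  by (intro sum.cong refl) (simp add: pairing_q_pole)

lemma pole_integrable_two:
  assumes "pole_integrable x" "pole_integrable z" "x \<noteq> z"
  shows "paired (\<lambda>\<zeta>. poly f \<zeta> / ((\<zeta> - x) * (\<zeta> - z)))"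
    and "pairing (\<lambda>\<zeta>. poly f \<zeta> / ((\<zeta> - x) * (\<zeta> - z))) = (cauchy f x - cauchy f z) / (x - z)"
proof -
  have eq: "poly f \<zeta> / ((\<zeta> - x) * (\<zeta> - z)) =
      inverse (x - z) * (poly f \<zeta> / (\<zeta> - x) - poly f \<zeta> / (\<zeta> - z))"
    if "\<zeta> \<notin> {x, z}" for \<zeta>
  proof -
    define u v where "u = \<zeta> - x" and "v = \<zeta> - z"
    have "u \<noteq> 0" "v \<noteq> 0" "v - u \<noteq> 0" "x - z = v - u"
      using that assms(3) by (auto simp: u_def v_def)
    then show ?thesis
      unfolding u_def[symmetric] v_def[symmetric]
      by (simp add: divide_simps) (simp add: algebra_simps)
  qed
  have pd: "paired (\<lambda>\<zeta>. inverse (x - z) * (poly f \<zeta> / (\<zeta> - x) - poly f \<zeta> / (\<zeta> - z)))"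
    using assms by (intro paired_cmult paired_diff paired_poly_pole)
  show "paired (\<lambda>\<zeta>. poly f \<zeta> / ((\<zeta> - x) * (\<zeta> - z)))"
    using pd by (subst paired_cong[of "{x, z}", OF _ eq]) simp_all
  have "pairing (\<lambda>\<zeta>. poly f \<zeta> / ((\<zeta> - x) * (\<zeta> - z))) =
      pairing (\<lambda>\<zeta>. inverse (x - z) * (poly f \<zeta> / (\<zeta> - x) - poly f \<zeta> / (\<zeta> - z)))"
    by (rule pairing_cong[of "{x, z}"]) (auto intro!: eq)
  also have "\<dots> = (cauchy f x - cauchy f z) / (x - z)"
    unfolding pairing_cmult cauchy_def using assms
    by (subst pairing_diff) (auto intro!: paired_poly_pole simp: field_simps)
  finally show "pairing (\<lambda>\<zeta>. poly f \<zeta> / ((\<zeta> - x) * (\<zeta> - z))) = (cauchy f x - cauchy f z) / (x - z)" .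
qed

end

section \<open>Differentiating expansions in a dual basis\<close>

text \<open>
  Writing \<open>G = 1 + E\<close> turns the system into \<open>c = b - E c\<close> with \<open>E \<rightarrow> 0\<close>. Used three times, this
  gives more each time: \<open>c\<close> is bounded near \<open>t\<close>, hence continuous at \<open>t\<close>, hence differentiable
  there.
\<close>
lemma linear_system_has_field_derivative:
  fixes G :: "nat \<Rightarrow> nat \<Rightarrow> complex \<Rightarrow> complex" and b c :: "nat \<Rightarrow> complex \<Rightarrow> complex"
  assumes G: "\<And>j k. j \<le> n \<Longrightarrow> k \<le> n \<Longrightarrow> (G j k has_field_derivative G' j k) (at t within D)"
    and G_t: "\<And>j k. j \<le> n \<Longrightarrow> k \<le> n \<Longrightarrow> G j k t = (if j = k then 1 else 0)"
    and b: "\<And>j. j \<le> n \<Longrightarrow> (b j has_field_derivative b' j) (at t within D)"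
    and sys: "\<And>s j. s \<in> D \<Longrightarrow> j \<le> n \<Longrightarrow> (\<Sum>k\<le>n. G j k s * c k s) = b j s"
    and t: "t \<in> D" and j: "j \<le> n"
  shows "(c j has_field_derivative (b' j - (\<Sum>k\<le>n. G' j k * b k t))) (at t within D)"
proof -
  define E where "E = (\<lambda>j k s. G j k s - (if j = k then 1 else 0))"
  have c_eq: "c j s = b j s - (\<Sum>k\<le>n. E j k s * c k s)" if "s \<in> D" "j \<le> n" for j s
  proof -
    have "(\<Sum>k\<le>n. E j k s * c k s) = (\<Sum>k\<le>n. G j k s * c k s - (if k = j then c j s else 0))"
      by (intro sum.cong) (auto simp: E_def algebra_simps)
    also have "\<dots> = b j s - c j s"
      using that sys[of s j] by (simp add: sum_subtractf)
    finally show ?thesis by simp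
  qed
  have c_t: "c j t = b j t" if "j \<le> n" for j
    using c_eq[OF t that] G_t that by (simp add: E_def)
  have E_lim: "(E j k \<longlongrightarrow> 0) (at t within D)" if "j \<le> n" "k \<le> n" for j k
  proof -
    have "(G j k \<longlongrightarrow> G j k t) (at t within D)"
      using G[OF that] DERIV_continuous continuous_within by blast
    then show ?thesis
      unfolding E_def G_t[OF that, symmetric] by (rule LIM_zero)
  qed
  have b_lim: "(b k \<longlongrightarrow> b k t) (at t within D)" if "k \<le> n" for k
    using b[OF that] DERIV_continuous continuous_within by blast
  define S e where "S = (\<lambda>s. \<Sum>k\<le>n. norm (c k s))" and "e = (\<lambda>s. \<Sum>j\<le>n. \<Sum>k\<le>n. norm (E j k s))"
  have e_lim: "(e \<longlongrightarrow> 0) (at t within D)"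
  proof -
    have "(e \<longlongrightarrow> (\<Sum>j\<le>n. \<Sum>k\<le>n. norm (0::complex))) (at t within D)"
      unfolding e_def by (intro tendsto_sum tendsto_norm E_lim) auto
    then show ?thesis by simp
  qed
  have Ec: "norm (\<Sum>k\<le>n. E j k s * c k s) \<le> (\<Sum>k\<le>n. norm (E j k s)) * S s" if "j \<le> n" for j s
  proof -
    have "norm (\<Sum>k\<le>n. E j k s * c k s) \<le> (\<Sum>k\<le>n. norm (E j k s) * norm (c k s))"
      using norm_sum[of "\<lambda>k. E j k s * c k s" "{..n}"] by (simp add: norm_mult)
    also have "\<dots> \<le> (\<Sum>k\<le>n. norm (E j k s) * S s)"
      unfolding S_def by (intro sum_mono mult_left_mono member_le_sum) auto
    finally show ?thesis by (simp add: sum_distrib_right)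
  qed
  have S_bound: "S s \<le> (\<Sum>k\<le>n. norm (b k s)) + e s * S s" if "s \<in> D" for s
  proof -
    have "S s \<le> (\<Sum>j\<le>n. norm (b j s) + (\<Sum>k\<le>n. norm (E j k s)) * S s)"
      unfolding S_def[of] 
    proof (intro sum_mono)
      fix j assume j: "j \<in> {..n}"
      then have "norm (c j s) \<le> norm (b j s) + norm (\<Sum>k\<le>n. E j k s * c k s)"
        using c_eq[of s j] that norm_triangle_ineq4 by auto
      with Ec[of j s] j
      show "norm (c j s) \<le> norm (b j s) + (\<Sum>k\<le>n. norm (E j k s)) * (\<Sum>k\<le>n. norm (c k s))"
        unfolding S_def by simp
    qed
    then show ?thesis
      by (simp add: e_def sum.distrib sum_distrib_right)
  qed
  \<comment> \<open>Where \<open>e s < 1/2\<close>, the estimate \<open>S \<le> |b| + e S\<close> can be solved for \<open>S\<close>, which bounds the coefficients.\<close>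
  have c_lim: "(c j \<longlongrightarrow> b j t) (at t within D)" if j: "j \<le> n" for j
  proof -
    have "((\<lambda>s. \<Sum>k\<le>n. E j k s * c k s) \<longlongrightarrow> 0) (at t within D)"
    proof (rule Lim_null_comparison)
      have "\<forall>\<^sub>F s in at t within D. e s < 1 / 2"
        using e_lim by (rule order_tendstoD) simp
      moreover have "\<forall>\<^sub>F s in at t within D. s \<in> D"
        by (simp add: eventually_at_filter)
      ultimately show "\<forall>\<^sub>F s in at t within D. norm (\<Sum>k\<le>n. E j k s * c k s) \<le>
          e s * (2 * (\<Sum>k\<le>n. norm (b k s)))"
      proof eventually_elim
        case (elim s)
        have "e s * S s \<le> 1 / 2 * S s"
          using elim by (intro mult_right_mono) (auto simp: S_def sum_nonneg)
        then have "S s \<le> 2 * (\<Sum>k\<le>n. norm (b k s))"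
          using S_bound[of s] elim by simp
        moreover have "(\<Sum>k\<le>n. norm (E j k s)) \<le> e s"
          unfolding e_def using j
          by (intro member_le_sum[of j "{..n}" "\<lambda>j. \<Sum>k\<le>n. norm (E j k s)"]) (auto simp: sum_nonneg)
        ultimately have "(\<Sum>k\<le>n. norm (E j k s)) * S s \<le> e s * (2 * (\<Sum>k\<le>n. norm (b k s)))"
          by (intro mult_mono) (auto simp: S_def e_def sum_nonneg)
        then show ?case using Ec[OF j, of s] by linarith
      qed
      have "((\<lambda>s. e s * (2 * (\<Sum>k\<le>n. norm (b k s)))) \<longlongrightarrow> 0 * (2 * (\<Sum>k\<le>n. norm (b k t)))) (at t within D)"
        by (intro tendsto_intros e_lim b_lim) auto
      then show "((\<lambda>s. e s * (2 * (\<Sum>k\<le>n. norm (b k s)))) \<longlongrightarrow> 0) (at t within D)"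
        by simp
    qed
    then have "((\<lambda>s. b j s - (\<Sum>k\<le>n. E j k s * c k s)) \<longlongrightarrow> b j t - 0) (at t within D)"
      by (intro tendsto_diff b_lim j)
    then have "((\<lambda>s. b j s - (\<Sum>k\<le>n. E j k s * c k s)) \<longlongrightarrow> b j t) (at t within D)"
      by simp
    then show ?thesis
      by (rule Lim_transform_eventually)
         (use c_eq j in \<open>auto simp: eventually_at_filter\<close>)
  qed
  \<comment> \<open>The difference quotient of \<open>c = b - E c\<close>: since \<open>E\<close> vanishes at \<open>t\<close>, continuity of \<open>c\<close> is enough for convergence.\<close>
  have Q: "((\<lambda>s. (b j s - b j t) / (s - t) - (\<Sum>k\<le>n. (G j k s - G j k t) / (s - t) * c k s)) \<longlongrightarrow>
      b' j - (\<Sum>k\<le>n. G' j k * b k t)) (at t within D)"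
    using b[OF j] G[OF j] unfolding has_field_derivative_iff
    by (intro tendsto_diff tendsto_sum tendsto_mult c_lim) auto
  show ?thesis
    unfolding has_field_derivative_iff
  proof (rule Lim_transform_eventually[OF Q])
    have "\<forall>\<^sub>F s in at t within D. s \<in> D \<and> s \<noteq> t"
      by (simp add: eventually_at_filter)
    then show "\<forall>\<^sub>F s in at t within D. (b j s - b j t) / (s - t)
        - (\<Sum>k\<le>n. (G j k s - G j k t) / (s - t) * c k s) = (c j s - c j t) / (s - t)"
    proof eventually_elim
      case (elim s)
      have "(\<Sum>k\<le>n. (G j k s - G j k t) / (s - t) * c k s) = (\<Sum>k\<le>n. E j k s * c k s) / (s - t)"
        unfolding sum_divide_distrib using j G_t by (intro sum.cong) (auto simp: E_def)
      then show ?case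
        using c_eq[of s j] c_t[OF j] elim j by (simp add: diff_divide_distrib)
    qed
  qed
qed

text \<open>
  One statement serves both families of polynomials, with the roles of \<open>p\<close> and \<open>q\<close> exchanged for
  the second; \<open>B s\<close> is the moment pairing at time \<open>s\<close> and \<open>P s\<close> the polynomial of degree \<open>n\<close> at
  time \<open>s\<close>. The right-hand side of the linear system is \<open>\<kappa> t / \<kappa> s\<close> in its last entry and zero
  elsewhere, and its derivative is the term \<open>- d\<kappa> / \<kappa> t\<close>.
\<close>
lemma dual_basis_expansion_derivative:
  fixes B :: "complex \<Rightarrow> complex poly \<Rightarrow> complex poly \<Rightarrow> complex"
    and p q :: "nat \<Rightarrow> complex poly" and P :: "complex \<Rightarrow> complex poly"
  assumes lin: "\<And>s c g. s \<in> D \<Longrightarrow>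
        B s (\<Sum>k\<le>n. Polynomial.smult (c k) (p k)) g = (\<Sum>k\<le>n. c k * B s (p k) g)"
    and P: "\<And>s. s \<in> D \<Longrightarrow> degree (P s) \<le> n" "P t = p n"
    and red: "\<And>s g. s \<in> D \<Longrightarrow> degree g \<le> n \<Longrightarrow> B s (P s) g = coeff g n / \<kappa> s"
    and p: "\<And>k. degree (p k) = k" "\<And>k. coeff (p k) k \<noteq> 0"
    and q: "\<And>k. degree (q k) = k" "coeff (q n) n = \<kappa> t"
    and orth: "\<And>j k. B t (p k) (q j) = (if j = k then 1 else 0)"
    and deriv: "\<And>j k. ((\<lambda>s. B s (p k) (q j)) has_field_derivative B' (p k) (q j)) (at t within D)"
    and \<kappa>: "(\<kappa> has_field_derivative d\<kappa>) (at t within D)" "\<kappa> t \<noteq> 0"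
    and t: "t \<in> D"
  shows "\<exists>c. (\<forall>s\<in>D. P s = (\<Sum>k\<le>n. Polynomial.smult (c k s) (p k))) \<and>
    (\<forall>k\<le>n. (c k has_field_derivative
       (if k = n then - (d\<kappa> / \<kappa> t) else 0) - B' (p n) (q k)) (at t within D)) \<and>
    (\<forall>k\<le>n. c k t = (if k = n then 1 else 0))"
proof -
  have "\<exists>c. P s = (\<Sum>k\<le>n. Polynomial.smult (c k) (p k))" if "s \<in> D" for s
    using expand_in_graded_basis[of p "P s" n] p P(1)[OF that] by blast
  then obtain c where c: "\<And>s. s \<in> D \<Longrightarrow> P s = (\<Sum>k\<le>n. Polynomial.smult (c s k) (p k))"
    by metis
  define b where "b = (\<lambda>j s. if j = n then \<kappa> t / \<kappa> s else 0)"
  have sys: "(\<Sum>k\<le>n. B s (p k) (q j) * c s k) = b j s" if "s \<in> D" "j \<le> n" for s j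
  proof -
    have "(\<Sum>k\<le>n. B s (p k) (q j) * c s k) = B s (P s) (q j)"
      using lin[OF that(1), of "c s" "q j"] c[OF that(1)] by (simp add: mult.commute)
    also have "\<dots> = coeff (q j) n / \<kappa> s"
      using that q by (intro red) auto
    also have "\<dots> = b j s"
      using that q by (auto simp: b_def coeff_eq_0)
    finally show ?thesis .
  qed
  have b_deriv: "(b j has_field_derivative (if j = n then - (d\<kappa> / \<kappa> t) else 0)) (at t within D)" for j
    using \<kappa> unfolding b_def by (auto intro!: derivative_eq_intros simp: field_simps)
  have c_deriv: "((\<lambda>s. c s k) has_field_derivative
      (if k = n then - (d\<kappa> / \<kappa> t) else 0) - B' (p n) (q k)) (at t within D)" if "k \<le> n" for k
  proof -
    have "((\<lambda>s. c s k) has_field_derivative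
      (if k = n then - (d\<kappa> / \<kappa> t) else 0) - (\<Sum>i\<le>n. B' (p i) (q k) * b i t)) (at t within D)"
      by (rule linear_system_has_field_derivative[where G = "\<lambda>j k s. B s (p k) (q j)" and b = b])
         (use that orth deriv sys b_deriv t in auto)
    moreover have "(\<Sum>i\<le>n. B' (p i) (q k) * b i t) = B' (p n) (q k)"
      using \<kappa>(2) by (simp add: b_def if_distrib[of "\<lambda>x. _ * x"] cong: if_cong)
    ultimately show ?thesis by simp
  qed
  have c_t: "c t k = (if k = n then 1 else 0)" if "k \<le> n" for k
  proof -
    have "(\<Sum>i\<le>n. B t (p i) (q k) * c t i) = c t k"
      using that by (simp add: orth if_distrib[of "\<lambda>x. x * _"] cong: if_cong)
    then show ?thesis
      using sys[OF t that] \<kappa>(2) by (cases "k = n") (simp_all add: b_def)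
  qed
  show ?thesis
    by (rule exI[of _ "\<lambda>k s. c s k"]) (use c c_deriv c_t in auto)
qed

section \<open>Branches of power products\<close>

text \<open>
  A cut running off to infinity meets each disc in a compact set.
\<close>
lemma closed_is_cut:
  assumes "is_cut C"
  shows "closed C"
  using assms unfolding is_cut_def
proof (elim disjE exE conjE)
  fix g assume "arc g" "C = path_image g"
  then show ?thesis
    using closed_arc_image by blast
next
  fix g :: "real \<Rightarrow> complex"
  assume g: "continuous_on {0..} g" "filterlim g at_infinity at_top" and C: "C = g ` {0..}"
  have "closed (C \<inter> cball 0 R)" for R
  proof -
    have "\<forall>\<^sub>F x in at_top. norm (g x) > R"
      using filterlim_at_infinity_imp_norm_at_top[OF g(2)] by (simp add: filterlim_at_top_dense)
    then obtain N where N: "\<And>x. x \<ge> N \<Longrightarrow> norm (g x) > R"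
      by (auto simp: eventually_at_top_linorder)
    have "C \<inter> cball 0 R = g ` {0..N} \<inter> cball 0 R"
      using N by (force simp: C not_less[symmetric])
    moreover have "compact (g ` {0..N})"
      by (intro compact_continuous_image continuous_on_subset[OF g(1)]) auto
    ultimately show ?thesis
      by (simp add: compact_imp_closed closed_Int)
  qed
  note cl = this
  show "closed C"
  proof (rule closed_sequential_limits[THEN iffD2], intro allI impI, elim conjE)
    fix x l assume x: "\<forall>n. x n \<in> C" "x \<longlonglongrightarrow> l"
    from x(2) have "Bseq x"
      using convergentI convergent_imp_Bseq by blast
    then obtain R where "\<And>n. norm (x n) \<le> R"
      by (auto simp: Bseq_def)
    then have "l \<in> C \<inter> cball 0 R"
      using closed_sequentially[OF cl[of R], of x l] x by auto
    then show "l \<in> C" by simp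
  qed
qed

lemma open_cut_plane: "cut_plane U \<Longrightarrow> open U"
  unfolding cut_plane_def using closed_is_cut by (auto intro!: open_Compl closed_Union)

text \<open>
  The multiplicative monodromy group of a power product. Another pointwise choice of logarithms
  multiplies the product by an element of this group.
\<close>
lemma countable_exp_monodromy:
  "countable (range (\<lambda>k :: nat \<Rightarrow> int. exp (\<Sum>j=1..m. \<rho> j * (2 * of_int (k j) * pi * \<i>))))"
proof -
  let ?F = "\<lambda>k :: nat \<Rightarrow> int. exp (\<Sum>j=1..m. \<rho> j * (2 * of_int (k j) * pi * \<i>))"
  have "?F k \<in> ?F ` (\<Pi>\<^sub>E j\<in>{1..m}. UNIV)" for k
  proof
    show "restrict k {1..m} \<in> (\<Pi>\<^sub>E j\<in>{1..m}. UNIV)" by auto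
  qed simp
  then have "range ?F \<subseteq> ?F ` (\<Pi>\<^sub>E j\<in>{1..m}. UNIV)" by blast
  moreover have "countable (\<Pi>\<^sub>E j\<in>{1..m}. UNIV :: int set)"
    by (intro countable_PiE) auto
  ultimately show ?thesis
    by (meson countable_image countable_subset)
qed

lemma power_product_branch_off_points:
  assumes "is_power_product_branch m a \<rho> U w" "x \<in> U" "j \<in> {1..m}"
  shows "x \<noteq> a j"
  using assms unfolding is_power_product_branch_def by (metis exp_not_eq_zero right_minus_eq)

lemma power_product_branch_nonzero:
  assumes "is_power_product_branch m a \<rho> U w" "x \<in> U"
  shows "w x \<noteq> 0"
  using assms unfolding is_power_product_branch_def by (metis exp_not_eq_zero)

text \<open>
  The logarithms in the definition of a branch are chosen pointwise. Compare the branch near \<open>x0\<close>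
  with the local branch \<open>W\<close> built from principal logarithms of \<open>(x - a j) / (x0 - a j)\<close>: the
  quotient is continuous on a disc and takes countably many values, since each belongs to the
  monodromy group. Connected sets with more than one point being uncountable, the quotient is
  constant.
\<close>
lemma power_product_branch_has_field_derivative:
  assumes br: "is_power_product_branch m a \<rho> U w" and U: "open U" and x0: "x0 \<in> U"
  shows "(w has_field_derivative w x0 * (\<Sum>j=1..m. \<rho> j / (x0 - a j))) (at x0)"
proof -
  have nz: "x0 - a j \<noteq> 0" if "j \<in> {1..m}" for j
    using power_product_branch_off_points[OF br x0 that] by simp
  obtain l where l: "\<And>x j. x \<in> U \<Longrightarrow> j \<in> {1..m} \<Longrightarrow> exp (l x j) = x - a j"
    "\<And>x. x \<in> U \<Longrightarrow> w x = exp (\<Sum>j=1..m. \<rho> j * l x j)"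
    using br unfolding is_power_product_branch_def by metis
  obtain e where e: "e > 0" "ball x0 e \<subseteq> U"
    using U x0 openE by blast
  \<comment> \<open>On this disc \<open>(x - a j) / (x0 - a j)\<close> stays within distance \<open>1\<close> of \<open>1\<close>.\<close>
  define r where "r = Min (insert e ((\<lambda>j. norm (x0 - a j)) ` {1..m}))"
  have "r > 0"
    unfolding r_def using e nz by (subst Min_gr_iff) auto
  moreover have "r \<le> e" "\<And>j. j \<in> {1..m} \<Longrightarrow> r \<le> norm (x0 - a j)"
    unfolding r_def by (intro Min_le; simp)+
  ultimately have r: "r > 0" "r \<le> e" "\<And>j. j \<in> {1..m} \<Longrightarrow> r \<le> norm (x0 - a j)"
    by auto
  have sub: "ball x0 r \<subseteq> U"
    using r e by (meson subset_ball order_trans)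
  define L where "L = (\<lambda>j x. Ln ((x - a j) / (x0 - a j)))"
  have slit: "(x - a j) / (x0 - a j) \<notin> \<real>\<^sub>\<le>\<^sub>0" if "x \<in> ball x0 r" "j \<in> {1..m}" for x j
  proof -
    have "norm ((x - x0) / (x0 - a j)) < 1"
      using that r(3)[OF that(2)] nz[OF that(2)]
      by (auto simp: norm_divide dist_norm norm_minus_commute divide_simps)
    then have "Re (1 + (x - x0) / (x0 - a j)) > 0"
      using abs_Re_le_cmod[of "(x - x0) / (x0 - a j)"] by simp
    moreover have "1 + (x - x0) / (x0 - a j) = (x - a j) / (x0 - a j)"
      using nz[OF that(2)] by (simp add: field_simps)
    ultimately show ?thesis
      by (auto simp: complex_nonpos_Reals_iff)
  qed
  define W where "W = (\<lambda>x. exp (\<Sum>j=1..m. \<rho> j * L j x))"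
  have L_deriv: "(L j has_field_derivative 1 / (x0 - a j)) (at x0)" if "j \<in> {1..m}" for j
    unfolding L_def using slit[OF _ that, of x0] r nz[OF that]
    by (auto intro!: derivative_eq_intros)
  have "continuous_on (ball x0 r) (L j)" if "j \<in> {1..m}" for j
    unfolding L_def using slit nz that by (intro continuous_intros) auto
  moreover have "continuous_on (ball x0 r) w"
    using br sub unfolding is_power_product_branch_def
    by (meson holomorphic_on_imp_continuous_on continuous_on_subset)
  ultimately have cont: "continuous_on (ball x0 r) (\<lambda>x. w x / (w x0 * W x))"
    unfolding W_def
    by (intro continuous_intros) (auto simp: power_product_branch_nonzero[OF br x0])
  have quot: "w x / (w x0 * W x) \<in>
      range (\<lambda>k :: nat \<Rightarrow> int. exp (\<Sum>j=1..m. \<rho> j * (2 * of_int (k j) * pi * \<i>)))"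
    if x: "x \<in> ball x0 r" for x
  proof -
    have "\<exists>k::int. l x j - l x0 j - L j x = 2 * of_int k * pi * \<i>" if j: "j \<in> {1..m}" for j
    proof -
      have "exp (l x j - l x0 j - L j x) = 1"
      proof -
        have xU: "x \<in> U" using x sub by blast
        then have "x - a j \<noteq> 0"
          using power_product_branch_off_points[OF br _ j] by simp
        then have "exp (L j x) = (x - a j) / (x0 - a j)"
          unfolding L_def using nz[OF j] by (intro exp_Ln) simp
        then show ?thesis
          using l(1)[OF xU j] l(1)[OF x0 j] \<open>x - a j \<noteq> 0\<close> nz[OF j] by (simp add: exp_diff)
      qed
      then obtain k :: int where "Re (l x j - l x0 j - L j x) = 0"
          "Im (l x j - l x0 j - L j x) = of_int (2 * k) * pi"
        unfolding exp_eq_1 by blast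
      then have "l x j - l x0 j - L j x = 2 * of_int k * pi * \<i>"
        by (simp add: complex_eq_iff)
      then show ?thesis ..
    qed
    then obtain k :: "nat \<Rightarrow> int" where
      k: "\<And>j. j \<in> {1..m} \<Longrightarrow> l x j - l x0 j - L j x = 2 * of_int (k j) * pi * \<i>"
      by metis
    have "w x / (w x0 * W x) = exp (\<Sum>j=1..m. \<rho> j * (l x j - l x0 j - L j x))"
    proof -
      have xU: "x \<in> U" using x sub by blast
      have "(\<Sum>j=1..m. \<rho> j * (l x j - l x0 j - L j x)) =
          (\<Sum>j=1..m. \<rho> j * l x j) - ((\<Sum>j=1..m. \<rho> j * l x0 j) + (\<Sum>j=1..m. \<rho> j * L j x))"
        by (simp add: sum_subtractf sum.distrib algebra_simps)
      then show ?thesis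
        unfolding W_def l(2)[OF xU] l(2)[OF x0] by (simp add: exp_diff exp_add)
    qed
    also have "\<dots> = exp (\<Sum>j=1..m. \<rho> j * (2 * of_int (k j) * pi * \<i>))"
      by (intro arg_cong[of _ _ exp] sum.cong refl) (simp only: k)
    finally show ?thesis by blast
  qed
  have const: "w x / (w x0 * W x) = w x0 / (w x0 * W x0)" if "x \<in> ball x0 r" for x
  proof (rule ccontr)
    assume ne: "\<not> ?thesis"
    have "connected ((\<lambda>x. w x / (w x0 * W x)) ` ball x0 r)"
      using cont by (intro connected_continuous_image) auto
    then have "uncountable ((\<lambda>x. w x / (w x0 * W x)) ` ball x0 r)"
    proof (rule connected_uncountable[OF _ _ _ ne])
      show "w x0 / (w x0 * W x0) \<in> (\<lambda>x. w x / (w x0 * W x)) ` ball x0 r"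
        by (rule imageI) (use r in simp)
    qed (rule imageI[OF that])
    moreover have "countable ((\<lambda>x. w x / (w x0 * W x)) ` ball x0 r)"
      by (rule countable_subset[OF _ countable_exp_monodromy[of \<rho> m]]) (use quot in blast)
    ultimately show False by simp
  qed
  have W0: "W x0 = 1"
    using nz by (simp add: W_def L_def)
  have eq: "w x0 * W x = w x" if "x \<in> ball x0 r" for x
    using const[OF that] W0 power_product_branch_nonzero[OF br x0]
    by (simp add: divide_simps W_def split: if_splits)
  have "((\<lambda>x. w x0 * W x) has_field_derivative w x0 * (\<Sum>j=1..m. \<rho> j / (x0 - a j))) (at x0)"
    unfolding W_def using W0
    by (auto intro!: derivative_eq_intros L_deriv simp: W_def)
  then show ?thesis
    by (rule has_field_derivative_transform_within_open[of _ _ _ "ball x0 r"]) (use eq r in auto)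
qed

section \<open>Logarithms along the unit circle\<close>

text \<open>
  A logarithm of \<open>cis \<theta> - z\<close> that is differentiable in \<open>\<theta>\<close> along every arc avoiding \<open>z\<close>. After
  dividing by \<open>cis \<theta>\<close> or by \<open>- z\<close>, whichever is larger in modulus, the remaining factor is \<open>1 - u\<close>
  with \<open>|u| \<le> 1\<close>, which stays in the closed right half-plane and, being nonzero, off the branch
  cut of \<open>Ln\<close>.
\<close>
definition arclog :: "complex \<Rightarrow> real \<Rightarrow> complex" where
  "arclog z \<theta> =
     (if norm z \<le> 1 then \<i> * \<theta> + Ln (1 - z * cis (- \<theta>)) else Ln (- z) + Ln (1 - cis \<theta> / z))"

lemma one_minus_notin_nonpos_Reals:
  fixes u :: complex
  assumes "norm u \<le> 1" "u \<noteq> 1"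
  shows "1 - u \<notin> \<real>\<^sub>\<le>\<^sub>0"
proof
  assume "1 - u \<in> \<real>\<^sub>\<le>\<^sub>0"
  then have u: "Im u = 0" "Re u \<ge> 1"
    by (auto simp: complex_nonpos_Reals_iff)
  moreover have "Re u \<le> 1"
    using complex_Re_le_cmod[of u] assms(1) by simp
  ultimately show False
    using assms(2) by (auto simp: complex_eq_iff)
qed

lemma arclog_slit:
  assumes "cis \<theta> \<noteq> z"
  shows "norm z \<le> 1 \<Longrightarrow> 1 - z * cis (- \<theta>) \<notin> \<real>\<^sub>\<le>\<^sub>0"
    and "\<not> norm z \<le> 1 \<Longrightarrow> 1 - cis \<theta> / z \<notin> \<real>\<^sub>\<le>\<^sub>0"
proof -
  assume "norm z \<le> 1"
  moreover have "z * cis (- \<theta>) \<noteq> 1"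
  proof
    assume "z * cis (- \<theta>) = 1"
    then have "z * cis (- \<theta>) * cis \<theta> = cis \<theta>" by simp
    then show False
      using assms by (simp add: mult.assoc cis_mult)
  qed
  ultimately show "1 - z * cis (- \<theta>) \<notin> \<real>\<^sub>\<le>\<^sub>0"
    by (intro one_minus_notin_nonpos_Reals) (simp_all add: norm_mult)
next
  assume "\<not> norm z \<le> 1"
  then show "1 - cis \<theta> / z \<notin> \<real>\<^sub>\<le>\<^sub>0"
    using assms by (intro one_minus_notin_nonpos_Reals) (auto simp: norm_divide divide_le_eq)
qed

lemma exp_arclog:
  assumes "cis \<theta> \<noteq> z"
  shows "exp (arclog z \<theta>) = cis \<theta> - z"
proof (cases "norm z \<le> 1")
  case True
  have "1 - z * cis (- \<theta>) \<noteq> 0"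
    using arclog_slit(1)[OF assms True] by auto
  then have "exp (arclog z \<theta>) = cis \<theta> * (1 - z * cis (- \<theta>))"
    using True by (simp add: arclog_def exp_add cis_conv_exp)
  also have "\<dots> = cis \<theta> - z * (cis (- \<theta>) * cis \<theta>)"
    by (simp add: algebra_simps)
  finally show ?thesis
    by (simp add: cis_mult)
next
  case False
  then have "1 - cis \<theta> / z \<noteq> 0" "z \<noteq> 0"
    using arclog_slit(2)[OF assms False] by auto
  then show ?thesis
    using False by (simp add: arclog_def exp_add field_simps)
qed

lemma Re_arclog: "cis \<theta> \<noteq> z \<Longrightarrow> norm (cis \<theta> - z) = exp (Re (arclog z \<theta>))"
  using exp_arclog[of \<theta> z] norm_exp_eq_Re by metis

text \<open>
  The bound does not depend on \<open>z\<close>. This gives comparison estimates uniform in the position of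
  moving singularities.
\<close>
lemma abs_Im_arclog:
  assumes "cis \<theta> \<noteq> z"
  shows "\<bar>Im (arclog z \<theta>)\<bar> \<le> \<bar>\<theta>\<bar> + 2 * pi"
proof (cases "norm z \<le> 1")
  case True
  have "1 - z * cis (- \<theta>) \<noteq> 0"
    using arclog_slit(1)[OF assms True] by auto
  then have "\<bar>Im (Ln (1 - z * cis (- \<theta>)))\<bar> \<le> pi"
    using Im_Ln_le_pi mpi_less_Im_Ln by (intro abs_leI) (auto simp: less_imp_le minus_le_iff)
  then show ?thesis
    using True pi_ge_zero by (simp add: arclog_def)
next
  case False
  then have "1 - cis \<theta> / z \<noteq> 0" "- z \<noteq> 0"
    using arclog_slit(2)[OF assms False] by auto
  moreover have "\<bar>Im (Ln u)\<bar> \<le> pi" if "u \<noteq> 0" for u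
    using Im_Ln_le_pi[OF that] mpi_less_Im_Ln[OF that] by linarith
  ultimately have "\<bar>Im (Ln (1 - cis \<theta> / z))\<bar> \<le> pi" "\<bar>Im (Ln (- z))\<bar> \<le> pi" by blast+
  then show ?thesis
    using False by (simp add: arclog_def)
qed

lemma has_vector_derivative_cis: "(cis has_vector_derivative \<i> * cis \<theta>) (at \<theta> within A)"
  unfolding has_vector_derivative_def
  by (rule derivative_eq_intros refl)+

lemma arclog_has_vector_derivative:
  assumes "cis \<theta> \<noteq> z"
  shows "(arclog z has_vector_derivative \<i> * cis \<theta> / (cis \<theta> - z)) (at \<theta>)"
proof (cases "norm z \<le> 1")
  case True
  have slit: "1 - z * cis (- \<theta>) \<notin> \<real>\<^sub>\<le>\<^sub>0"
    by (rule arclog_slit(1)[OF assms True])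
  have c: "((\<lambda>x. 1 - z * inverse (exp (\<i> * x))) has_field_derivative z * \<i> * cis (- \<theta>)) (at (of_real \<theta>))"
    by (auto intro!: derivative_eq_intros simp: cis_conv_exp exp_minus field_simps power2_eq_square)
  have "((\<lambda>x. \<i> * x + Ln (1 - z * inverse (exp (\<i> * x)))) has_field_derivative
      \<i> * cis \<theta> / (cis \<theta> - z)) (at (of_real \<theta>))"
  proof -
    have i: "inverse (exp (\<i> * of_real \<theta>)) = cis (- \<theta>)"
      by (simp add: cis_conv_exp exp_minus)
    have d: "\<i> + z * \<i> * cis (- \<theta>) / (1 - z * cis (- \<theta>)) = \<i> * cis \<theta> / (cis \<theta> - z)"
    proof -
      have "cis \<theta> - z = cis \<theta> * (1 - z * cis (- \<theta>))"
        by (simp add: right_diff_distrib mult.left_commute[of "cis \<theta>"] cis_mult)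
      moreover have "1 - z * cis (- \<theta>) \<noteq> 0" using slit by auto
      moreover have "\<i> + z * \<i> * cis (- \<theta>) / (1 - z * cis (- \<theta>)) = \<i> / (1 - z * cis (- \<theta>))"
        using \<open>1 - z * cis (- \<theta>) \<noteq> 0\<close> by (simp add: divide_simps) (simp add: algebra_simps)
      ultimately show ?thesis by simp
    qed
    have "((\<lambda>x. Ln (1 - z * inverse (exp (\<i> * x)))) has_field_derivative
        inverse (1 - z * cis (- \<theta>)) * (z * \<i> * cis (- \<theta>))) (at (of_real \<theta>))"
      using slit by (intro DERIV_chain2[OF _ c]) (simp add: i has_field_derivative_Ln)
    moreover have "((\<lambda>x. \<i> * x) has_field_derivative \<i>) (at (of_real \<theta>))"
      by (auto intro!: derivative_eq_intros)
    ultimately show ?thesis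
      unfolding d[symmetric] by (auto dest: DERIV_add simp: divide_inverse mult_ac)
  qed
  then have "(((\<lambda>x. \<i> * x + Ln (1 - z * inverse (exp (\<i> * x)))) \<circ> of_real) has_vector_derivative
      1 * (\<i> * cis \<theta> / (cis \<theta> - z))) (at \<theta>)"
    by (intro field_vector_diff_chain_at) (auto intro!: derivative_eq_intros)
  moreover have "arclog z = (\<lambda>x. \<i> * x + Ln (1 - z * inverse (exp (\<i> * x)))) \<circ> of_real"
    using True by (auto simp: arclog_def fun_eq_iff cis_conv_exp exp_minus)
  ultimately show ?thesis by simp
next
  case False
  have slit: "1 - cis \<theta> / z \<notin> \<real>\<^sub>\<le>\<^sub>0"
    by (rule arclog_slit(2)[OF assms False])
  have z: "z \<noteq> 0" using False by auto
  have "((\<lambda>x. Ln (- z) + Ln (1 - x / z)) has_field_derivative 1 / (cis \<theta> - z)) (at (cis \<theta>))"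
  proof -
    have "- (inverse (1 - cis \<theta> / z) / z) = 1 / (cis \<theta> - z)"
      using z assms by (simp add: divide_simps)
    then show ?thesis
      using slit z by (auto intro!: derivative_eq_intros)
  qed
  then have "(((\<lambda>x. Ln (- z) + Ln (1 - x / z)) \<circ> cis) has_vector_derivative
      \<i> * cis \<theta> * (1 / (cis \<theta> - z))) (at \<theta>)"
    by (intro field_vector_diff_chain_at has_vector_derivative_cis)
  moreover have "arclog z = (\<lambda>x. Ln (- z) + Ln (1 - x / z)) \<circ> cis"
    using False by (auto simp: arclog_def fun_eq_iff)
  ultimately show ?thesis by simp
qed

section \<open>The weight on the unit circle\<close>

text \<open>
  The form in which the branch structure enters from here on: a nowhere vanishing solution of
  \<open>dw / d\<zeta> = w * \<Sum>\<^sub>j \<rho>\<^sub>j / (\<zeta> - a\<^sub>j)\<close> at all but finitely many points of the circle, with matching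
  limits at \<open>-1\<close>.
\<close>
locale circle_weight =
  fixes m :: nat and a \<rho> :: "nat \<Rightarrow> complex" and w :: "complex \<Rightarrow> complex"
  assumes w_deriv: "\<And>\<zeta>. \<zeta> \<in> sphere 0 1 \<Longrightarrow> \<zeta> \<notin> insert (-1) (a ` {1..m}) \<Longrightarrow>
        (w has_field_derivative w \<zeta> * (\<Sum>j=1..m. \<rho> j / (\<zeta> - a j))) (at \<zeta>)"
    and w_nonzero: "\<And>\<zeta>. \<zeta> \<in> sphere 0 1 \<Longrightarrow> \<zeta> \<notin> insert (-1) (a ` {1..m}) \<Longrightarrow> w \<zeta> \<noteq> 0"
    and w_periodic: "\<exists>c. ((\<lambda>\<theta>. w (cis \<theta>)) \<longlongrightarrow> c) (at_left pi) \<and>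
        ((\<lambda>\<theta>. w (cis \<theta>)) \<longlongrightarrow> c) (at_right (- pi))"
begin

definition seam :: complex where
  "seam = (SOME c. ((\<lambda>\<theta>. w (cis \<theta>)) \<longlongrightarrow> c) (at_left pi) \<and>
        ((\<lambda>\<theta>. w (cis \<theta>)) \<longlongrightarrow> c) (at_right (- pi)))"

lemma seam: "((\<lambda>\<theta>. w (cis \<theta>)) \<longlongrightarrow> seam) (at_left pi)"
  "((\<lambda>\<theta>. w (cis \<theta>)) \<longlongrightarrow> seam) (at_right (- pi))"
  using someI_ex[OF w_periodic] unfolding seam_def by auto

text \<open>
  The weight as a function of the angle, periodic and corrected at the points where \<open>w\<close> carries no
  information: \<open>w\<close> is arbitrary at \<open>-1\<close>, where cuts may meet the circle, and at the singularities,
  where \<open>0\<close> turns out to be the limit.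
\<close>
definition v :: "real \<Rightarrow> complex" where
  "v \<theta> = (if cis \<theta> \<in> a ` {1..m} then 0 else if cis \<theta> = -1 then seam else w (cis \<theta>))"

lemma v_eq_w: "cis \<theta> \<notin> insert (-1) (a ` {1..m}) \<Longrightarrow> v \<theta> = w (cis \<theta>)"
  by (simp add: v_def)

lemma v_cong: "cis \<theta> = cis \<theta>' \<Longrightarrow> v \<theta> = v \<theta>'"
  by (simp add: v_def)

text \<open>
  The logarithmic derivative of \<open>v\<close> with respect to the angle.
\<close>
definition log_deriv :: "real \<Rightarrow> complex" where
  "log_deriv \<theta> = (\<Sum>j=1..m. \<rho> j * (\<i> * cis \<theta> / (cis \<theta> - a j)))"

lemma eventually_cis_notin:
  assumes "cis \<theta> \<notin> S" "finite S"
  shows "\<forall>\<^sub>F \<theta>' in nhds \<theta>. cis \<theta>' \<notin> S"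
proof -
  have "open (cis -` (- S))"
    using open_Compl[OF finite_imp_closed[OF assms(2)]]
    by (rule open_vimage) (intro continuous_intros)
  then have "\<forall>\<^sub>F \<theta>' in nhds \<theta>. \<theta>' \<in> cis -` (- S)"
    by (rule eventually_nhds_in_open) (use assms(1) in simp)
  then show ?thesis by simp
qed

lemma eventually_cis_neq: "\<forall>\<^sub>F \<theta>' in at \<theta>. cis \<theta>' \<noteq> cis \<theta>"
proof -
  let ?S = "{\<theta>' \<in> {\<theta> - 1..\<theta> + 1}. cis \<theta>' \<in> {cis \<theta>}} - {\<theta>}"
  have "finite ?S"
    using finite_cis_vimage[of "{cis \<theta>}" "\<theta> - 1" "\<theta> + 1"] by simp
  then have "open ({\<theta> - 1<..<\<theta> + 1} - ?S)"
    by (intro open_Diff finite_imp_closed) auto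
  then show ?thesis
    unfolding eventually_at_topological
    by (intro exI[of _ "{\<theta> - 1<..<\<theta> + 1} - ?S"]) auto
qed

lemma v_has_vector_derivative:
  assumes "cis \<theta> \<notin> insert (-1) (a ` {1..m})"
  shows "(v has_vector_derivative v \<theta> * log_deriv \<theta>) (at \<theta>)"
proof -
  have "((w \<circ> cis) has_vector_derivative \<i> * cis \<theta> * (w (cis \<theta>) * (\<Sum>j=1..m. \<rho> j / (cis \<theta> - a j)))) (at \<theta>)"
    using assms by (intro field_vector_diff_chain_at has_vector_derivative_cis w_deriv) auto
  moreover have "\<i> * cis \<theta> * (w (cis \<theta>) * (\<Sum>j=1..m. \<rho> j / (cis \<theta> - a j))) = v \<theta> * log_deriv \<theta>"
    using assms by (simp add: v_eq_w log_deriv_def sum_distrib_left mult_ac)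
  ultimately have D: "((w \<circ> cis) has_vector_derivative v \<theta> * log_deriv \<theta>) (at \<theta>)"
    by simp
  have "\<forall>\<^sub>F \<theta>' in nhds \<theta>. (w \<circ> cis) \<theta>' = v \<theta>'"
    using eventually_cis_notin[OF assms] by (auto elim!: eventually_mono simp: v_eq_w)
  then show ?thesis
    by (intro iffD1[OF has_vector_derivative_cong_ev D])
       (auto elim: eventually_mono dest: eventually_nhds_x_imp_x)
qed

text \<open>
  At an angle \<open>\<theta> \<equiv> \<pi>\<close> the one-sided limits of \<open>v\<close> are those of \<open>w (cis \<theta>)\<close> at \<open>\<pi>\<close> and \<open>- \<pi>\<close>,
  shifted by different multiples of \<open>2 \<pi>\<close>; they agree.
\<close>
lemma isCont_v:
  assumes "cis \<theta> \<notin> a ` {1..m}"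
  shows "isCont v \<theta>"
proof (cases "cis \<theta> = -1")
  case False
  then show ?thesis
    using assms v_has_vector_derivative[of \<theta>] has_vector_derivative_continuous by blast
next
  case True
  then have "cis \<theta> = cis pi"
    by simp
  then have "sin \<theta> = sin pi \<and> cos \<theta> = cos pi"
    by (metis cis.sel)
  then obtain k :: int where k: "\<theta> = pi + 2 * pi * k"
    using sin_cos_eq_iff by metis
  have v\<theta>: "v \<theta> = seam"
    using assms True by (simp add: v_def)
  have cis_shift: "cis (x - 2 * pi * of_int i) = cis x" for x and i :: int
    using cis_multiple_2pi[of "of_int i"] by (simp add: cis_divide[symmetric])
  have ev: "\<forall>\<^sub>F x in at \<theta>. w (cis (x - 2 * pi * of_int i)) = v x" for i :: int
  proof -
    have "\<forall>\<^sub>F x in at \<theta>. cis x \<notin> a ` {1..m}"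
      using eventually_cis_notin[OF assms] by (simp add: eventually_at_filter eventually_mono)
    then show ?thesis
      using eventually_cis_neq[of \<theta>]
    proof eventually_elim
      case (elim x)
      then have "v x = w (cis x)"
        using True by (intro v_eq_w) simp
      then show ?case
        by (simp only: cis_shift)
    qed
  qed
  have "((\<lambda>x. w (cis (x - 2 * pi * of_int k))) \<longlongrightarrow> seam) (at_left \<theta>)"
  proof -
    have "filterlim (\<lambda>x. x - 2 * pi * of_int k) (at_left pi) (at_left \<theta>)"
      unfolding filterlim_def filtermap_at_left_shift by (simp add: k)
    then show ?thesis
      by (rule filterlim_compose[OF seam(1)])
  qed
  then have L: "(v \<longlongrightarrow> seam) (at_left \<theta>)"
    by (rule Lim_transform_eventually)
       (use ev[of k] in \<open>auto simp: eventually_at_filter elim!: eventually_mono\<close>)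
  have "((\<lambda>x. w (cis (x - 2 * pi * of_int (k + 1)))) \<longlongrightarrow> seam) (at_right \<theta>)"
  proof -
    have "filterlim (\<lambda>x. x - 2 * pi * of_int (k + 1)) (at_right (- pi)) (at_right \<theta>)"
      unfolding filterlim_def filtermap_at_right_shift by (simp add: k algebra_simps)
    then show ?thesis
      by (rule filterlim_compose[OF seam(2)])
  qed
  then have R: "(v \<longlongrightarrow> seam) (at_right \<theta>)"
    by (rule Lim_transform_eventually)
       (use ev[of "k + 1"] in \<open>auto simp: eventually_at_filter elim!: eventually_mono\<close>)
  show ?thesis
    using L R unfolding isCont_def v\<theta> by (simp add: filterlim_split_at)
qed

definition log_sum :: "real \<Rightarrow> complex" where
  "log_sum \<theta> = (\<Sum>j=1..m. \<rho> j * arclog (a j) \<theta>)"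

text \<open>
  The quotient of \<open>v\<close> by the explicit power product has derivative zero except at the finitely
  many angles over \<open>-1\<close>, where it is merely continuous. That suffices for constancy.
\<close>
lemma v_along_arc_aux:
  assumes "\<theta>0 \<le> \<theta>1" and arc: "\<And>\<theta>. \<theta> \<in> {\<theta>0..\<theta>1} \<Longrightarrow> cis \<theta> \<notin> a ` {1..m}"
  shows "v \<theta>1 * exp (- log_sum \<theta>1) = v \<theta>0 * exp (- log_sum \<theta>0)"
proof -
  define F where "F = (\<lambda>\<theta>. v \<theta> * exp (- log_sum \<theta>))"
  define K where "K = {\<theta> \<in> {\<theta>0..\<theta>1}. cis \<theta> \<in> {-1}}"
  have log_sum_deriv: "(log_sum has_vector_derivative log_deriv \<theta>) (at \<theta>)" if "\<theta> \<in> {\<theta>0..\<theta>1}" for \<theta>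
    unfolding log_sum_def log_deriv_def
    using arc[OF that]
    by (intro has_vector_derivative_sum has_vector_derivative_mult_right arclog_has_vector_derivative) auto
  have F_deriv: "(F has_vector_derivative 0) (at \<theta>)" if "\<theta> \<in> {\<theta>0..\<theta>1} - K" for \<theta>
  proof -
    have "((\<lambda>\<theta>. exp (- log_sum \<theta>)) has_vector_derivative - log_deriv \<theta> * exp (- log_sum \<theta>)) (at \<theta>)"
    proof -
      have "((exp \<circ> (\<lambda>\<theta>. - log_sum \<theta>)) has_vector_derivative - log_deriv \<theta> * exp (- log_sum \<theta>)) (at \<theta>)"
        using that by (intro field_vector_diff_chain_at has_vector_derivative_minus log_sum_deriv) auto
      then show ?thesis by (simp add: o_def)
    qed
    moreover have "(v has_vector_derivative v \<theta> * log_deriv \<theta>) (at \<theta>)"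
      using that arc by (intro v_has_vector_derivative) (auto simp: K_def)
    ultimately have "(F has_vector_derivative
        v \<theta> * (- log_deriv \<theta> * exp (- log_sum \<theta>)) + v \<theta> * log_deriv \<theta> * exp (- log_sum \<theta>)) (at \<theta>)"
      unfolding F_def by (intro has_vector_derivative_mult)
    then show ?thesis by simp
  qed
  have F_cont: "continuous_on {\<theta>0..\<theta>1} F"
  proof (rule continuous_at_imp_continuous_on, rule ballI)
    fix \<theta> assume \<theta>: "\<theta> \<in> {\<theta>0..\<theta>1}"
    have "isCont log_sum \<theta>"
      using log_sum_deriv[OF \<theta>] has_vector_derivative_continuous by blast
    moreover have "isCont v \<theta>"
      using arc[OF \<theta>] by (rule isCont_v)
    ultimately show "isCont F \<theta>"
      unfolding F_def by (intro continuous_intros)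
  qed
  have K: "finite K"
    unfolding K_def by (rule finite_cis_vimage) simp
  have F_zero: "(F has_derivative (\<lambda>h. 0)) (at \<theta> within {\<theta>0..\<theta>1})" if "\<theta> \<in> {\<theta>0..\<theta>1} - K" for \<theta>
    using has_vector_derivative_at_within[OF F_deriv[OF that]] by (simp add: has_vector_derivative_def)
  have "\<theta>1 \<in> {\<theta>0..\<theta>1}"
    using assms(1) by simp
  from has_derivative_zero_unique_strong_interval[OF K F_cont refl F_zero this]
  have "F \<theta>1 = F \<theta>0" .
  then show ?thesis
    by (simp add: F_def)
qed

lemma v_along_arc:
  assumes "\<And>\<theta>. \<theta> \<in> closed_segment \<theta>0 \<theta>1 \<Longrightarrow> cis \<theta> \<notin> a ` {1..m}"
  shows "v \<theta>1 * exp (- log_sum \<theta>1) = v \<theta>0 * exp (- log_sum \<theta>0)"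
  using v_along_arc_aux[of \<theta>0 \<theta>1] v_along_arc_aux[of \<theta>1 \<theta>0] assms
  by (cases "\<theta>0 \<le> \<theta>1") (auto simp: closed_segment_eq_real_ivl)

end

section \<open>Comparing values of the weight along arcs\<close>

text \<open>
  Subadditivity of \<open>x powr b\<close> for exponents at most \<open>1\<close>.
\<close>
lemma powr_diff_le_diff_powr:
  fixes x y b :: real
  assumes "0 \<le> x" "x \<le> y" "0 < b" "b \<le> 1"
  shows "y powr b - x powr b \<le> (y - x) powr b"
proof (cases "y = 0")
  case True
  then show ?thesis using assms by simp
next
  case False
  then have y: "y > 0" using assms by simp
  define u where "u = x / y"
  have u: "0 \<le> u" "u \<le> 1" "x = u * y"
    using assms y by (auto simp: u_def)
  have ge: "u' \<le> u' powr b" if "0 \<le> u'" "u' \<le> 1" for u'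
    using that assms powr_mono'[of b 1 u'] by (cases "u' = 0") auto
  have "1 - u powr b \<le> (1 - u) powr b"
    using ge[of u] ge[of "1 - u"] u by simp
  then have "y powr b * (1 - u powr b) \<le> y powr b * (1 - u) powr b"
    by (intro mult_left_mono) auto
  moreover have "(y - x) powr b = y powr b * (1 - u) powr b"
  proof -
    have "y - x = y * (1 - u)"
      by (simp add: u(3) algebra_simps)
    then show ?thesis
      using y u by (simp add: powr_mult)
  qed
  moreover have "x powr b = y powr b * u powr b"
    unfolding u(3) using y u(1) by (simp add: powr_mult)
  ultimately show ?thesis
    by (simp add: algebra_simps)
qed

lemma norm_cis_minus_one_le: "norm (cis x - 1) \<le> \<bar>x\<bar>"
proof -
  have pos: "norm (cis x - 1) \<le> x" if "0 < x" for x
  proof -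
    have "norm (cis x - cis 0) \<le> x - 0"
      by (rule differentiable_bound_general[OF that, of cis "\<lambda>x. x" "\<lambda>x. \<i> * cis x" "\<lambda>_. 1"])
         (auto intro: has_vector_derivative_cis continuous_intros simp: norm_mult)
    then show ?thesis by simp
  qed
  show ?thesis
  proof (cases "0 < x")
    case True
    then show ?thesis using pos[of x] by simp
  next
    case False
    have "norm (cis x - 1) = norm (cnj (cis (- x) - 1))"
      by (simp add: cis_cnj)
    then have "norm (cis x - 1) = norm (cis (- x) - 1)"
      by (simp only: complex_mod_cnj)
    then show ?thesis
      using pos[of "- x"] False by (cases "x = 0") auto
  qed
qed

text \<open>
  For \<open>0 \<le> x \<le> 1\<close> the Taylor remainder gives the bound with \<open>2\<close> in place of \<open>8\<close>. Halving the angle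
  does not increase the chord, and two halvings bring \<open>[0, \<pi>]\<close> into \<open>[0, 1]\<close>.
\<close>
lemma norm_cis_minus_one_ge:
  assumes "\<bar>x\<bar> \<le> pi"
  shows "\<bar>x\<bar> \<le> 8 * norm (cis x - 1)"
proof -
  have small: "x / 2 \<le> norm (cis x - 1)" if x: "0 \<le> x" "x \<le> 1" for x
  proof (cases "x = 0")
    case False
    have "norm ((cis x - 1 - \<i> * x) - (cis 0 - 1 - \<i> * of_real 0)) \<le> x ^ 2 / 2 - 0 ^ 2 / 2"
    proof (rule differentiable_bound_general)
      show "0 < x" using False x by simp
      show "((\<lambda>s. cis s - 1 - \<i> * of_real s) has_vector_derivative \<i> * cis s - \<i>) (at s)" for s
        by (auto intro!: derivative_eq_intros has_vector_derivative_cis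
            simp: has_vector_derivative_of_real)
      show "((\<lambda>s. s\<^sup>2 / 2) has_vector_derivative s) (at s)" for s :: real
        by (auto intro!: derivative_eq_intros simp: has_real_derivative_iff_has_vector_derivative[symmetric])
      fix s :: real assume "0 < s"
      have "norm (\<i> * cis s - \<i>) = norm (cis s - 1)"
        using norm_mult[of \<i> "cis s - 1"] by (simp add: algebra_simps)
      then show "norm (\<i> * cis s - \<i>) \<le> s"
        using norm_cis_minus_one_le[of s] \<open>0 < s\<close> by simp
    qed (auto intro!: continuous_intros)
    then have "norm (cis x - 1 - \<i> * x) \<le> x\<^sup>2 / 2"
      by simp
    moreover have "norm (\<i> * x) \<le> norm (cis x - 1) + norm (cis x - 1 - \<i> * x)"
      using norm_triangle_ineq4[of "cis x - 1" "cis x - 1 - \<i> * x"] by simp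
    moreover have "x\<^sup>2 \<le> x"
      using x by (simp add: power2_eq_square mult_left_le)
    ultimately show ?thesis
      using x by (simp add: norm_mult)
  qed simp
  have halve: "norm (cis (x / 2) - 1) \<le> norm (cis x - 1)" if "\<bar>x\<bar> \<le> pi" for x
  proof -
    have "cis x - 1 = (cis (x / 2) - 1) * (cis (x / 2) + 1)"
      by (simp add: algebra_simps cis_mult)
    moreover have "norm (cis (x / 2) + 1) \<ge> 1"
    proof -
      have "cos (x / 2) \<ge> 0"
        using that by (intro cos_ge_zero) auto
      then show ?thesis
        using complex_Re_le_cmod[of "cis (x / 2) + 1"] by simp
    qed
    ultimately show ?thesis
      by (simp add: norm_mult mult_left_le mult_le_cancel_left1)
  qed
  have pos: "x \<le> 8 * norm (cis x - 1)" if "0 \<le> x" "x \<le> pi" for x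
  proof -
    have "x / 4 / 2 \<le> norm (cis (x / 4) - 1)"
      using that pi_less_4 by (intro small) auto
    also have "\<dots> \<le> norm (cis (x / 2) - 1)"
      using halve[of "x / 2"] that by simp
    also have "\<dots> \<le> norm (cis x - 1)"
      using halve[of x] that by simp
    finally show ?thesis by simp
  qed
  show ?thesis
  proof (cases "0 \<le> x")
    case True
    then show ?thesis using pos[of x] assms by simp
  next
    case False
    have "norm (cis x - 1) = norm (cnj (cis (- x) - 1))"
      by (simp add: cis_cnj)
    then have "norm (cis x - 1) = norm (cis (- x) - 1)"
      by (simp only: complex_mod_cnj)
    then show ?thesis using pos[of "- x"] assms False by simp
  qed
qed

lemma norm_cis_diff: "norm (cis x - cis y) = norm (cis (x - y) - 1)"
proof -
  have "cis x - cis y = cis y * (cis (x - y) - 1)"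
    by (simp add: algebra_simps cis_mult)
  then show ?thesis by (simp add: norm_mult)
qed

lemma norm_cis_diff_le: "norm (cis x - cis y) \<le> \<bar>x - y\<bar>"
  by (simp add: norm_cis_diff norm_cis_minus_one_le)

lemma norm_cis_diff_ge: "\<bar>x - y\<bar> \<le> pi \<Longrightarrow> \<bar>x - y\<bar> \<le> 8 * norm (cis x - cis y)"
  by (simp add: norm_cis_diff norm_cis_minus_one_ge)

context circle_weight
begin

definition comparison_const :: "real \<Rightarrow> real \<Rightarrow> real \<Rightarrow> real" where
  "comparison_const d D R =
     exp ((\<Sum>k=1..m. \<bar>Re (\<rho> k)\<bar> * ln (D / d)) + (\<Sum>k=1..m. \<bar>Im (\<rho> k)\<bar> * (2 * R + 4 * pi)))"

lemma comparison_const_pos: "comparison_const d D R > 0"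
  by (simp add: comparison_const_def)

text \<open>
  By \<open>v_along_arc\<close> the quotient \<open>|v \<theta>| / |v \<theta>0|\<close> is the product of the factors
  \<open>(|cis \<theta> - a k| / |cis \<theta>0 - a k|) powr Re (\<rho> k)\<close> and of \<open>exp (- Im (\<rho> k) * \<Delta>\<^sub>k)\<close>, where \<open>\<Delta>\<^sub>k\<close> is
  the change of \<open>Im (arclog (a k))\<close> along the arc. The factor for \<open>k = j\<close>, which may degenerate,
  is kept, and the others are absorbed in a constant. That constant depends only on the exponents,
  on \<open>d\<close> and \<open>D\<close>, and on the range \<open>R\<close> of angles, so it can be shared by weights with different
  singularities.
\<close>
lemma norm_v_compare:
  assumes arc: "\<And>\<theta>'. \<theta>' \<in> closed_segment \<theta>0 \<theta> \<Longrightarrow> cis \<theta>' \<notin> a ` {1..m}"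
    and R: "\<bar>\<theta>\<bar> \<le> R" "\<bar>\<theta>0\<bar> \<le> R" and j: "j \<in> {1..m}" and d: "0 < d" "d \<le> D"
    and far: "\<And>k. k \<in> {1..m} \<Longrightarrow> k \<noteq> j \<Longrightarrow> d \<le> norm (cis \<theta> - a k) \<and> norm (cis \<theta> - a k) \<le> D \<and>
            d \<le> norm (cis \<theta>0 - a k) \<and> norm (cis \<theta>0 - a k) \<le> D"
  shows "norm (v \<theta>) \<le> comparison_const d D R *
           (norm (cis \<theta> - a j) / norm (cis \<theta>0 - a j)) powr Re (\<rho> j) * norm (v \<theta>0)"
proof -
  have sing: "cis \<theta> \<noteq> a k" "cis \<theta>0 \<noteq> a k" if "k \<in> {1..m}" for k
    using arc[OF ends_in_segment(1)] arc[OF ends_in_segment(2)] that by auto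
  define t where "t = (\<lambda>k. Re (\<rho> k) * (Re (arclog (a k) \<theta>) - Re (arclog (a k) \<theta>0)))"
  define i where "i = (\<lambda>k. - Im (\<rho> k) * (Im (arclog (a k) \<theta>) - Im (arclog (a k) \<theta>0)))"
  have Re_eq: "Re (arclog (a k) \<theta>) - Re (arclog (a k) \<theta>0) = ln (norm (cis \<theta> - a k) / norm (cis \<theta>0 - a k))"
    if "k \<in> {1..m}" for k
    using sing[OF that] by (simp add: Re_arclog exp_diff[symmetric])
  have "v \<theta> = v \<theta>0 * exp (log_sum \<theta> - log_sum \<theta>0)"
    using v_along_arc[OF arc] by (simp add: exp_diff exp_minus field_simps)
  then have "norm (v \<theta>) = norm (v \<theta>0) * exp (Re (log_sum \<theta> - log_sum \<theta>0))"
    by (simp add: norm_mult)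
  also have "Re (log_sum \<theta> - log_sum \<theta>0) = (\<Sum>k=1..m. t k) + (\<Sum>k=1..m. i k)"
    by (simp add: log_sum_def t_def i_def sum.distrib[symmetric] sum_subtractf[symmetric] algebra_simps)
  also have "(\<Sum>k=1..m. t k) = t j + (\<Sum>k\<in>{1..m} - {j}. t k)"
    using j by (intro sum.remove) auto
  also have "norm (v \<theta>0) * exp (t j + (\<Sum>k\<in>{1..m} - {j}. t k) + (\<Sum>k=1..m. i k)) \<le>
      norm (v \<theta>0) * exp (t j + (\<Sum>k=1..m. \<bar>Re (\<rho> k)\<bar> * ln (D / d)) +
        (\<Sum>k=1..m. \<bar>Im (\<rho> k)\<bar> * (2 * R + 4 * pi)))"
  proof -
    have "t k \<le> \<bar>Re (\<rho> k)\<bar> * ln (D / d)" if k: "k \<in> {1..m} - {j}" for k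
    proof -
      let ?q = "norm (cis \<theta> - a k) / norm (cis \<theta>0 - a k)"
      have f: "d \<le> norm (cis \<theta> - a k)" "norm (cis \<theta> - a k) \<le> D"
          "d \<le> norm (cis \<theta>0 - a k)" "norm (cis \<theta>0 - a k) \<le> D"
        using far[of k] k by auto
      have "?q \<le> D / d"
        using f d by (intro frac_le) auto
      moreover have "?q \<ge> d / D"
        using f d by (intro frac_le) auto
      moreover have "?q > 0" using sing[of k] k by simp
      ultimately have "ln ?q \<le> ln (D / d)" "ln (d / D) \<le> ln ?q"
        using d by auto
      moreover have "ln (d / D) = - ln (D / d)"
        using d by (simp add: ln_div)
      ultimately have "\<bar>ln ?q\<bar> \<le> ln (D / d)"
        by linarith
      then have "\<bar>t k\<bar> \<le> \<bar>Re (\<rho> k)\<bar> * ln (D / d)"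
        using k unfolding t_def by (simp only: Re_eq DiffD1 abs_mult) (auto intro!: mult_left_mono)
      then show ?thesis by simp
    qed
    then have "(\<Sum>k\<in>{1..m} - {j}. t k) \<le> (\<Sum>k\<in>{1..m} - {j}. \<bar>Re (\<rho> k)\<bar> * ln (D / d))"
      by (intro sum_mono)
    also have "\<dots> \<le> (\<Sum>k=1..m. \<bar>Re (\<rho> k)\<bar> * ln (D / d))"
      using d by (intro sum_mono2) auto
    finally have "(\<Sum>k\<in>{1..m} - {j}. t k) \<le> (\<Sum>k=1..m. \<bar>Re (\<rho> k)\<bar> * ln (D / d))" .
    moreover have "(\<Sum>k=1..m. i k) \<le> (\<Sum>k=1..m. \<bar>Im (\<rho> k)\<bar> * (2 * R + 4 * pi))"
    proof (rule sum_mono)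
      fix k assume "k \<in> {1..m}"
      then have "\<bar>Im (arclog (a k) \<theta>) - Im (arclog (a k) \<theta>0)\<bar> \<le> 2 * R + 4 * pi"
        using abs_Im_arclog[of \<theta> "a k"] abs_Im_arclog[of \<theta>0 "a k"] sing[of k] R by linarith
      then have "\<bar>i k\<bar> \<le> \<bar>Im (\<rho> k)\<bar> * (2 * R + 4 * pi)"
        unfolding i_def by (simp add: abs_mult mult_left_mono)
      then show "i k \<le> \<bar>Im (\<rho> k)\<bar> * (2 * R + 4 * pi)" by simp
    qed
    ultimately show ?thesis
      by (intro mult_left_mono) auto
  qed
  also have "\<dots> = comparison_const d D R * exp (t j) * norm (v \<theta>0)"
    by (simp add: comparison_const_def exp_add mult_ac)
  also have "exp (t j) = (norm (cis \<theta> - a j) / norm (cis \<theta>0 - a j)) powr Re (\<rho> j)"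
    unfolding t_def Re_eq[OF j] using sing[OF j] by (simp add: powr_def)
  finally show ?thesis .
qed

end

section \<open>Local behaviour at a singularity on the circle\<close>

locale integrable_circle_weight = circle_weight +
  assumes a_inj: "inj_on a {1..m}"
    and \<rho>_nonzero: "\<And>j. j \<in> {1..m} \<Longrightarrow> \<rho> j \<noteq> 0"
    and w_L1: "circle_L1 w"
    and deriv_w_L1: "circle_L1 (deriv w)"
begin

lemma circle_L1_w_mult: "continuous_on (sphere 0 1) f \<Longrightarrow> circle_L1 (\<lambda>\<zeta>. w \<zeta> * f \<zeta>)"
  by (rule circle_L1_mult_continuous[OF w_L1])

text \<open>
  The equation \<open>dw / d\<zeta> = w * \<Sum>\<^sub>k \<rho>\<^sub>k / (\<zeta> - a\<^sub>k)\<close> is solved for the \<open>j\<close>-th term. Multiplication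
  with \<open>Q = \<Prod>\<^sub>k\<^sub>\<noteq>\<^sub>j (\<zeta> - a\<^sub>k)\<close> clears the other poles, so that \<open>Q w / (\<zeta> - a\<^sub>j)\<close> is integrable,
  and subtracting the multiple \<open>w (Q - Q(a\<^sub>j)) / (\<zeta> - a\<^sub>j)\<close>, which has no pole, replaces \<open>Q\<close> by
  the nonzero constant \<open>Q(a\<^sub>j)\<close>.
\<close>
lemma circle_L1_pole:
  assumes j: "j \<in> {1..m}"
  shows "circle_L1 (\<lambda>\<zeta>. w \<zeta> / (\<zeta> - a j))"
proof -
  define Q where "Q = (\<Prod>k\<in>{1..m} - {j}. [:- a k, 1:])"
  define Q' where "Q' = (\<lambda>k. \<Prod>i\<in>{1..m} - {j} - {k}. [:- a i, 1:])"
  have Q_factor: "poly Q \<zeta> = (\<zeta> - a k) * poly (Q' k) \<zeta>" if "k \<in> {1..m} - {j}" for k \<zeta>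
    unfolding Q_def Q'_def by (subst prod.remove[OF _ that]) (simp_all add: algebra_simps)
  have Qj: "poly Q (a j) \<noteq> 0"
  proof -
    have "a j - a k \<noteq> 0" if "k \<in> {1..m} - {j}" for k
      using inj_onD[OF a_inj, of j k] j that by auto
    moreover have "poly Q (a j) = (\<Prod>k\<in>{1..m} - {j}. a j - a k)"
      by (simp add: Q_def poly_prod)
    ultimately show ?thesis
      by (simp only: prod_zero_iff finite_Diff finite_atLeastAtMost) blast
  qed
  define r where "r = synthetic_div Q (a j)"
  have Q_div: "poly Q \<zeta> = poly Q (a j) + (\<zeta> - a j) * poly r \<zeta>" for \<zeta>
    using arg_cong[OF synthetic_div_correct'[of "a j" Q], of "\<lambda>f. poly f \<zeta>"]
    by (simp add: r_def algebra_simps)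
  let ?g = "\<lambda>\<zeta>. 1 / poly Q (a j) * (1 / \<rho> j * (deriv w \<zeta> * poly Q \<zeta>
      - (\<Sum>k\<in>{1..m} - {j}. \<rho> k * (w \<zeta> * poly (Q' k) \<zeta>))) - w \<zeta> * poly r \<zeta>)"
  have "circle_L1 ?g"
    by (intro circle_L1_cmult circle_L1_diff circle_L1_sum circle_L1_mult_continuous[OF deriv_w_L1]
        circle_L1_w_mult continuous_intros continuous_on_poly)
  moreover have "?g \<zeta> = w \<zeta> / (\<zeta> - a j)"
    if \<zeta>: "\<zeta> \<in> sphere 0 1 - insert (-1) (a ` {1..m})" for \<zeta>
  proof -
    have nz: "\<zeta> - a k \<noteq> 0" if "k \<in> {1..m}" for k
      using \<zeta> that by auto
    have "deriv w \<zeta> = w \<zeta> * (\<Sum>k=1..m. \<rho> k / (\<zeta> - a k))"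
      using \<zeta> by (intro DERIV_imp_deriv w_deriv) auto
    also have "(\<Sum>k=1..m. \<rho> k / (\<zeta> - a k)) = \<rho> j / (\<zeta> - a j) + (\<Sum>k\<in>{1..m} - {j}. \<rho> k / (\<zeta> - a k))"
      using j by (intro sum.remove) auto
    finally have "deriv w \<zeta> * poly Q \<zeta> = w \<zeta> * (\<rho> j / (\<zeta> - a j)) * poly Q \<zeta> +
        (\<Sum>k\<in>{1..m} - {j}. w \<zeta> * (\<rho> k / (\<zeta> - a k)) * poly Q \<zeta>)"
      by (simp add: distrib_left distrib_right sum_distrib_left sum_distrib_right)
    also have "(\<Sum>k\<in>{1..m} - {j}. w \<zeta> * (\<rho> k / (\<zeta> - a k)) * poly Q \<zeta>) =
        (\<Sum>k\<in>{1..m} - {j}. \<rho> k * (w \<zeta> * poly (Q' k) \<zeta>))"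
      using nz by (intro sum.cong refl) (auto simp: Q_factor)
    finally have "?g \<zeta> = 1 / poly Q (a j) * (w \<zeta> / (\<zeta> - a j) * poly Q \<zeta> - w \<zeta> * poly r \<zeta>)"
      using \<rho>_nonzero[OF j] by simp
    also have "\<dots> = w \<zeta> / (\<zeta> - a j)"
      using nz[OF j] Qj by (subst Q_div) (simp add: field_simps)
    finally show ?thesis .
  qed
  ultimately show ?thesis
    using circle_L1_cong_finite[of "insert (-1) (a ` {1..m})" ?g "\<lambda>\<zeta>. w \<zeta> / (\<zeta> - a j)"] by simp
qed

lemma singularity_separated:
  assumes j: "j \<in> {1..m}"
  obtains d where "0 < d" "d \<le> 1" "\<And>k. k \<in> {1..m} \<Longrightarrow> k \<noteq> j \<Longrightarrow> 4 * d \<le> norm (a j - a k)"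
proof -
  define M where "M = Min (insert 1 ((\<lambda>k. norm (a j - a k)) ` ({1..m} - {j})))"
  show thesis
  proof (rule that[of "M / 4"])
    show "0 < M / 4"
      unfolding M_def
      using inj_onD[OF a_inj, of j] j by (subst zero_less_divide_iff, subst Min_gr_iff) (simp, simp, force)
    have "M \<le> 1"
      unfolding M_def by (intro Min_le) auto
    then show "M / 4 \<le> 1" by simp
    fix k assume "k \<in> {1..m}" "k \<noteq> j"
    then have "M \<le> norm (a j - a k)"
      unfolding M_def by (intro Min_le) auto
    then show "4 * (M / 4) \<le> norm (a j - a k)" by simp
  qed
qed

text \<open>
  Each side of the singularity has its own base point \<open>\<alpha> \<plusminus> \<delta>\<close>. Comparing \<open>\<theta>\<close> with the base point
  on the same side, in both directions, gives the two inequalities with exponent \<open>Re (\<rho> j)\<close>; the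
  values at the base points enter the constant.
\<close>
lemma v_local_bounds:
  assumes j: "j \<in> {1..m}" and \<alpha>: "cis \<alpha> = a j"
  obtains \<delta> C where "0 < \<delta>" "\<delta> \<le> 1" "C > 0"
    and "\<And>\<theta>. 0 < \<bar>\<theta> - \<alpha>\<bar> \<Longrightarrow> \<bar>\<theta> - \<alpha>\<bar> \<le> \<delta> \<Longrightarrow> cis \<theta> \<notin> insert (-1) (a ` {1..m})"
    and "\<And>\<theta>. 0 < \<bar>\<theta> - \<alpha>\<bar> \<Longrightarrow> \<bar>\<theta> - \<alpha>\<bar> \<le> \<delta> \<Longrightarrow>
           norm (v \<theta>) \<le> C * norm (cis \<theta> - a j) powr Re (\<rho> j)"
    and "\<And>\<theta>. 0 < \<bar>\<theta> - \<alpha>\<bar> \<Longrightarrow> \<bar>\<theta> - \<alpha>\<bar> \<le> \<delta> \<Longrightarrow>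
           norm (cis \<theta> - a j) powr Re (\<rho> j) \<le> C * norm (v \<theta>)"
    and "\<And>\<theta>. \<bar>\<theta> - \<alpha>\<bar> \<le> \<delta> \<Longrightarrow> norm (log_deriv \<theta>) * norm (cis \<theta> - a j) \<le> C"
proof -
  define S where "S = insert (-1) (a ` {1..m}) - {a j}"
  have "\<forall>\<^sub>F \<theta> in nhds \<alpha>. cis \<theta> \<notin> S"
    by (rule eventually_cis_notin) (auto simp: S_def \<alpha>)
  then have "\<forall>\<^sub>F \<theta> in at \<alpha>. cis \<theta> \<notin> S"
    by (simp add: eventually_at_filter eventually_mono)
  then have "\<forall>\<^sub>F \<theta> in at \<alpha>. cis \<theta> \<notin> insert (-1) (a ` {1..m})"
    using eventually_cis_neq[of \<alpha>] by eventually_elim (auto simp: S_def \<alpha>)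
  then obtain \<delta>0 where \<delta>0: "\<delta>0 > 0"
    "\<And>\<theta>. \<theta> \<noteq> \<alpha> \<Longrightarrow> \<bar>\<theta> - \<alpha>\<bar> < \<delta>0 \<Longrightarrow> cis \<theta> \<notin> insert (-1) (a ` {1..m})"
    unfolding eventually_at by (auto simp: dist_real_def)
  obtain d where d: "0 < d" "d \<le> 1" "\<And>k. k \<in> {1..m} \<Longrightarrow> k \<noteq> j \<Longrightarrow> 4 * d \<le> norm (a j - a k)"
    using singularity_separated[OF j] by metis
  define D where "D = 1 + (\<Sum>k=1..m. norm (a k))"
  define \<delta> where "\<delta> = min (\<delta>0 / 2) (min d 1)"
  have \<delta>: "0 < \<delta>" "\<delta> \<le> 1" "\<delta> \<le> d" "\<delta> < \<delta>0"
    using \<delta>0(1) d(1) by (auto simp: \<delta>_def)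
  have far: "d \<le> norm (cis \<theta> - a k) \<and> norm (cis \<theta> - a k) \<le> D"
    if "\<bar>\<theta> - \<alpha>\<bar> \<le> \<delta>" "k \<in> {1..m}" "k \<noteq> j" for \<theta> k
  proof
    have "2 * d \<le> norm (a j - a k)" using d(3)[OF that(2,3)] d(1) by simp
    also have "\<dots> \<le> norm (cis \<theta> - a k) + norm (cis \<theta> - cis \<alpha>)"
      using norm_triangle_ineq4[of "cis \<theta> - a k" "cis \<theta> - cis \<alpha>"] by (simp add: \<alpha>)
    also have "norm (cis \<theta> - cis \<alpha>) \<le> d"
      using norm_cis_diff_le[of \<theta> \<alpha>] that(1) \<delta> by linarith
    finally show "d \<le> norm (cis \<theta> - a k)" by simp
    have "norm (cis \<theta> - a k) \<le> 1 + norm (a k)"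
      using norm_triangle_ineq4[of "cis \<theta>" "a k"] by simp
    also have "norm (a k) \<le> (\<Sum>k=1..m. norm (a k))"
      using that by (intro member_le_sum) auto
    finally show "norm (cis \<theta> - a k) \<le> D" by (simp add: D_def)
  qed
  have dD: "d \<le> D"
    using d(2) by (simp add: D_def sum_nonneg add_increasing2)
  have sing: "cis \<theta> \<notin> insert (-1) (a ` {1..m})" if "0 < \<bar>\<theta> - \<alpha>\<bar>" "\<bar>\<theta> - \<alpha>\<bar> \<le> \<delta>" for \<theta>
    using that \<delta> by (intro \<delta>0(2)) auto
  define R where "R = \<bar>\<alpha>\<bar> + 1"
  define K where "K = comparison_const d D R"
  define r where "r = Re (\<rho> j)"
  have K: "K > 0" by (simp add: K_def comparison_const_pos)
  define base where "base = (\<lambda>\<theta>. if \<theta> < \<alpha> then \<alpha> - \<delta> else \<alpha> + \<delta>)"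
  have base: "\<bar>base \<theta> - \<alpha>\<bar> = \<delta>" for \<theta>
    using \<delta> by (simp add: base_def)
  have between: "0 < \<bar>x - \<alpha>\<bar> \<and> \<bar>x - \<alpha>\<bar> \<le> \<delta>"
    if "x \<in> closed_segment \<theta> (base \<theta>)" "0 < \<bar>\<theta> - \<alpha>\<bar>" "\<bar>\<theta> - \<alpha>\<bar> \<le> \<delta>" for x \<theta>
    using that \<delta> by (auto simp: closed_segment_eq_real_ivl base_def split: if_splits)
  have compare: "norm (v \<theta>) \<le> K * (norm (cis \<theta> - a j) / norm (cis \<theta>' - a j)) powr r * norm (v \<theta>')"
    if "{\<theta>, \<theta>'} = {x, base x}" "0 < \<bar>x - \<alpha>\<bar>" "\<bar>x - \<alpha>\<bar> \<le> \<delta>" for \<theta> \<theta>' x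
    unfolding K_def r_def
  proof (rule norm_v_compare)
    have mem: "\<theta> \<in> {x, base x}" "\<theta>' \<in> {x, base x}"
      using that(1) by blast+
    then have le: "\<bar>\<theta> - \<alpha>\<bar> \<le> \<delta>" "\<bar>\<theta>' - \<alpha>\<bar> \<le> \<delta>"
      using that(3) base[of x] by auto
    then show "\<bar>\<theta>\<bar> \<le> R" "\<bar>\<theta>'\<bar> \<le> R"
      using \<delta> by (auto simp: R_def)
    show "d \<le> norm (cis \<theta> - a k) \<and> norm (cis \<theta> - a k) \<le> D \<and>
        d \<le> norm (cis \<theta>' - a k) \<and> norm (cis \<theta>' - a k) \<le> D" if "k \<in> {1..m}" "k \<noteq> j" for k
      using far[OF le(1) that] far[OF le(2) that] by blast
    fix y assume "y \<in> closed_segment \<theta>' \<theta>"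
    moreover have "closed_segment \<theta>' \<theta> = closed_segment x (base x)"
      using that(1) by (auto simp: doubleton_eq_iff closed_segment_commute)
    ultimately show "cis y \<notin> a ` {1..m}"
      using between[of y x] that sing by blast
  qed (use j d dD in auto)
  define N where "N = norm (v (\<alpha> - \<delta>)) + norm (v (\<alpha> + \<delta>)) +
      1 / norm (v (\<alpha> - \<delta>)) + 1 / norm (v (\<alpha> + \<delta>))"
  define Y where "Y = (\<lambda>\<theta>. norm (cis (base \<theta>) - a j) powr r)"
  have v_base: "v (base \<theta>) \<noteq> 0" for \<theta>
  proof -
    have "cis (base \<theta>) \<notin> insert (-1) (a ` {1..m})"
      by (rule sing) (use base[of \<theta>] \<delta> in auto)
    then show ?thesis
      using w_nonzero[of "cis (base \<theta>)"] by (simp add: v_eq_w)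
  qed
  have N_ge: "norm (v (base \<theta>)) \<le> N" "1 / norm (v (base \<theta>)) \<le> N" for \<theta>
    by (auto simp: N_def base_def)
  have N_pos: "N > 0"
    using N_ge(1)[of 0] v_base[of 0] by (meson less_le_trans zero_less_norm_iff)
  define Z where "Z = norm (cis (\<alpha> - \<delta>) - a j) powr r + norm (cis (\<alpha> + \<delta>) - a j) powr r +
      1 / norm (cis (\<alpha> - \<delta>) - a j) powr r + 1 / norm (cis (\<alpha> + \<delta>) - a j) powr r"
  have Y_pos: "Y \<theta> > 0" for \<theta>
  proof -
    have "cis (base \<theta>) \<notin> insert (-1) (a ` {1..m})"
      by (rule sing) (use base[of \<theta>] \<delta> in auto)
    then have "cis (base \<theta>) \<noteq> a j" using j by auto
    then show ?thesis by (simp add: Y_def)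
  qed
  have Z_ge: "Y \<theta> \<le> Z" "1 / Y \<theta> \<le> Z" for \<theta>
    by (auto simp: Y_def Z_def base_def)
  have Z_pos: "Z > 0"
    using Z_ge(1)[of 0] Y_pos[of 0] by linarith
  define E where "E = (\<Sum>k=1..m. norm (\<rho> k) * (D + 1) / d)"
  define C where "C = K * Z * N + (norm (\<rho> j) + E)"
  have E_nonneg: "E \<ge> 0"
    unfolding E_def using d dD by (intro sum_nonneg) auto
  have C_pos: "C > 0"
    unfolding C_def using K Z_pos N_pos E_nonneg by (intro add_pos_nonneg) auto
  have C_ge: "K * Z * N \<le> C" "norm (\<rho> j) + E \<le> C"
    using K Z_pos N_pos E_nonneg by (auto simp: C_def)
  show thesis
  proof (rule that[OF \<delta>(1,2) C_pos])
    fix \<theta> assume \<theta>: "0 < \<bar>\<theta> - \<alpha>\<bar>" "\<bar>\<theta> - \<alpha>\<bar> \<le> \<delta>"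
    show "cis \<theta> \<notin> insert (-1) (a ` {1..m})"
      by (rule sing[OF \<theta>])
    have nz: "norm (cis \<theta> - a j) > 0"
      using sing[OF \<theta>] j by auto
    have ratio: "(x / y) powr r = x powr r * (1 / y powr r)" if "x \<ge> 0" "y \<ge> 0" for x y
      using that by (simp add: powr_divide)
    have "norm (v \<theta>) \<le> K * (norm (cis \<theta> - a j) powr r * (1 / Y \<theta>)) * norm (v (base \<theta>))"
      using compare[of \<theta> "base \<theta>" \<theta>] \<theta> by (simp add: ratio Y_def)
    also have "\<dots> \<le> K * (norm (cis \<theta> - a j) powr r * Z) * N"
      using K Z_pos Y_pos[of \<theta>] by (intro mult_mono N_ge Z_ge mult_left_mono) auto
    also have "\<dots> = K * Z * N * norm (cis \<theta> - a j) powr r"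
      by simp
    also have "\<dots> \<le> C * norm (cis \<theta> - a j) powr r"
      using C_ge by (intro mult_right_mono) auto
    finally show "norm (v \<theta>) \<le> C * norm (cis \<theta> - a j) powr Re (\<rho> j)"
      by (simp add: r_def)
    have "norm (v (base \<theta>)) \<le> K * (Y \<theta> * (1 / norm (cis \<theta> - a j) powr r)) * norm (v \<theta>)"
      using compare[of "base \<theta>" \<theta> \<theta>] \<theta> by (simp add: ratio Y_def insert_commute)
    then have "norm (cis \<theta> - a j) powr r * norm (v (base \<theta>)) \<le> K * Y \<theta> * norm (v \<theta>)"
      using nz by (simp add: field_simps)
    then have "norm (cis \<theta> - a j) powr r \<le> K * Y \<theta> * norm (v \<theta>) * (1 / norm (v (base \<theta>)))"
      using v_base[of \<theta>] by (simp add: field_simps)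
    also have "\<dots> \<le> K * Z * norm (v \<theta>) * N"
      using K Z_pos Y_pos[of \<theta>] by (intro mult_mono N_ge Z_ge mult_left_mono) auto
    also have "\<dots> = K * Z * N * norm (v \<theta>)"
      by simp
    also have "\<dots> \<le> C * norm (v \<theta>)"
      using C_ge by (intro mult_right_mono) auto
    finally show "norm (cis \<theta> - a j) powr Re (\<rho> j) \<le> C * norm (v \<theta>)"
      by (simp add: r_def)
  next
    fix \<theta> assume \<theta>: "\<bar>\<theta> - \<alpha>\<bar> \<le> \<delta>"
    let ?x = "norm (cis \<theta> - a j)"
    have x: "?x \<le> D + 1"
      using norm_cis_diff_le[of \<theta> \<alpha>] \<theta> \<delta> by (simp add: \<alpha> D_def sum_nonneg add_increasing2)
    have "norm (log_deriv \<theta>) * ?x \<le> (\<Sum>k=1..m. norm (\<rho> k) / norm (cis \<theta> - a k)) * ?x"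
      unfolding log_deriv_def
      by (intro mult_right_mono order.trans[OF norm_sum] sum_mono) (auto simp: norm_mult norm_divide)
    also have "\<dots> = (\<Sum>k=1..m. norm (\<rho> k) / norm (cis \<theta> - a k) * ?x)"
      by (simp add: sum_distrib_right)
    also have "\<dots> = norm (\<rho> j) / ?x * ?x + (\<Sum>k\<in>{1..m} - {j}. norm (\<rho> k) / norm (cis \<theta> - a k) * ?x)"
      using j by (intro sum.remove) auto
    also have "(\<Sum>k\<in>{1..m} - {j}. norm (\<rho> k) / norm (cis \<theta> - a k) * ?x) \<le>
        (\<Sum>k\<in>{1..m} - {j}. norm (\<rho> k) * (D + 1) / d)"
    proof (rule sum_mono)
      fix k assume "k \<in> {1..m} - {j}"
      then have "norm (\<rho> k) / norm (cis \<theta> - a k) \<le> norm (\<rho> k) / d"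
        using far[OF \<theta>, of k] d(1) by (intro frac_le) auto
      then have "norm (\<rho> k) / norm (cis \<theta> - a k) * ?x \<le> norm (\<rho> k) / d * (D + 1)"
        using x d by (intro mult_mono) auto
      then show "norm (\<rho> k) / norm (cis \<theta> - a k) * ?x \<le> norm (\<rho> k) * (D + 1) / d"
        by simp
    qed
    also have "\<dots> \<le> E"
      unfolding E_def using d dD by (intro sum_mono2) auto
    also have "norm (\<rho> j) / ?x * ?x + E \<le> norm (\<rho> j) + E"
      by simp
    finally show "norm (log_deriv \<theta>) * ?x \<le> C"
      using C_ge(2) by simp
  qed
qed

end

lemma cis_Arg_unit:
  assumes "norm z = 1"
  shows "cis (Arg z) = z"
proof -
  have "z \<noteq> 0" using assms by auto
  then show ?thesis
    using cis_Arg[of z] assms by (simp add: sgn_div_norm)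
qed

text \<open>
  The reciprocal has a logarithmically divergent integral.
\<close>
lemma not_dominating_reciprocal:
  fixes g :: "real \<Rightarrow> real"
  assumes g: "g integrable_on {\<alpha> - \<delta>..\<alpha>}" "\<And>x. g x \<ge> 0" and "\<delta> > 0" "c > 0"
    and lower: "\<And>x. \<alpha> - \<delta> \<le> x \<Longrightarrow> x < \<alpha> \<Longrightarrow> c / (\<alpha> - x) \<le> g x"
  shows False
proof -
  define I where "I = integral {\<alpha> - \<delta>..\<alpha>} g"
  have bound: "c * ln (\<delta> / e) \<le> I" if e: "0 < e" "e < \<delta>" for e
  proof -
    have "((\<lambda>x. c / (\<alpha> - x)) has_integral (- c * ln (\<alpha> - (\<alpha> - e)) - (- c * ln (\<alpha> - (\<alpha> - \<delta>))))) {\<alpha> - \<delta>..\<alpha> - e}"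
    proof (rule fundamental_theorem_of_calculus)
      fix x assume "x \<in> {\<alpha> - \<delta>..\<alpha> - e}"
      then have "x < \<alpha>" using e by auto
      then have "((\<lambda>x. - c * ln (\<alpha> - x)) has_real_derivative c / (\<alpha> - x)) (at x)"
        by (auto intro!: derivative_eq_intros simp: divide_inverse)
      then show "((\<lambda>x. - c * ln (\<alpha> - x)) has_vector_derivative c / (\<alpha> - x)) (at x within {\<alpha> - \<delta>..\<alpha> - e})"
        by (simp add: has_real_derivative_iff_has_vector_derivative has_vector_derivative_at_within)
    qed (use e in auto)
    moreover have "- c * ln (\<alpha> - (\<alpha> - e)) - (- c * ln (\<alpha> - (\<alpha> - \<delta>))) = c * ln (\<delta> / e)"
      using e assms(3) by (simp add: ln_div algebra_simps)
    ultimately have int: "((\<lambda>x. c / (\<alpha> - x)) has_integral (c * ln (\<delta> / e))) {\<alpha> - \<delta>..\<alpha> - e}"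
      by simp
    have gi: "g integrable_on {\<alpha> - \<delta>..\<alpha> - e}"
      by (rule integrable_on_subinterval[OF g(1)]) (use e in auto)
    have "c * ln (\<delta> / e) \<le> integral {\<alpha> - \<delta>..\<alpha> - e} g"
      by (rule has_integral_le[OF int integrable_integral[OF gi]]) (use lower e in auto)
    also have "\<dots> \<le> I"
      unfolding I_def by (rule integral_subset_le) (use gi g e in auto)
    finally show ?thesis .
  qed
  define e where "e = \<delta> * exp (- (\<bar>I\<bar> + 1) / c)"
  have "exp (- (\<bar>I\<bar> + 1) / c) < 1"
    using \<open>c > 0\<close> by (simp add: divide_neg_pos)
  then have "0 < e" "e < \<delta>"
    using \<open>\<delta> > 0\<close> by (auto simp: e_def)
  moreover have "c * ln (\<delta> / e) = \<bar>I\<bar> + 1"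
    using assms(3,4) by (simp add: e_def ln_div ln_mult)
  ultimately show False
    using bound[of e] by linarith
qed

text \<open>
  Integrate the bound on the derivative and use subadditivity of \<open>u powr b\<close>.
\<close>
lemma power_derivative_imp_Hoelder:
  fixes f :: "real \<Rightarrow> complex"
  assumes b: "0 < b" "b \<le> 1" and x: "0 < x" "x \<le> y" "y \<le> \<delta>"
    and deriv: "\<And>u. 0 < u \<Longrightarrow> u \<le> \<delta> \<Longrightarrow> (f has_vector_derivative f' u) (at u)"
    and bound: "\<And>u. 0 < u \<Longrightarrow> u \<le> \<delta> \<Longrightarrow> norm (f' u) \<le> C * u powr (b - 1)"
    and C: "C \<ge> 0"
  shows "norm (f y - f x) \<le> C / b * (y - x) powr b"
proof (cases "x = y")
  case False
  have "norm (f y - f x) \<le> C / b * y powr b - C / b * x powr b"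
  proof (rule differentiable_bound_general)
    show "continuous_on {x..y} f"
    proof (rule continuous_at_imp_continuous_on, rule ballI)
      fix u assume "u \<in> {x..y}"
      then show "isCont f u"
        using has_vector_derivative_continuous[OF deriv[of u]] x by simp
    qed
    show "continuous_on {x..y} (\<lambda>u. C / b * u powr b)"
      using x by (intro continuous_intros) auto
    fix u assume u: "x < u" "u < y"
    then show "(f has_vector_derivative f' u) (at u)" "norm (f' u) \<le> C * u powr (b - 1)"
      using deriv bound x by auto
    show "((\<lambda>u. C / b * u powr b) has_vector_derivative C * u powr (b - 1)) (at u)"
      unfolding has_real_derivative_iff_has_vector_derivative[symmetric]
      using u x b by (auto intro!: derivative_eq_intros)
  qed (use x False in auto)
  also have "\<dots> = C / b * (y powr b - x powr b)"
    by (simp add: right_diff_distrib)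
  also have "\<dots> \<le> C / b * (y - x) powr b"
    using x b C by (intro mult_left_mono powr_diff_le_diff_powr) auto
  finally show ?thesis .
qed simp

context integrable_circle_weight
begin

text \<open>
  Otherwise \<open>w\<close> would be bounded away from zero near \<open>a j\<close>, and \<open>w / (\<zeta> - a j)\<close> could not be
  integrable.
\<close>
lemma Re_exponent_pos:
  assumes j: "j \<in> {1..m}" and aj: "norm (a j) = 1"
  shows "Re (\<rho> j) > 0"
proof (rule ccontr)
  assume neg: "\<not> Re (\<rho> j) > 0"
  define \<alpha> where "\<alpha> = Arg (a j)"
  have \<alpha>: "cis \<alpha> = a j" "-pi < \<alpha>" "\<alpha> \<le> pi"
    using cis_Arg_unit[OF aj] Arg_bounded[of "a j"] by (auto simp: \<alpha>_def)
  from v_local_bounds[OF j \<alpha>(1)] obtain \<delta> C where \<delta>: "0 < \<delta>" "\<delta> \<le> 1" "C > 0"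
    and sing: "\<And>\<theta>. 0 < \<bar>\<theta> - \<alpha>\<bar> \<Longrightarrow> \<bar>\<theta> - \<alpha>\<bar> \<le> \<delta> \<Longrightarrow> cis \<theta> \<notin> insert (-1) (a ` {1..m})"
    and lower: "\<And>\<theta>. 0 < \<bar>\<theta> - \<alpha>\<bar> \<Longrightarrow> \<bar>\<theta> - \<alpha>\<bar> \<le> \<delta> \<Longrightarrow>
           norm (cis \<theta> - a j) powr Re (\<rho> j) \<le> C * norm (v \<theta>)"
    by metis
  \<comment> \<open>The interval to the left of \<open>\<alpha>\<close> lies in \<open>{-pi..pi}\<close> after shortening, as \<open>\<alpha> > -pi\<close>.\<close>
  define \<eta> where "\<eta> = min \<delta> (\<alpha> + pi)"
  have \<eta>: "0 < \<eta>" "\<eta> \<le> \<delta>" "{\<alpha> - \<eta>..\<alpha>} \<subseteq> {-pi..pi}"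
    using \<delta> \<alpha> by (auto simp: \<eta>_def)
  define g where "g = (\<lambda>\<theta>. norm (w (cis \<theta>) / (cis \<theta> - a j)))"
  have "(\<lambda>\<theta>. w (cis \<theta>) / (cis \<theta> - a j)) absolutely_integrable_on {-pi..pi}"
    using circle_L1_pole[OF j] by (simp add: circle_L1_def)
  then have "g integrable_on {-pi..pi}"
    unfolding g_def by (simp add: absolutely_integrable_on_def)
  then have gi: "g integrable_on {\<alpha> - \<eta>..\<alpha>}"
    by (rule integrable_on_subinterval) (rule \<eta>(3))
  show False
  proof (rule not_dominating_reciprocal[OF gi])
    show "0 < 1 / C" using \<delta> by simp
    fix x assume x: "\<alpha> - \<eta> \<le> x" "x < \<alpha>"
    then have x': "0 < \<bar>x - \<alpha>\<bar>" "\<bar>x - \<alpha>\<bar> \<le> \<delta>" using \<eta> by auto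
    let ?y = "norm (cis x - a j)"
    have y: "?y \<le> \<alpha> - x"
      using norm_cis_diff_le[of x \<alpha>] x by (simp add: \<alpha>(1))
    have y0: "0 < ?y"
      using sing[OF x'] j by auto
    have "1 \<le> ?y powr Re (\<rho> j)"
    proof -
      have "?y \<le> 1" using y x x' \<delta> by linarith
      then have "?y powr 0 \<le> ?y powr Re (\<rho> j)"
        using neg y0 by (intro powr_mono') auto
      then show ?thesis using y0 by simp
    qed
    then have "1 \<le> C * norm (v x)"
      using lower[OF x'] by linarith
    then have "1 / C \<le> norm (v x)"
      using \<delta> by (simp add: field_simps)
    then have "1 / C / (\<alpha> - x) \<le> norm (v x) / ?y"
      using y y0 \<delta> by (intro frac_le) auto
    then show "1 / C / (\<alpha> - x) \<le> g x"
      using v_eq_w[OF sing[OF x']] by (simp add: g_def norm_divide)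
  qed (auto simp: g_def \<eta>)
qed

lemma v_singular: "cis \<alpha> = a j \<Longrightarrow> j \<in> {1..m} \<Longrightarrow> v \<alpha> = 0"
  by (auto simp: v_def)

text \<open>
  On either side of the singularity the derivative \<open>v * log_deriv\<close> is bounded by a multiple of
  \<open>|\<theta> - \<alpha>| powr (b - 1)\<close>; for two angles on different sides the value \<open>v \<alpha> = 0\<close> is used as an
  intermediate step.
\<close>
lemma v_Hoelder:
  assumes j: "j \<in> {1..m}" and \<alpha>: "cis \<alpha> = a j"
  obtains \<delta> H b where "0 < \<delta>" "0 < b" "b \<le> 1" "H \<ge> 0"
    "\<And>x y. \<bar>x - \<alpha>\<bar> \<le> \<delta> \<Longrightarrow> \<bar>y - \<alpha>\<bar> \<le> \<delta> \<Longrightarrow> norm (v x - v y) \<le> H * \<bar>x - y\<bar> powr b"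
proof -
  have "norm (a j) = 1"
    using \<alpha> norm_cis by metis
  from v_local_bounds[OF j \<alpha>] obtain \<delta> C where \<delta>: "0 < \<delta>" "\<delta> \<le> 1" "C > 0"
    and sing: "\<And>\<theta>. 0 < \<bar>\<theta> - \<alpha>\<bar> \<Longrightarrow> \<bar>\<theta> - \<alpha>\<bar> \<le> \<delta> \<Longrightarrow> cis \<theta> \<notin> insert (-1) (a ` {1..m})"
    and upper: "\<And>\<theta>. 0 < \<bar>\<theta> - \<alpha>\<bar> \<Longrightarrow> \<bar>\<theta> - \<alpha>\<bar> \<le> \<delta> \<Longrightarrow>
           norm (v \<theta>) \<le> C * norm (cis \<theta> - a j) powr Re (\<rho> j)"
    and ld: "\<And>\<theta>. \<bar>\<theta> - \<alpha>\<bar> \<le> \<delta> \<Longrightarrow> norm (log_deriv \<theta>) * norm (cis \<theta> - a j) \<le> C"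
    by metis
  define r where "r = Re (\<rho> j)"
  have r: "r > 0"
    unfolding r_def using Re_exponent_pos[OF j \<open>norm (a j) = 1\<close>] .
  \<comment> \<open>Exponents above \<open>1\<close> give no more than Lipschitz continuity.\<close>
  define b where "b = min r 1"
  have b: "0 < b" "b \<le> 1" "b \<le> r"
    using r by (auto simp: b_def)
  define C' where "C' = C * C * 8"
  have C': "C' \<ge> 0" using \<delta> by (simp add: C'_def)
  have chord: "\<bar>\<theta> - \<alpha>\<bar> / 8 \<le> norm (cis \<theta> - a j)" "norm (cis \<theta> - a j) \<le> \<bar>\<theta> - \<alpha>\<bar>"
    if "\<bar>\<theta> - \<alpha>\<bar> \<le> \<delta>" for \<theta>
    using norm_cis_diff_ge[of \<theta> \<alpha>] norm_cis_diff_le[of \<theta> \<alpha>] that \<delta> pi_ge_two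
    by (auto simp: \<alpha>)
  have v_upper: "norm (v \<theta>) \<le> C * \<bar>\<theta> - \<alpha>\<bar> powr b" if "0 < \<bar>\<theta> - \<alpha>\<bar>" "\<bar>\<theta> - \<alpha>\<bar> \<le> \<delta>" for \<theta>
  proof -
    have "norm (cis \<theta> - a j) powr r \<le> \<bar>\<theta> - \<alpha>\<bar> powr r"
      using r chord(2)[OF that(2)] by (intro powr_mono2) auto
    also have "\<dots> \<le> \<bar>\<theta> - \<alpha>\<bar> powr b"
      using that \<delta> b by (intro powr_mono') auto
    finally have "C * norm (cis \<theta> - a j) powr r \<le> C * \<bar>\<theta> - \<alpha>\<bar> powr b"
      using \<delta> by (intro mult_left_mono) auto
    then show ?thesis
      using upper[OF that] by (simp add: r_def)
  qed
  have d_upper: "norm (v \<theta> * log_deriv \<theta>) \<le> C' * \<bar>\<theta> - \<alpha>\<bar> powr (b - 1)"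
    if "0 < \<bar>\<theta> - \<alpha>\<bar>" "\<bar>\<theta> - \<alpha>\<bar> \<le> \<delta>" for \<theta>
  proof -
    have "\<bar>\<theta> - \<alpha>\<bar> * norm (log_deriv \<theta>) \<le> 8 * (norm (log_deriv \<theta>) * norm (cis \<theta> - a j))"
      using mult_right_mono[OF chord(1)[OF that(2)], of "norm (log_deriv \<theta>)"] by (simp add: mult_ac)
    also have "\<dots> \<le> 8 * C"
      using ld[OF that(2)] by simp
    finally have "norm (log_deriv \<theta>) \<le> 8 * C / \<bar>\<theta> - \<alpha>\<bar>"
      using that by (simp add: field_simps)
    then have "norm (v \<theta>) * norm (log_deriv \<theta>) \<le> C * \<bar>\<theta> - \<alpha>\<bar> powr b * (8 * C / \<bar>\<theta> - \<alpha>\<bar>)"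
      using v_upper[OF that] \<delta> by (intro mult_mono) auto
    also have "\<dots> = C' * \<bar>\<theta> - \<alpha>\<bar> powr (b - 1)"
      using that by (simp add: C'_def powr_diff)
    finally show ?thesis by (simp add: norm_mult)
  qed
  have v_deriv: "(v has_vector_derivative v \<theta> * log_deriv \<theta>) (at \<theta>)"
    if "0 < \<bar>\<theta> - \<alpha>\<bar>" "\<bar>\<theta> - \<alpha>\<bar> \<le> \<delta>" for \<theta>
    by (rule v_has_vector_derivative[OF sing[OF that]])
  have right: "norm (v (\<alpha> + y) - v (\<alpha> + x)) \<le> C' / b * (y - x) powr b"
    if "0 < x" "x \<le> y" "y \<le> \<delta>" for x y
  proof (rule power_derivative_imp_Hoelder[OF b(1,2) that])
    fix u assume u: "0 < u" "u \<le> \<delta>"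
    have "((v \<circ> (\<lambda>u. \<alpha> + u)) has_vector_derivative 1 *\<^sub>R (v (\<alpha> + u) * log_deriv (\<alpha> + u))) (at u)"
      using u by (intro vector_diff_chain_at v_deriv) (auto intro!: derivative_eq_intros)
    then show "((\<lambda>u. v (\<alpha> + u)) has_vector_derivative v (\<alpha> + u) * log_deriv (\<alpha> + u)) (at u)"
      by (simp add: o_def)
    show "norm (v (\<alpha> + u) * log_deriv (\<alpha> + u)) \<le> C' * u powr (b - 1)"
      using d_upper[of "\<alpha> + u"] u by simp
  qed (rule C')
  have left: "norm (v (\<alpha> - y) - v (\<alpha> - x)) \<le> C' / b * (y - x) powr b"
    if "0 < x" "x \<le> y" "y \<le> \<delta>" for x y
  proof (rule power_derivative_imp_Hoelder[OF b(1,2) that])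
    fix u assume u: "0 < u" "u \<le> \<delta>"
    have "((v \<circ> (\<lambda>u. \<alpha> - u)) has_vector_derivative (- 1) *\<^sub>R (v (\<alpha> - u) * log_deriv (\<alpha> - u))) (at u)"
      using u by (intro vector_diff_chain_at v_deriv) (auto intro!: derivative_eq_intros)
    then show "((\<lambda>u. v (\<alpha> - u)) has_vector_derivative - (v (\<alpha> - u) * log_deriv (\<alpha> - u))) (at u)"
      by (simp add: o_def)
    show "norm (- (v (\<alpha> - u) * log_deriv (\<alpha> - u))) \<le> C' * u powr (b - 1)"
      using d_upper[of "\<alpha> - u"] u by simp
  qed (rule C')
  define H where "H = C' / b + 2 * C"
  have H: "H \<ge> 0" "C' / b \<le> H" "2 * C \<le> H"
    using C' b \<delta> by (auto simp: H_def)
  have v_upper': "norm (v \<theta>) \<le> C * \<bar>\<theta> - \<alpha>\<bar> powr b" if "\<bar>\<theta> - \<alpha>\<bar> \<le> \<delta>" for \<theta>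
  proof (cases "\<theta> = \<alpha>")
    case True
    then show ?thesis using v_singular[OF \<alpha> j] by simp
  next
    case False
    then show ?thesis using v_upper[of \<theta>] that by simp
  qed
  have main: "norm (v x - v y) \<le> H * \<bar>x - y\<bar> powr b"
    if le: "\<bar>x - \<alpha>\<bar> \<le> \<delta>" "\<bar>y - \<alpha>\<bar> \<le> \<delta>" and xy: "x \<le> y" for x y
  proof -
    consider "\<alpha> < x" | "y < \<alpha>" | "x \<le> \<alpha>" "\<alpha> \<le> y" by linarith
    then show ?thesis
    proof cases
      case 1
      have "norm (v y - v x) \<le> C' / b * (y - x) powr b"
        using right[of "x - \<alpha>" "y - \<alpha>"] 1 le xy by simp
      also have "\<dots> \<le> H * (y - x) powr b"
        using H by (intro mult_right_mono) auto
      finally show ?thesis using xy by (simp add: norm_minus_commute abs_minus_commute)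
    next
      case 2
      have "norm (v x - v y) \<le> C' / b * (y - x) powr b"
        using left[of "\<alpha> - y" "\<alpha> - x"] 2 le xy by simp
      also have "\<dots> \<le> H * (y - x) powr b"
        using H by (intro mult_right_mono) auto
      finally show ?thesis using xy by (simp add: norm_minus_commute abs_minus_commute)
    next
      case 3
      have "norm (v x - v y) \<le> norm (v x) + norm (v y)"
        by (rule norm_triangle_ineq4)
      also have "\<dots> \<le> C * \<bar>x - \<alpha>\<bar> powr b + C * \<bar>y - \<alpha>\<bar> powr b"
        using v_upper'[OF le(1)] v_upper'[OF le(2)] by simp
      also have "\<dots> \<le> C * \<bar>x - y\<bar> powr b + C * \<bar>x - y\<bar> powr b"
        using 3 b \<delta> by (intro add_mono mult_left_mono powr_mono2) auto
      also have "\<dots> \<le> H * \<bar>x - y\<bar> powr b"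
        using mult_right_mono[OF H(3), of "\<bar>x - y\<bar> powr b"] by simp
      finally show ?thesis .
    qed
  qed
  show thesis
  proof (rule that[OF \<delta>(1) b(1,2) H(1)])
    fix x y assume "\<bar>x - \<alpha>\<bar> \<le> \<delta>" "\<bar>y - \<alpha>\<bar> \<le> \<delta>"
    then show "norm (v x - v y) \<le> H * \<bar>x - y\<bar> powr b"
      using main[of x y] main[of y x]
      by (cases "x \<le> y") (auto simp: norm_minus_commute abs_minus_commute)
  qed
qed

lemma continuous_v: "isCont v \<theta>"
proof (cases "cis \<theta> \<in> a ` {1..m}")
  case True
  then obtain j where j: "j \<in> {1..m}" "cis \<theta> = a j" by auto
  from v_Hoelder[OF j] obtain \<delta> H b where \<delta>: "0 < \<delta>" "0 < b" "H \<ge> 0"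
    and hoel: "\<And>x y. \<bar>x - \<theta>\<bar> \<le> \<delta> \<Longrightarrow> \<bar>y - \<theta>\<bar> \<le> \<delta> \<Longrightarrow> norm (v x - v y) \<le> H * \<bar>x - y\<bar> powr b"
    by metis
  have "((\<lambda>x. v x - v \<theta>) \<longlongrightarrow> 0) (at \<theta>)"
  proof (rule Lim_null_comparison)
    show "\<forall>\<^sub>F x in at \<theta>. norm (v x - v \<theta>) \<le> H * \<bar>x - \<theta>\<bar> powr b"
      using \<delta> hoel unfolding eventually_at by (auto simp: dist_real_def intro!: exI[of _ \<delta>])
    have "((\<lambda>x. \<bar>x - \<theta>\<bar>) \<longlongrightarrow> 0) (at \<theta>)"
      by (auto intro!: tendsto_eq_intros)
    then have "((\<lambda>x. \<bar>x - \<theta>\<bar> powr b) \<longlongrightarrow> 0) (at \<theta>)"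
      using \<delta> by (intro tendsto_zero_powrI[where b = b]) (auto intro: always_eventually)
    then show "((\<lambda>x. H * \<bar>x - \<theta>\<bar> powr b) \<longlongrightarrow> 0) (at \<theta>)"
      by (rule tendsto_mult_right_zero)
  qed
  then show ?thesis
    unfolding isCont_def by (simp add: LIM_zero_iff)
qed (rule isCont_v)

lemma bounded_v: obtains B where "\<And>\<theta>. norm (v \<theta>) \<le> B"
proof -
  have "compact (v ` {-pi..pi})"
    by (intro compact_continuous_image continuous_at_imp_continuous_on) (auto intro: continuous_v)
  then obtain B where B: "\<And>\<theta>. \<theta> \<in> {-pi..pi} \<Longrightarrow> norm (v \<theta>) \<le> B"
    using compact_imp_bounded bounded_iff by (metis imageI)
  have "norm (v \<theta>) \<le> B" for \<theta>
  proof -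
    have "cis \<theta> = cis (Arg (cis \<theta>))"
      by (simp add: cis_Arg_unit)
    then have "v \<theta> = v (Arg (cis \<theta>))" by (rule v_cong)
    then show ?thesis
      using B[of "Arg (cis \<theta>)"] Arg_bounded[of "cis \<theta>"] by auto
  qed
  then show thesis by (rule that)
qed

end

section \<open>Boundary values of the Cauchy transform\<close>

lemma has_integral_shift_interval:
  fixes g :: "real \<Rightarrow> complex"
  assumes "(g has_integral I) {l..r}"
  shows "((\<lambda>x. g (x + c)) has_integral I) {l - c..r - c}"
proof -
  have "((\<lambda>x. g (1 *\<^sub>R x + c)) has_integral (1 / \<bar>1\<bar> ^ DIM(real)) *\<^sub>R I)
      ((\<lambda>x. (1 / 1) *\<^sub>R x + - ((1 / 1) *\<^sub>R c)) ` cbox l r)"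
    using assms by (intro has_integral_affinity) auto
  moreover have "(\<lambda>x. x + - c) ` {l..r} = {l - c..r - c}"
    by (auto simp: image_iff intro!: bexI[of _ "_ + c"])
  ultimately show ?thesis by simp
qed

text \<open>
  Rotation invariance; the shifted interval of angles is cut at \<open>\<pi>\<close> and reassembled by
  periodicity.
\<close>
lemma circle_int_rotate:
  assumes h: "circle_L1 h" and u: "norm u = 1"
  shows "circle_int (\<lambda>\<zeta>. h (\<zeta> * u)) = circle_int h"
proof -
  define \<beta> where "\<beta> = Arg2pi u"
  have \<beta>: "0 \<le> \<beta>" "\<beta> \<le> 2 * pi" "cis \<beta> = u"
    using Arg2pi[of u] u by (auto simp: \<beta>_def cis_conv_exp is_Arg_def)
  define g where "g = (\<lambda>\<theta>. h (cis \<theta>))"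
  have gi: "g integrable_on {-pi..pi}"
    using h unfolding circle_L1_def g_def by (rule set_lebesgue_integral_eq_integral(1))
  have gi1: "g integrable_on {-pi..-pi + \<beta>}" and gi2: "g integrable_on {-pi + \<beta>..pi}"
    using \<beta> by (auto intro!: integrable_on_subinterval[OF gi])
  have 1: "((\<lambda>x. g (x + \<beta>)) has_integral integral {-pi + \<beta>..pi} g) {-pi..pi - \<beta>}"
    using has_integral_shift_interval[OF integrable_integral[OF gi2], of \<beta>] by simp
  have "((\<lambda>x. g (x + (\<beta> - 2 * pi))) has_integral integral {-pi..-pi + \<beta>} g) {pi - \<beta>..pi}"
    using has_integral_shift_interval[OF integrable_integral[OF gi1], of "\<beta> - 2 * pi"] by simp
  moreover have "g (x + (\<beta> - 2 * pi)) = g (x + \<beta>)" for x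
    by (simp add: g_def cis_mult[symmetric] cis_divide[symmetric])
  ultimately have 2: "((\<lambda>x. g (x + \<beta>)) has_integral integral {-pi..-pi + \<beta>} g) {pi - \<beta>..pi}"
    by simp
  have "((\<lambda>x. g (x + \<beta>)) has_integral (integral {-pi + \<beta>..pi} g + integral {-pi..-pi + \<beta>} g)) {-pi..pi}"
    by (rule has_integral_combine[OF _ _ 1 2]) (use \<beta> in auto)
  moreover have "integral {-pi + \<beta>..pi} g + integral {-pi..-pi + \<beta>} g = integral {-pi..pi} g"
    using Henstock_Kurzweil_Integration.integral_combine[OF _ _ gi, of "-pi + \<beta>"] \<beta> by (simp add: add.commute)
  ultimately have "integral {-pi..pi} (\<lambda>x. g (x + \<beta>)) = integral {-pi..pi} g"
    by (simp add: integral_unique)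
  moreover have "g (x + \<beta>) = h (cis x * u)" for x
    by (simp add: g_def cis_mult[symmetric] \<beta>)
  ultimately show ?thesis
    by (simp add: circle_int_eq g_def)
qed

text \<open>
  The integral is the winding number of the circle about \<open>x\<close>, an integer of modulus at most \<open>1\<close>.
\<close>
lemma norm_circle_int_pole_le:
  assumes "x \<notin> sphere 0 1"
  shows "norm (circle_int (\<lambda>\<zeta>. \<zeta> / (\<zeta> - x))) \<le> 1"
proof -
  let ?\<gamma> = "part_circlepath 0 1 (-pi) pi"
  have image: "path_image ?\<gamma> \<subseteq> sphere 0 1"
    by (rule path_image_part_circlepath_subset) auto
  have "circle_int (\<lambda>\<zeta>. \<zeta> / (\<zeta> - x)) = contour_integral ?\<gamma> (\<lambda>\<zeta>. 1 / (2 * pi * \<i>) * (1 / (\<zeta> - x)))"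
    unfolding circle_int_def
    by (rule contour_integral_cong[OF refl]) (use image in auto)
  also have "\<dots> = 1 / (2 * pi * \<i>) * contour_integral ?\<gamma> (\<lambda>\<zeta>. 1 / (\<zeta> - x))"
    by (rule contour_integral_lmul)
       (intro contour_integrable_continuous_part_circlepath continuous_intros; use image assms in auto)
  also have "\<dots> = winding_number ?\<gamma> x"
    by (subst winding_number_valid_path) (use image assms in auto)
  finally have eq: "circle_int (\<lambda>\<zeta>. \<zeta> / (\<zeta> - x)) = winding_number ?\<gamma> x" .
  have "simple_path ?\<gamma>"
    by (simp add: simple_path_part_circlepath)
  moreover have "pathfinish ?\<gamma> = pathstart ?\<gamma>"
    by (simp add: exp_minus exp_pi_i')
  ultimately have "winding_number ?\<gamma> x \<in> {-1, 0, 1}"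
    using image assms by (intro simple_closed_path_winding_number_cases) auto
  then show ?thesis
    unfolding eq by auto
qed

lemma norm_cis_powr_integrable:
  assumes "0 < b" "b \<le> 1"
  shows "integrable circle_measure (\<lambda>\<theta>. norm (cis \<theta> - 1) powr (b - 1))"
proof -
  have "(\<lambda>x. x powr (b - 1)) integrable_on {0..pi}"
    using assms by (intro integrable_on_powr_from_0) auto
  then have 0: "(\<lambda>x. \<bar>x\<bar> powr (b - 1)) integrable_on {0..pi}"
    by (rule integrable_eq) auto
  have "(\<lambda>x. \<bar>- x\<bar> powr (b - 1)) integrable_on {- pi..- 0}"
    using 0 by (rule Henstock_Kurzweil_Integration.integrable_reflect_real[THEN iffD2])
  then have "(\<lambda>x. \<bar>x\<bar> powr (b - 1)) integrable_on {-pi..pi}"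
    using 0 by (intro Henstock_Kurzweil_Integration.integrable_combine[of "-pi" 0 pi]) auto
  then have "(\<lambda>x. \<bar>x\<bar> powr (b - 1)) absolutely_integrable_on {-pi..pi}"
    by (intro nonnegative_absolutely_integrable_1) auto
  then have i: "integrable circle_measure (\<lambda>x. 8 powr (1 - b) * \<bar>x\<bar> powr (b - 1))"
    unfolding circle_measure_def by (simp add: set_integrable_def integrable_restrict_space)
  show ?thesis
  proof (rule Bochner_Integration.integrable_bound[OF i])
    have "(\<lambda>\<theta>. norm (cis \<theta> - 1)) \<in> borel_measurable circle_measure"
      using cis_measurable by measurable
    then show "(\<lambda>\<theta>. norm (cis \<theta> - 1) powr (b - 1)) \<in> borel_measurable circle_measure"
      by measurable
    show "AE \<theta> in circle_measure. norm (norm (cis \<theta> - 1) powr (b - 1)) \<le>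
        norm (8 powr (1 - b) * \<bar>\<theta>\<bar> powr (b - 1))"
    proof (rule AE_I2)
      fix \<theta> assume "\<theta> \<in> space circle_measure"
      then have \<theta>: "\<bar>\<theta>\<bar> \<le> pi" by (auto simp: circle_measure_def)
      show "norm (norm (cis \<theta> - 1) powr (b - 1)) \<le> norm (8 powr (1 - b) * \<bar>\<theta>\<bar> powr (b - 1))"
      proof (cases "\<theta> = 0")
        case False
        have "norm (cis \<theta> - 1) powr (b - 1) \<le> (\<bar>\<theta>\<bar> / 8) powr (b - 1)"
          using norm_cis_minus_one_ge[OF \<theta>] False assms by (intro powr_mono2') auto
        also have "\<dots> = 8 powr (1 - b) * \<bar>\<theta>\<bar> powr (b - 1)"
          by (simp add: powr_divide powr_minus_divide[of 8 "b - 1", simplified] divide_simps)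
        finally show ?thesis by simp
      qed simp
    qed
  qed
qed

context integrable_circle_weight
begin

text \<open>
  The weight as a continuous function on the circle.
\<close>
definition V :: "complex \<Rightarrow> complex" where
  "V \<zeta> = v (Arg \<zeta>)"

lemma V_cis: "V (cis \<theta>) = v \<theta>"
proof -
  have "cis (Arg (cis \<theta>)) = cis \<theta>"
    by (simp add: cis_Arg_unit)
  then show ?thesis
    unfolding V_def by (rule v_cong)
qed

text \<open>
  Measuring angles from an arbitrary \<open>\<alpha>\<close> places the discontinuity of \<open>Arg\<close> away from \<open>cis \<alpha>\<close>.
\<close>
lemma V_lift:
  assumes "norm \<zeta> = 1"
  shows "V \<zeta> = v (\<alpha> + Arg (\<zeta> / cis \<alpha>))"
proof -
  have "cis (Arg (\<zeta> / cis \<alpha>)) = \<zeta> / cis \<alpha>"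
    using assms by (intro cis_Arg_unit) (simp add: norm_divide)
  then have "\<zeta> = cis (\<alpha> + Arg (\<zeta> / cis \<alpha>))"
    by (simp add: cis_mult[symmetric])
  then show ?thesis
    using V_cis by metis
qed

lemma continuous_on_V: "continuous_on (sphere 0 1) V"
  unfolding continuous_on_eq_continuous_within
proof
  fix \<zeta>0 :: complex assume \<zeta>0: "\<zeta>0 \<in> sphere 0 1"
  define \<alpha> where "\<alpha> = Arg \<zeta>0"
  have \<alpha>: "cis \<alpha> = \<zeta>0"
    using \<zeta>0 by (simp add: \<alpha>_def cis_Arg_unit)
  have "isCont (\<lambda>\<zeta>. Arg (\<zeta> / cis \<alpha>)) \<zeta>0"
    using \<zeta>0 by (intro continuous_intros isCont_o2[OF _ continuous_at_Arg]) (auto simp: \<alpha>)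
  then have "isCont (\<lambda>\<zeta>. v (\<alpha> + Arg (\<zeta> / cis \<alpha>))) \<zeta>0"
    by (intro isCont_o2[where g = v, OF _ continuous_v] continuous_intros)
  then have "continuous (at \<zeta>0 within sphere 0 1) (\<lambda>\<zeta>. v (\<alpha> + Arg (\<zeta> / cis \<alpha>)))"
    by (rule continuous_at_imp_continuous_within)
  then show "continuous (at \<zeta>0 within sphere 0 1) V"
    by (rule continuous_transform_within[where \<delta> = 1])
       (use \<zeta>0 in \<open>auto simp: V_lift[of _ \<alpha>]\<close>)
qed

lemma V_Hoelder:
  assumes j: "j \<in> {1..m}" and aj: "norm (a j) = 1"
  obtains \<eta> H b where "0 < \<eta>" "0 < b" "b \<le> 1" "H \<ge> 0"
    "\<And>x y. norm x = 1 \<Longrightarrow> norm y = 1 \<Longrightarrow> norm (x - a j) \<le> \<eta> \<Longrightarrow> norm (y - a j) \<le> \<eta> \<Longrightarrow>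
       norm (V x - V y) \<le> H * norm (x - y) powr b"
proof -
  define \<alpha> where "\<alpha> = Arg (a j)"
  have \<alpha>: "cis \<alpha> = a j"
    using aj by (simp add: \<alpha>_def cis_Arg_unit)
  from v_Hoelder[OF j \<alpha>] obtain \<delta> H b where \<delta>: "0 < \<delta>" "0 < b" "b \<le> 1" "H \<ge> 0"
    and hoel: "\<And>x y. \<bar>x - \<alpha>\<bar> \<le> \<delta> \<Longrightarrow> \<bar>y - \<alpha>\<bar> \<le> \<delta> \<Longrightarrow> norm (v x - v y) \<le> H * \<bar>x - y\<bar> powr b"
    by metis
  define \<eta> where "\<eta> = min \<delta> 1 / 8"
  have lift: "\<exists>\<theta>. cis \<theta> = \<zeta> \<and> \<bar>\<theta> - \<alpha>\<bar> \<le> min \<delta> 1" if "norm \<zeta> = 1" "norm (\<zeta> - a j) \<le> \<eta>" for \<zeta>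
  proof -
    define s where "s = Arg (\<zeta> / a j)"
    have nz: "\<zeta> / a j \<noteq> 0" "norm (\<zeta> / a j) = 1"
      using that aj by (auto simp: norm_divide)
    then have s: "cis s = \<zeta> / a j"
      by (simp add: s_def cis_Arg_unit)
    have "\<bar>s\<bar> \<le> pi"
      using Arg_bounded[of "\<zeta> / a j"] by (auto simp: s_def)
    have cs: "cis (\<alpha> + s) = \<zeta>"
      using aj by (auto simp: cis_mult[symmetric] s \<alpha>)
    have "\<bar>s\<bar> \<le> 8 * norm (\<zeta> - a j)"
      using norm_cis_diff_ge[of "\<alpha> + s" \<alpha>] \<open>\<bar>s\<bar> \<le> pi\<close> by (simp add: cs \<alpha>)
    then have "\<bar>s\<bar> \<le> min \<delta> 1"
      using that by (simp add: \<eta>_def)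
    then show ?thesis
      using cs by (intro exI[of _ "\<alpha> + s"]) simp
  qed
  show thesis
  proof (rule that[of \<eta> b "H * 8 powr b"])
    show "0 < \<eta>" "0 \<le> H * 8 powr b" using \<delta> by (auto simp: \<eta>_def)
    fix x y assume xy: "norm x = 1" "norm y = 1" "norm (x - a j) \<le> \<eta>" "norm (y - a j) \<le> \<eta>"
    from lift[OF xy(1,3)] lift[OF xy(2,4)] obtain s t where
      st: "cis s = x" "\<bar>s - \<alpha>\<bar> \<le> min \<delta> 1" "cis t = y" "\<bar>t - \<alpha>\<bar> \<le> min \<delta> 1"
      by blast
    then have "\<bar>s - t\<bar> \<le> 8 * norm (x - y)"
      using norm_cis_diff_ge[of s t] pi_ge_two by (auto simp: abs_if split: if_splits)
    then have "\<bar>s - t\<bar> powr b \<le> (8 * norm (x - y)) powr b"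
      using \<delta> by (intro powr_mono2) auto
    then have "H * \<bar>s - t\<bar> powr b \<le> H * 8 powr b * norm (x - y) powr b"
      using \<delta> by (simp add: powr_mult mult.assoc mult_left_mono)
    moreover have "norm (V x - V y) \<le> H * \<bar>s - t\<bar> powr b"
      unfolding st(1)[symmetric] st(3)[symmetric] V_cis using st by (intro hoel) auto
    ultimately show "norm (V x - V y) \<le> H * 8 powr b * norm (x - y) powr b"
      by linarith
  qed (use \<delta> in auto)
qed

lemma V_eq_w:
  assumes "\<zeta> \<in> sphere 0 1 - insert (-1) (a ` {1..m})"
  shows "V \<zeta> = w \<zeta>"
proof -
  have "cis (Arg \<zeta>) = \<zeta>"
    using assms by (intro cis_Arg_unit) simp
  then show ?thesis
    using assms v_eq_w[of "Arg \<zeta>"] by (simp add: V_def)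
qed

text \<open>
  With \<open>u = sgn x\<close>, rotating by \<open>u\<close> turns the kernel \<open>\<zeta> / (\<zeta> - x)\<close> into \<open>\<zeta> / (\<zeta> - |x|)\<close>, so that
  for every \<open>x\<close> the near-singularity sits at \<open>\<zeta> = 1\<close>. Subtracting the value \<open>V u\<close> leaves an
  integrand bounded by a multiple of \<open>|\<zeta> - 1| powr (b - 1)\<close>, uniformly in \<open>x\<close>, to which dominated
  convergence applies. The subtracted part is \<open>V u\<close> times a bounded integral, and \<open>V u\<close> tends to
  \<open>V (a j) = 0\<close>. Approaching the circle from inside and from outside is treated alike, since only
  \<open>|x| \<noteq> 1\<close> is used.
\<close>
lemma tendsto_cauchy_transform_at_singularity:
  assumes j: "j \<in> {1..m}" and aj: "norm (a j) = 1"
  shows "((\<lambda>x. circle_int (\<lambda>\<zeta>. w \<zeta> * (\<zeta> / (\<zeta> - x)))) \<longlongrightarrow> circle_int (\<lambda>\<zeta>. w \<zeta> * (\<zeta> / (\<zeta> - a j))))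
           (at (a j) within - sphere 0 1)"
proof -
  let ?F = "at (a j) within - sphere 0 1"
  from V_Hoelder[OF j aj] obtain \<eta> H b where \<eta>: "0 < \<eta>" "0 < b" "b \<le> 1" "H \<ge> 0"
    and hoel: "\<And>x y. norm x = 1 \<Longrightarrow> norm y = 1 \<Longrightarrow> norm (x - a j) \<le> \<eta> \<Longrightarrow> norm (y - a j) \<le> \<eta> \<Longrightarrow>
       norm (V x - V y) \<le> H * norm (x - y) powr b"
    by metis
  obtain B where "\<And>\<theta>. norm (v \<theta>) \<le> B"
    using bounded_v by blast
  then have B: "norm (V \<zeta>) \<le> B" for \<zeta> by (simp add: V_def)
  have aj0: "a j \<noteq> 0" using aj by auto
  have Va: "V (a j) = 0"
  proof -
    have "cis (Arg (a j)) = a j"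
      using aj by (rule cis_Arg_unit)
    then show ?thesis
      using v_singular j by (simp add: V_def)
  qed
  define f where "f = (\<lambda>u R \<zeta>. (V (\<zeta> * u) - V u) * (\<zeta> / (\<zeta> - complex_of_real R)))"
  \<comment> \<open>The first summand bounds the integrand for \<open>|\<zeta> - 1| \<le> \<eta> / 2\<close>, where \<open>\<zeta> * u\<close> and \<open>u\<close> lie in the Hoelder neighbourhood. The second bounds it elsewhere, where \<open>|\<zeta> - R| \<ge> \<eta> / 4\<close>.\<close>
  define g where "g = (\<lambda>\<zeta>::complex. 2 * H * norm (\<zeta> - 1) powr (b - 1) + 8 * B / \<eta>)"
  have bound: "norm (f u R \<zeta>) \<le> g \<zeta>"
    if "norm u = 1" "norm (u - a j) \<le> \<eta> / 2" "R \<ge> 0" "norm \<zeta> = 1" "\<zeta> \<noteq> 1" for u R \<zeta>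
  proof -
    have nz: "norm (\<zeta> - 1) > 0" using that by simp
    have "\<bar>R - 1\<bar> \<le> norm (\<zeta> - complex_of_real R)"
      using norm_triangle_ineq3[of "complex_of_real R" \<zeta>] that by (simp add: norm_minus_commute)
    moreover have "norm (\<zeta> - 1) \<le> norm (\<zeta> - complex_of_real R) + \<bar>R - 1\<bar>"
      using norm_triangle_ineq[of "\<zeta> - complex_of_real R" "complex_of_real (R - 1)"] unfolding norm_of_real
      by simp
    ultimately have half: "norm (\<zeta> - 1) / 2 \<le> norm (\<zeta> - complex_of_real R)" by linarith
    have "norm (f u R \<zeta>) = norm (V (\<zeta> * u) - V u) / norm (\<zeta> - complex_of_real R)"
      using that by (simp add: f_def norm_mult norm_divide)
    also have "\<dots> \<le> norm (V (\<zeta> * u) - V u) / (norm (\<zeta> - 1) / 2)"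
      using half nz by (intro divide_left_mono mult_pos_pos) auto
    also have "\<dots> \<le> g \<zeta>"
    proof (cases "norm (\<zeta> - 1) \<le> \<eta> / 2")
      case True
      have "norm (\<zeta> * u - u) = norm ((\<zeta> - 1) * u)" by (simp add: algebra_simps)
      then have e: "norm (\<zeta> * u - u) = norm (\<zeta> - 1)"
        using that by (simp add: norm_mult)
      have "norm (\<zeta> * u - a j) \<le> norm (\<zeta> * u - u) + norm (u - a j)"
        using norm_triangle_ineq[of "\<zeta> * u - u" "u - a j"] by simp
      then have "norm (V (\<zeta> * u) - V u) \<le> H * norm (\<zeta> * u - u) powr b"
        using that True e \<eta> by (intro hoel) (auto simp: norm_mult)
      then have "norm (V (\<zeta> * u) - V u) / (norm (\<zeta> - 1) / 2) \<le> H * norm (\<zeta> - 1) powr b / (norm (\<zeta> - 1) / 2)"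
        unfolding e using nz by (intro divide_right_mono) auto
      also have "\<dots> = 2 * H * norm (\<zeta> - 1) powr (b - 1)"
        using nz by (simp add: powr_diff)
      also have "\<dots> \<le> g \<zeta>"
        using \<eta> order.trans[OF norm_ge_zero B] by (simp add: g_def)
      finally show ?thesis .
    next
      case False
      have "norm (V (\<zeta> * u) - V u) \<le> 2 * B"
        using norm_triangle_ineq4[of "V (\<zeta> * u)" "V u"] B[of u] B[of "\<zeta> * u"] by linarith
      then have "norm (V (\<zeta> * u) - V u) / (norm (\<zeta> - 1) / 2) \<le> 2 * B / (\<eta> / 2 / 2)"
        using False \<eta> order.trans[OF norm_ge_zero B] by (intro frac_le) auto
      also have "\<dots> \<le> g \<zeta>"
        using \<eta> by (simp add: g_def)
      finally show ?thesis .
    qed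
    finally show ?thesis .
  qed
  have gi: "integrable circle_measure (\<lambda>\<theta>. g (cis \<theta>))"
  proof -
    interpret finite_measure circle_measure
      unfolding circle_measure_def by (rule finite_measure_lebesgue_on) simp
    show ?thesis
      unfolding g_def using norm_cis_powr_integrable[OF \<eta>(2,3)]
      by (intro Bochner_Integration.integrable_add integrable_mult_right) auto
  qed
  have V_rot: "continuous_on (sphere 0 1) (\<lambda>\<zeta>. V (\<zeta> * u) - c)" if "norm u = 1" for u c
    by (intro continuous_intros continuous_on_compose2[OF continuous_on_V]) (use that in \<open>auto simp: norm_mult\<close>)
  have one_L1: "circle_L1 (\<lambda>\<zeta>. c)" for c
  proof -
    have "(\<lambda>\<theta>::real. c) absolutely_integrable_on {-pi..pi}"
      by (rule absolutely_integrable_continuous_real) (intro continuous_intros)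
    then show ?thesis by (simp add: circle_L1_def)
  qed
  have cont_L1: "circle_L1 h" if "continuous_on (sphere 0 1) h" for h
    using circle_L1_mult_continuous[OF one_L1[of 1] that] by simp
  have f_L1: "circle_L1 (f u R)" if "norm u = 1" "R \<ge> 0" "R \<noteq> 1" for u R
    unfolding f_def
    using that by (intro cont_L1 continuous_on_mult V_rot continuous_intros) auto
  have lim_L1: "circle_L1 (f (a j) 1)"
    unfolding circle_L1_iff_integrable
  proof (rule Bochner_Integration.integrable_bound[OF gi])
    have "(\<lambda>\<theta>. (V (cis \<theta> * a j) - V (a j))) \<in> borel_measurable circle_measure"
      using continuous_on_sphere_measurable[OF V_rot[OF aj]] .
    then show "(\<lambda>\<theta>. f (a j) 1 (cis \<theta>)) \<in> borel_measurable circle_measure"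
      unfolding f_def using cis_measurable by measurable
    have "AE \<theta> in circle_measure. norm (f (a j) 1 (cis \<theta>)) \<le> g (cis \<theta>)"
      by (rule AE_circle_measure_finite[of "{1}" "\<lambda>\<zeta>. norm (f (a j) 1 \<zeta>) \<le> g \<zeta>"])
         (use \<eta> in \<open>auto intro!: bound simp: aj\<close>)
    then show "AE \<theta> in circle_measure. norm (f (a j) 1 (cis \<theta>)) \<le> norm (g (cis \<theta>))"
      by eventually_elim simp
  qed
  have x_nz: "\<forall>\<^sub>F x in ?F. x \<noteq> 0"
    using aj0 tendsto_imp_eventually_ne[of "\<lambda>x. x" "a j" ?F 0] by (simp add: tendsto_ident_at)
  have sgn_lim: "(sgn \<longlongrightarrow> a j) ?F"
  proof -
    have "((\<lambda>x. sgn x) \<longlongrightarrow> sgn (a j)) ?F"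
      by (intro tendsto_sgn tendsto_ident_at aj0)
    moreover have "sgn (a j) = a j" using aj by (simp add: sgn_div_norm)
    ultimately show ?thesis by simp
  qed
  have norm_lim: "(norm \<longlongrightarrow> 1) ?F"
    using tendsto_norm[OF tendsto_ident_at[of "a j" "- sphere 0 1"]] aj by simp
  have V_lim: "((\<lambda>x. V (\<zeta> * sgn x)) \<longlongrightarrow> V (\<zeta> * a j)) ?F" if "norm \<zeta> = 1" for \<zeta>
  proof (rule continuous_on_tendsto_compose[OF continuous_on_V])
    show "((\<lambda>x. \<zeta> * sgn x) \<longlongrightarrow> \<zeta> * a j) ?F"
      by (intro tendsto_intros sgn_lim)
    show "\<zeta> * a j \<in> sphere 0 1" using that aj by (simp add: norm_mult)
    show "\<forall>\<^sub>F x in ?F. \<zeta> * sgn x \<in> sphere 0 1"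
      using x_nz by eventually_elim (use that in \<open>simp add: norm_mult norm_sgn\<close>)
  qed
  have main: "((\<lambda>x. circle_int (f (sgn x) (norm x))) \<longlongrightarrow> circle_int (f (a j) 1)) ?F"
  proof (rule tendsto_circle_int_dominated[OF _ _ gi lim_L1, where exc = "{1}"])
    have off: "\<forall>\<^sub>F x in ?F. x \<in> - sphere 0 1"
      by (simp add: eventually_at_filter)
    show "\<forall>\<^sub>F x in ?F. circle_L1 (f (sgn x) (norm x))"
      using off x_nz by eventually_elim (intro f_L1; auto simp: norm_sgn)
    have "\<forall>\<^sub>F x in ?F. dist (sgn x) (a j) < \<eta> / 2"
      using sgn_lim \<eta>(1) by (intro tendstoD) auto
    then show "\<forall>\<^sub>F x in ?F. \<exists>S. finite S \<and> (\<forall>\<zeta>\<in>sphere 0 1 - S. norm (f (sgn x) (norm x) \<zeta>) \<le> g \<zeta>)"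
      using x_nz
    proof eventually_elim
      case (elim x)
      then show ?case
        by (intro exI[of _ "{1}"]) (auto intro!: bound simp: norm_sgn dist_norm)
    qed
    fix \<zeta> :: complex assume \<zeta>: "\<zeta> \<in> sphere 0 1 - {1}"
    have "((\<lambda>x. V (1 * sgn x)) \<longlongrightarrow> V (1 * a j)) ?F"
      by (rule V_lim) simp
    then have "((\<lambda>x. (V (\<zeta> * sgn x) - V (sgn x)) * (\<zeta> / (\<zeta> - complex_of_real (norm x)))) \<longlongrightarrow>
        (V (\<zeta> * a j) - V (a j)) * (\<zeta> / (\<zeta> - complex_of_real 1))) ?F"
      using \<zeta> by (intro tendsto_intros V_lim norm_lim) auto
    then show "((\<lambda>x. f (sgn x) (norm x) \<zeta>) \<longlongrightarrow> f (a j) 1 \<zeta>) ?F"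
      by (simp only: f_def)
  qed auto
  have rot: "circle_int (\<lambda>\<zeta>. w \<zeta> * (\<zeta> / (\<zeta> - x))) =
      circle_int (\<lambda>\<zeta>. V (\<zeta> * sgn x) * (\<zeta> / (\<zeta> - complex_of_real (norm x))))"
    if x: "x \<noteq> 0" and L: "circle_L1 (\<lambda>\<zeta>. w \<zeta> * (\<zeta> / (\<zeta> - x)))" for x
  proof -
    have fin: "finite (insert (-1) (a ` {1..m}))" by simp
    have L': "circle_L1 (\<lambda>\<zeta>. V \<zeta> * (\<zeta> / (\<zeta> - x)))"
      using L by (subst circle_L1_cong_finite[OF fin, of _ "\<lambda>\<zeta>. w \<zeta> * (\<zeta> / (\<zeta> - x))"]) (auto simp: V_eq_w)
    have "circle_int (\<lambda>\<zeta>. w \<zeta> * (\<zeta> / (\<zeta> - x))) = circle_int (\<lambda>\<zeta>. V \<zeta> * (\<zeta> / (\<zeta> - x)))"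
      by (rule circle_int_cong_finite[OF fin]) (simp add: V_eq_w)
    also have "\<dots> = circle_int (\<lambda>\<zeta>. V (\<zeta> * sgn x) * (\<zeta> * sgn x / (\<zeta> * sgn x - x)))"
      using circle_int_rotate[OF L', of "sgn x"] x by (simp add: norm_sgn)
    also have "\<dots> = circle_int (\<lambda>\<zeta>. V (\<zeta> * sgn x) * (\<zeta> / (\<zeta> - complex_of_real (norm x))))"
    proof -
      have "\<zeta> * sgn x / (\<zeta> * sgn x - x) = \<zeta> / (\<zeta> - complex_of_real (norm x))" for \<zeta>
      proof -
        have "x = complex_of_real (norm x) * sgn x"
          using x by (simp add: sgn_eq)
        then have "\<zeta> * sgn x - x = (\<zeta> - complex_of_real (norm x)) * sgn x"
          by (metis left_diff_distrib)
        then show ?thesis using x by (simp add: sgn_zero_iff)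
      qed
      then show ?thesis by simp
    qed
    finally show ?thesis .
  qed
  have eq: "circle_int (f (sgn x) (norm x)) + V (sgn x) * circle_int (\<lambda>\<zeta>. \<zeta> / (\<zeta> - complex_of_real (norm x))) =
      circle_int (\<lambda>\<zeta>. w \<zeta> * (\<zeta> / (\<zeta> - x)))" if x: "x \<noteq> 0" "x \<notin> sphere 0 1" for x
  proof -
    have L: "circle_L1 (\<lambda>\<zeta>. w \<zeta> * (\<zeta> / (\<zeta> - x)))"
      using x by (intro circle_L1_w_mult continuous_intros) auto
    have L2: "circle_L1 (\<lambda>\<zeta>. V (sgn x) * (\<zeta> / (\<zeta> - complex_of_real (norm x))))"
      using x by (intro cont_L1 continuous_intros) auto
    have "circle_int (\<lambda>\<zeta>. f (sgn x) (norm x) \<zeta> + V (sgn x) * (\<zeta> / (\<zeta> - complex_of_real (norm x)))) =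
        circle_int (f (sgn x) (norm x)) + circle_int (\<lambda>\<zeta>. V (sgn x) * (\<zeta> / (\<zeta> - complex_of_real (norm x))))"
      using x by (intro circle_int_add f_L1 L2) (auto simp: norm_sgn)
    moreover have "(\<lambda>\<zeta>. f (sgn x) (norm x) \<zeta> + V (sgn x) * (\<zeta> / (\<zeta> - complex_of_real (norm x)))) =
        (\<lambda>\<zeta>. V (\<zeta> * sgn x) * (\<zeta> / (\<zeta> - complex_of_real (norm x))))"
      by (simp only: f_def left_diff_distrib diff_add_cancel)
    ultimately show ?thesis
      using rot[OF x(1) L] by (simp only: circle_int_cmult)
  qed
  have eq_lim: "circle_int (f (a j) 1) = circle_int (\<lambda>\<zeta>. w \<zeta> * (\<zeta> / (\<zeta> - a j)))"
  proof -
    have "circle_L1 (\<lambda>\<zeta>. w \<zeta> * (\<zeta> / (\<zeta> - a j)))"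
      using circle_L1_mult_continuous[OF circle_L1_pole[OF j], of "\<lambda>\<zeta>. \<zeta>"]
      by (simp add: continuous_on_id)
    from rot[OF aj0 this] show ?thesis
      using aj by (simp add: f_def Va sgn_div_norm)
  qed
  have null: "((\<lambda>x. V (sgn x) * circle_int (\<lambda>\<zeta>. \<zeta> / (\<zeta> - complex_of_real (norm x)))) \<longlongrightarrow> 0) ?F"
  proof (rule Lim_null_comparison)
    show "\<forall>\<^sub>F x in ?F. norm (V (sgn x) * circle_int (\<lambda>\<zeta>. \<zeta> / (\<zeta> - complex_of_real (norm x)))) \<le> norm (V (sgn x))"
    proof -
      have "\<forall>\<^sub>F x in ?F. x \<in> - sphere 0 1"
        by (simp add: eventually_at_filter)
      then show ?thesis
      proof eventually_elim
        case (elim x)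
        then have "norm (circle_int (\<lambda>\<zeta>. \<zeta> / (\<zeta> - complex_of_real (norm x)))) \<le> 1"
          by (intro norm_circle_int_pole_le) simp
        then show ?case
          by (simp add: norm_mult mult_left_le)
      qed
    qed
    have "((\<lambda>x. V (1 * sgn x)) \<longlongrightarrow> V (1 * a j)) ?F"
      by (rule V_lim) simp
    then show "((\<lambda>x. norm (V (sgn x))) \<longlongrightarrow> 0) ?F"
      by (simp add: Va tendsto_norm_zero)
  qed
  have "((\<lambda>x. circle_int (f (sgn x) (norm x)) + V (sgn x) * circle_int (\<lambda>\<zeta>. \<zeta> / (\<zeta> - complex_of_real (norm x)))) \<longlongrightarrow>
      circle_int (\<lambda>\<zeta>. w \<zeta> * (\<zeta> / (\<zeta> - a j)))) ?F"
    using tendsto_add[OF main null] by (simp add: eq_lim)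
  then show ?thesis
  proof (rule Lim_transform_eventually)
    have "\<forall>\<^sub>F x in ?F. x \<in> - sphere 0 1"
      by (simp add: eventually_at_filter)
    then show "\<forall>\<^sub>F x in ?F. circle_int (f (sgn x) (norm x)) + V (sgn x) * circle_int (\<lambda>\<zeta>. \<zeta> / (\<zeta> - complex_of_real (norm x))) =
        circle_int (\<lambda>\<zeta>. w \<zeta> * (\<zeta> / (\<zeta> - x)))"
      using x_nz by eventually_elim (intro eq; simp)
  qed
qed

end

section \<open>Deforming the weight\<close>

text \<open>
  Convexity makes a function of \<open>s\<close> with vanishing derivative constant, also when \<open>D\<close> is a set of
  real numbers.
\<close>
lemma deformation_set_locally_convex:
  assumes "deformation_set D" "t \<in> D"
  obtains \<eta> where "\<eta> > 0" "\<And>r. r \<le> \<eta> \<Longrightarrow> convex (D \<inter> cball t r)"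
  using assms(1) unfolding deformation_set_def
proof (elim disjE exE conjE)
  assume "open D"
  then obtain e where e: "e > 0" "cball t e \<subseteq> D"
    using assms(2) open_contains_cball by blast
  show thesis
  proof (rule that[OF e(1)])
    fix r assume "r \<le> e"
    then have "D \<inter> cball t r = cball t r"
      using e(2) subset_cball by blast
    then show "convex (D \<inter> cball t r)" by simp
  qed
next
  fix I :: "real set" assume I: "open I" "D = complex_of_real ` I"
  then obtain x where x: "x \<in> I" "t = complex_of_real x" using assms(2) by auto
  obtain e where e: "e > 0" "cball x e \<subseteq> I"
    using I(1) x(1) open_contains_cball by blast
  show thesis
  proof (rule that[OF e(1)])
    fix r assume "r \<le> e"
    then have "cball x r \<subseteq> I"
      using e(2) subset_cball by blast
    then have "D \<inter> cball t r = complex_of_real ` cball x r"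
      by (auto simp: I(2) x(2) dist_of_real)
    moreover have "convex (complex_of_real ` cball x r)"
      by (intro convex_linear_image bounded_linear.linear bounded_linear_of_real convex_cball)
    ultimately show "convex (D \<inter> cball t r)" by simp
  qed
qed

lemma has_field_derivative_imp_locally_Lipschitz:
  fixes f :: "complex \<Rightarrow> complex"
  assumes "(f has_field_derivative f') (at t within D)"
  shows "\<forall>\<^sub>F s in at t within D. norm (f s - f t) \<le> (norm f' + 1) * norm (s - t)"
proof -
  have "((\<lambda>s. (f s - f t) / (s - t)) \<longlongrightarrow> f') (at t within D)"
    using assms by (simp add: has_field_derivative_iff)
  then have "\<forall>\<^sub>F s in at t within D. dist ((f s - f t) / (s - t)) f' < 1"
    by (rule tendstoD) simp
  moreover have "\<forall>\<^sub>F s in at t within D. s \<noteq> t"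
    by (simp add: eventually_at_filter)
  ultimately show ?thesis
  proof eventually_elim
    case (elim s)
    have "norm ((f s - f t) / (s - t)) \<le> norm f' + 1"
      using elim(1) norm_triangle_ineq2[of "(f s - f t) / (s - t)" f'] by (simp add: dist_norm)
    then show ?case
      using elim(2) by (simp add: norm_divide pos_divide_le_eq)
  qed
qed

lemma norm_exp_minus_one_le: "norm (exp z - 1) \<le> exp (norm z) * norm z" for z :: complex
  using Taylor_exp_field[of z 0] by simp

text \<open>
  The time \<open>t\<close> at which derivatives are taken is fixed.
\<close>
locale weight_deformation =
  fixes D :: "complex set" and m :: nat and z dz :: "nat \<Rightarrow> complex \<Rightarrow> complex"
    and \<rho> :: "nat \<Rightarrow> complex" and w :: "complex \<Rightarrow> complex \<Rightarrow> complex" and t :: complex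
  assumes D: "deformation_set D" and t: "t \<in> D"
    and z_deriv: "\<And>j s. j \<in> {1..m} \<Longrightarrow> s \<in> D \<Longrightarrow> (z j has_field_derivative dz j s) (at s within D)"
    and weight: "\<And>s. s \<in> D \<Longrightarrow> integrable_circle_weight m (\<lambda>j. z j s) \<rho> (w s)"
    and w_t_deriv: "\<And>s \<zeta>. s \<in> D \<Longrightarrow> \<zeta> \<in> sphere 0 1 \<Longrightarrow> \<zeta> \<notin> insert (-1) ((\<lambda>j. z j s) ` {1..m}) \<Longrightarrow>
          ((\<lambda>u. w u \<zeta>) has_field_derivative
             - (\<Sum>j=1..m. \<rho> j * dz j s / (\<zeta> - z j s)) * w s \<zeta>) (at s within D)"
begin

abbreviation singularities :: "complex \<Rightarrow> complex set" where
  "singularities s \<equiv> insert (-1) ((\<lambda>j. z j s) ` {1..m})"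

lemma finite_singularities: "finite (singularities s)"
  by simp

lemma Lipschitz_neighbourhood:
  obtains L \<eta> where "L > 0" "\<eta> > 0" "\<And>r. r < \<eta> \<Longrightarrow> convex (D \<inter> cball t r)"
    "\<And>j s. j \<in> {1..m} \<Longrightarrow> s \<in> D \<Longrightarrow> norm (s - t) < \<eta> \<Longrightarrow> norm (z j s - z j t) \<le> L * norm (s - t)"
proof -
  define L where "L = (\<Sum>j=1..m. norm (dz j t) + 1) + 1"
  have L: "L > 0" "\<And>j. j \<in> {1..m} \<Longrightarrow> norm (dz j t) + 1 \<le> L"
  proof -
    show "L > 0" unfolding L_def by (intro add_nonneg_pos sum_nonneg) auto
    fix j assume "j \<in> {1..m}"
    then have "norm (dz j t) + 1 \<le> (\<Sum>j=1..m. norm (dz j t) + 1)"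
      by (intro member_le_sum[of j _ "\<lambda>j. norm (dz j t) + 1"]) auto
    then show "norm (dz j t) + 1 \<le> L" by (simp add: L_def)
  qed
  have "\<forall>\<^sub>F s in at t within D. \<forall>j\<in>{1..m}. norm (z j s - z j t) \<le> (norm (dz j t) + 1) * norm (s - t)"
    using z_deriv t by (intro eventually_ball_finite ballI has_field_derivative_imp_locally_Lipschitz) auto
  then obtain e where e: "e > 0" "\<And>s j. s \<in> D \<Longrightarrow> s \<noteq> t \<Longrightarrow> dist s t < e \<Longrightarrow> j \<in> {1..m} \<Longrightarrow>
      norm (z j s - z j t) \<le> (norm (dz j t) + 1) * norm (s - t)"
    unfolding eventually_at by blast
  obtain \<eta> where \<eta>: "\<eta> > 0" "\<And>r. r \<le> \<eta> \<Longrightarrow> convex (D \<inter> cball t r)"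
    using deformation_set_locally_convex[OF D t] by blast
  show thesis
  proof (rule that[OF L(1), of "min e \<eta>"])
    fix j s assume *: "j \<in> {1..m}" "s \<in> D" "norm (s - t) < min e \<eta>"
    show "norm (z j s - z j t) \<le> L * norm (s - t)"
    proof (cases "s = t")
      case False
      have "norm (z j s - z j t) \<le> (norm (dz j t) + 1) * norm (s - t)"
        using e(2)[of s j] * False by (simp add: dist_norm)
      also have "\<dots> \<le> L * norm (s - t)"
        using L(2)[OF *(1)] by (rule mult_right_mono) simp
      finally show ?thesis .
    qed simp
  qed (use e \<eta> in auto)
qed

text \<open>
  Bounds \<open>|w\<^sub>s| / |w\<^sub>t|\<close> at points whose distance from the singularities is large compared with
  their displacement.
\<close>
definition growth :: real where
  "growth = exp (\<Sum>j=1..m. norm (\<rho> j))"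

lemma growth_ge: "growth \<ge> 1"
  unfolding growth_def by (simp add: sum_nonneg)

text \<open>
  For fixed \<open>\<zeta>\<close> the quotient of \<open>w s \<zeta>\<close> by \<open>\<Prod>\<^sub>j ((\<zeta> - z j s) / (\<zeta> - z j t)) powr \<rho> j\<close> has
  vanishing derivative in \<open>s\<close>. The factor \<open>4\<close> in the distance assumption keeps each ratio within
  \<open>1 / 4\<close> of \<open>1\<close>, hence away from the branch cut, and the increment is then estimated by the
  Taylor expansions of \<open>Ln\<close> and \<open>exp\<close>.
\<close>
lemma weight_ratio_far:
  assumes s: "s \<in> D" and conv: "convex (D \<inter> cball t (norm (s - t)))"
    and Lip: "\<And>j s'. j \<in> {1..m} \<Longrightarrow> s' \<in> D \<inter> cball t (norm (s - t)) \<Longrightarrow>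
            norm (z j s' - z j t) \<le> L * norm (s' - t)"
    and L: "L > 0" and \<zeta>: "norm \<zeta> = 1" "\<zeta> \<noteq> -1"
    and far: "\<And>j. j \<in> {1..m} \<Longrightarrow> 4 * L * norm (s - t) \<le> norm (\<zeta> - z j t) \<and> \<zeta> \<noteq> z j t"
  shows "norm (w s \<zeta>) \<le> growth * norm (w t \<zeta>)"
    and "norm (w s \<zeta> - w t \<zeta>) \<le> growth * (\<Sum>j=1..m. norm (\<rho> j)) * 2 * L * norm (s - t) *
           (norm (w t \<zeta>) * (\<Sum>j=1..m. 1 / norm (\<zeta> - z j t)))"
proof -
  let ?S = "D \<inter> cball t (norm (s - t))"
  define u where "u = (\<lambda>j s'. (z j t - z j s') / (\<zeta> - z j t))"
  have u_small: "norm (u j s') \<le> 1 / 4" "norm (u j s') \<le> L * norm (s - t) * (1 / norm (\<zeta> - z j t))"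
    if "j \<in> {1..m}" "s' \<in> ?S" for j s'
  proof -
    have pos: "0 < norm (\<zeta> - z j t)" using far[OF that(1)] by simp
    have "norm (z j t - z j s') \<le> L * norm (s' - t)"
      using Lip[OF that] by (simp add: norm_minus_commute)
    also have "\<dots> \<le> L * norm (s - t)"
      using that(2) L by (intro mult_left_mono) (auto simp: dist_norm norm_minus_commute)
    finally have n: "norm (z j t - z j s') \<le> L * norm (s - t)" .
    then show "norm (u j s') \<le> L * norm (s - t) * (1 / norm (\<zeta> - z j t))"
      using pos by (simp add: u_def norm_divide divide_right_mono)
    have "4 * norm (z j t - z j s') \<le> norm (\<zeta> - z j t)"
      using n far[OF that(1)] by linarith
    then show "norm (u j s') \<le> 1 / 4"
      using pos by (simp add: u_def norm_divide divide_le_eq)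
  qed
  have one_plus: "1 + u j s' = (\<zeta> - z j s') / (\<zeta> - z j t)" if "j \<in> {1..m}" for j s'
    using far[OF that] by (simp add: u_def field_simps)
  have slit: "(\<zeta> - z j s') / (\<zeta> - z j t) \<notin> \<real>\<^sub>\<le>\<^sub>0" if "j \<in> {1..m}" "s' \<in> ?S" for j s'
  proof -
    have "Re (1 + u j s') > 0"
      using u_small(1)[OF that] abs_Re_le_cmod[of "u j s'"] by simp
    then show ?thesis
      unfolding one_plus[OF that(1)] by (auto simp: complex_nonpos_Reals_iff)
  qed
  \<comment> \<open>As functions of \<open>s'\<close>, \<open>w s' \<zeta>\<close> and \<open>exp (\<Lambda> s')\<close> have the same logarithmic derivative on the convex set \<open>?S\<close>.\<close>
  define \<Lambda> where "\<Lambda> = (\<lambda>s'. \<Sum>j=1..m. \<rho> j * Ln ((\<zeta> - z j s') / (\<zeta> - z j t)))"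
  have "\<exists>c. \<forall>s'\<in>?S. w s' \<zeta> * exp (- \<Lambda> s') = c"
  proof (rule has_field_derivative_zero_constant[OF conv])
    fix s' assume s': "s' \<in> ?S"
    have neq: "\<zeta> - z j s' \<noteq> 0" if "j \<in> {1..m}" for j
      using slit[OF that s'] by auto
    have dL: "((\<lambda>s'. Ln ((\<zeta> - z j s') / (\<zeta> - z j t))) has_field_derivative - dz j s' / (\<zeta> - z j s')) (at s' within ?S)"
      if j: "j \<in> {1..m}" for j
    proof -
      have "(z j has_field_derivative dz j s') (at s' within ?S)"
        using z_deriv[OF j, of s'] s' by (auto intro: DERIV_subset)
      then have "((\<lambda>s'. (\<zeta> - z j s') / (\<zeta> - z j t)) has_field_derivative - dz j s' / (\<zeta> - z j t)) (at s' within ?S)"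
        using far[OF j] by (auto intro!: derivative_eq_intros)
      then have "((\<lambda>s'. Ln ((\<zeta> - z j s') / (\<zeta> - z j t))) has_field_derivative
          inverse ((\<zeta> - z j s') / (\<zeta> - z j t)) * (- dz j s' / (\<zeta> - z j t))) (at s' within ?S)"
        by (rule DERIV_chain2[where f = Ln and g = "\<lambda>s'. (\<zeta> - z j s') / (\<zeta> - z j t)" and x = s', OF has_field_derivative_Ln[OF slit[OF j s']]])
      moreover have "inverse ((\<zeta> - z j s') / (\<zeta> - z j t)) * (- dz j s' / (\<zeta> - z j t)) = - dz j s' / (\<zeta> - z j s')"
        using far[OF j] by simp
      ultimately show ?thesis by simp
    qed
    have d\<Lambda>: "(\<Lambda> has_field_derivative - (\<Sum>j=1..m. \<rho> j * dz j s' / (\<zeta> - z j s'))) (at s' within ?S)"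
    proof -
      have "(\<Lambda> has_field_derivative (\<Sum>j=1..m. \<rho> j * (- dz j s' / (\<zeta> - z j s')))) (at s' within ?S)"
        unfolding \<Lambda>_def by (intro DERIV_sum DERIV_cmult dL)
      then show ?thesis by (simp add: sum_negf)
    qed
    have "((\<lambda>u. w u \<zeta>) has_field_derivative
        - (\<Sum>j=1..m. \<rho> j * dz j s' / (\<zeta> - z j s')) * w s' \<zeta>) (at s' within ?S)"
    proof (rule DERIV_subset[OF w_t_deriv])
      show "\<zeta> \<notin> singularities s'"
      proof
        assume "\<zeta> \<in> singularities s'"
        then obtain j where j: "j \<in> {1..m}" "\<zeta> = z j s'" using \<zeta>(2) by auto
        then show False using neq[OF j(1)] by simp
      qed
    qed (use s' \<zeta> in auto)
    then show "((\<lambda>s'. w s' \<zeta> * exp (- \<Lambda> s')) has_field_derivative 0) (at s' within ?S)"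
      by (auto intro!: derivative_eq_intros d\<Lambda> simp: algebra_simps)
  qed
  then have "w s \<zeta> * exp (- \<Lambda> s) = w t \<zeta> * exp (- \<Lambda> t)"
    using s t by (auto simp: dist_norm norm_minus_commute)
  moreover have "\<Lambda> t = 0"
    unfolding \<Lambda>_def using far by (intro sum.neutral) auto
  ultimately have w_eq: "w s \<zeta> = w t \<zeta> * exp (\<Lambda> s)"
    by (simp add: exp_minus field_simps)
  have sS: "s \<in> ?S" using s by (simp add: dist_norm norm_minus_commute)
  have "norm (\<Lambda> s) \<le> (\<Sum>j=1..m. norm (\<rho> j) * (2 * norm (u j s)))"
    unfolding \<Lambda>_def
  proof (intro order.trans[OF norm_sum] sum_mono)
    fix j assume j: "j \<in> {1..m}"
    have "norm (Ln (1 + u j s)) \<le> 2 * norm (u j s)"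
      using u_small(1)[OF j sS] by (intro norm_Ln_le) simp
    then show "norm (\<rho> j * Ln ((\<zeta> - z j s) / (\<zeta> - z j t))) \<le> norm (\<rho> j) * (2 * norm (u j s))"
      unfolding one_plus[OF j] norm_mult by (rule mult_left_mono) simp
  qed
  note \<Lambda>_bound = this
  have "norm (\<Lambda> s) \<le> (\<Sum>j=1..m. norm (\<rho> j) * 1)"
  proof (rule order.trans[OF \<Lambda>_bound], intro sum_mono mult_left_mono)
    fix j assume "j \<in> {1..m}"
    then show "2 * norm (u j s) \<le> 1" using u_small(1)[of j s] sS by simp
  qed simp
  then have \<Lambda>1: "exp (norm (\<Lambda> s)) \<le> growth"
    by (simp add: growth_def)
  have "norm (exp (\<Lambda> s)) \<le> growth"
    by (rule order.trans[OF norm_exp \<Lambda>1])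
  then have "norm (exp (\<Lambda> s)) * norm (w t \<zeta>) \<le> growth * norm (w t \<zeta>)"
    by (rule mult_right_mono) simp
  then show "norm (w s \<zeta>) \<le> growth * norm (w t \<zeta>)"
    unfolding w_eq norm_mult by (simp only: mult.commute)
  have "norm (\<Lambda> s) \<le> (\<Sum>j=1..m. (\<Sum>i=1..m. norm (\<rho> i)) * (2 * (L * norm (s - t) * (1 / norm (\<zeta> - z j t)))))"
  proof (rule order.trans[OF \<Lambda>_bound], rule sum_mono, rule mult_mono)
    fix j assume j: "j \<in> {1..m}"
    then show "norm (\<rho> j) \<le> (\<Sum>i=1..m. norm (\<rho> i))"
      by (intro member_le_sum) auto
    show "2 * norm (u j s) \<le> 2 * (L * norm (s - t) * (1 / norm (\<zeta> - z j t)))"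
      using u_small(2)[OF j sS] by simp
  qed (auto simp: sum_nonneg)
  also have "\<dots> = (\<Sum>j=1..m. norm (\<rho> j)) * 2 * L * norm (s - t) * (\<Sum>j=1..m. 1 / norm (\<zeta> - z j t))"
  proof -
    have "(\<Sum>j\<in>A. P * (2 * (c * f j))) = P * 2 * c * (\<Sum>j\<in>A. f j)"
      for P c :: real and f :: "nat \<Rightarrow> real" and A
      by (simp add: sum_distrib_left sum_distrib_right mult_ac)
    from this[of "\<Sum>i=1..m. norm (\<rho> i)" "L * norm (s - t)" "\<lambda>j. 1 / norm (\<zeta> - z j t)" "{1..m}"]
    show ?thesis by (simp only: mult.assoc)
  qed
  finally have \<Lambda>2: "norm (\<Lambda> s) \<le> (\<Sum>j=1..m. norm (\<rho> j)) * 2 * L * norm (s - t) * (\<Sum>j=1..m. 1 / norm (\<zeta> - z j t))" .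
  have "norm (w s \<zeta> - w t \<zeta>) = norm (w t \<zeta>) * norm (exp (\<Lambda> s) - 1)"
    unfolding w_eq norm_mult[symmetric] by (simp add: algebra_simps)
  also have "\<dots> \<le> norm (w t \<zeta>) * (exp (norm (\<Lambda> s)) * norm (\<Lambda> s))"
    by (intro mult_left_mono norm_exp_minus_one_le) simp
  also have "\<dots> \<le> norm (w t \<zeta>) * (growth * ((\<Sum>j=1..m. norm (\<rho> j)) * 2 * L * norm (s - t) * (\<Sum>j=1..m. 1 / norm (\<zeta> - z j t))))"
    using growth_ge by (intro mult_left_mono mult_mono \<Lambda>1 \<Lambda>2) auto
  finally show "norm (w s \<zeta> - w t \<zeta>) \<le> growth * (\<Sum>j=1..m. norm (\<rho> j)) * 2 * L * norm (s - t) *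
           (norm (w t \<zeta>) * (\<Sum>j=1..m. 1 / norm (\<zeta> - z j t)))"
    by (simp add: mult_ac)
qed

text \<open>
  If \<open>z j t\<close> is off the circle, nothing on the circle is that close. Otherwise, set
  \<open>h = L * |s - t|\<close>. Neither the position of \<open>z j s\<close> relative to the circle nor the connection
  between \<open>w s\<close> on its two sides is controlled, so \<open>w s \<zeta>\<close> is not related to \<open>w t \<zeta>\<close>. Instead each
  is shown to be of order \<open>h powr r\<close>, \<open>r = Re (\<rho> j)\<close>. For \<open>w t\<close> this is the local bound at the
  singularity. For \<open>w s\<close>, the point \<open>\<zeta>\<close> is joined by an arc to one of the two points at angle
  \<open>32 * h\<close> from \<open>z j t\<close>, chosen so that the arc avoids \<open>z j s\<close>; at the end point \<open>w s\<close> is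
  dominated by \<open>w t\<close>, and \<open>norm_v_compare\<close> carries the bound back along the arc. Finally
  \<open>h powr r\<close> is at most a multiple of \<open>h * (1 + |w t \<zeta>| / |\<zeta> - z j t|)\<close> because
  \<open>|\<zeta> - z j t| < 4 * h\<close> and \<open>|w t \<zeta>|\<close> is comparable to \<open>|\<zeta> - z j t| powr r\<close>.
\<close>
lemma increment_bound_near_singularity:
  assumes L: "L > 0" and \<eta>: "\<eta> > 0" and conv: "\<And>r. r < \<eta> \<Longrightarrow> convex (D \<inter> cball t r)"
    and Lip: "\<And>j s. j \<in> {1..m} \<Longrightarrow> s \<in> D \<Longrightarrow> norm (s - t) < \<eta> \<Longrightarrow>
            norm (z j s - z j t) \<le> L * norm (s - t)"
    and j: "j \<in> {1..m}"
  obtains C e where "e > 0" "C \<ge> 0"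
    "\<And>s \<zeta>. s \<in> D \<Longrightarrow> s \<noteq> t \<Longrightarrow> norm (s - t) < e \<Longrightarrow> norm \<zeta> = 1 \<Longrightarrow>
        \<zeta> \<notin> singularities s \<Longrightarrow> \<zeta> \<notin> singularities t \<Longrightarrow> norm (\<zeta> - z j t) < 4 * L * norm (s - t) \<Longrightarrow>
        norm (w s \<zeta> - w t \<zeta>) \<le> C * norm (s - t) * (1 + norm (w t \<zeta>) * (1 / norm (\<zeta> - z j t)))"
proof (cases "norm (z j t) = 1")
  case False
  define h where "h = \<bar>norm (z j t) - 1\<bar>"
  have h: "h > 0" using False by (simp add: h_def)
  show thesis
  proof (rule that[of "h / (4 * L)" 0])
    show "h / (4 * L) > 0" using h L by simp
    fix s \<zeta> :: complex assume "norm (s - t) < h / (4 * L)" "norm \<zeta> = 1" "norm (\<zeta> - z j t) < 4 * L * norm (s - t)"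
    moreover have "h \<le> norm (\<zeta> - z j t)"
      unfolding h_def using norm_triangle_ineq3[of "z j t" \<zeta>] \<open>norm \<zeta> = 1\<close> by (simp add: norm_minus_commute)
    ultimately have False using L by (simp add: field_simps)
    then show "norm (w s \<zeta> - w t \<zeta>) \<le> 0 * norm (s - t) * (1 + norm (w t \<zeta>) * (1 / norm (\<zeta> - z j t)))" ..
  qed simp
next
  case True
  interpret T: integrable_circle_weight m "\<lambda>j. z j t" \<rho> "w t"
    by (rule weight[OF t])
  define \<alpha> where "\<alpha> = Arg (z j t)"
  have \<alpha>: "cis \<alpha> = z j t"
    unfolding \<alpha>_def by (rule cis_Arg_unit[OF True])
  define r where "r = Re (\<rho> j)"
  have r: "r > 0"
    unfolding r_def by (rule T.Re_exponent_pos[OF j True])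
  from T.v_local_bounds[OF j \<alpha>] obtain \<delta> C where \<delta>: "0 < \<delta>" "\<delta> \<le> 1" "C > 0"
    and sing: "\<And>\<theta>. 0 < \<bar>\<theta> - \<alpha>\<bar> \<Longrightarrow> \<bar>\<theta> - \<alpha>\<bar> \<le> \<delta> \<Longrightarrow> cis \<theta> \<notin> singularities t"
    and upper: "\<And>\<theta>. 0 < \<bar>\<theta> - \<alpha>\<bar> \<Longrightarrow> \<bar>\<theta> - \<alpha>\<bar> \<le> \<delta> \<Longrightarrow>
           norm (T.v \<theta>) \<le> C * norm (cis \<theta> - z j t) powr r"
    and lower: "\<And>\<theta>. 0 < \<bar>\<theta> - \<alpha>\<bar> \<Longrightarrow> \<bar>\<theta> - \<alpha>\<bar> \<le> \<delta> \<Longrightarrow>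
           norm (cis \<theta> - z j t) powr r \<le> C * norm (T.v \<theta>)"
    unfolding r_def by metis
  obtain d where d: "0 < d" "d \<le> 1" "\<And>k. k \<in> {1..m} \<Longrightarrow> k \<noteq> j \<Longrightarrow> 4 * d \<le> norm (z j t - z k t)"
    using T.singularity_separated[OF j] by metis
  define B where "B = 2 + (\<Sum>k=1..m. norm (z k t))"
  have dB: "d \<le> B"
    using d(2) by (simp add: B_def sum_nonneg add_increasing2)
  define R where "R = \<bar>\<alpha>\<bar> + 1"
  define K where "K = T.comparison_const d B R"
  have K: "K > 0" unfolding K_def by (rule T.comparison_const_pos)
  define e where "e = min \<eta> (min \<delta> d / (32 * L))"
  have e: "e > 0"
    using \<eta> \<delta> d L by (simp add: e_def)
  define C1 where "C1 = K * 2 powr r * growth * C + C"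
  have C1: "C1 \<ge> 0"
    using K growth_ge \<delta> by (simp add: C1_def)
  show thesis
  proof (rule that[OF e, of "C1 * (32 * L) * (1 + C)"])
    show "C1 * (32 * L) * (1 + C) \<ge> 0"
      using C1 L \<delta> by simp
    fix s \<zeta> :: complex
    assume s: "s \<in> D" "s \<noteq> t" "norm (s - t) < e" and \<zeta>: "norm \<zeta> = 1"
      "\<zeta> \<notin> singularities s" "\<zeta> \<notin> singularities t" "norm (\<zeta> - z j t) < 4 * L * norm (s - t)"
    interpret S: integrable_circle_weight m "\<lambda>j. z j s" \<rho> "w s"
      by (rule weight[OF s(1)])
    define h where "h = L * norm (s - t)"
    \<comment> \<open>The factor \<open>32 = 4 * 8\<close>: a chord below \<open>4 * h\<close> spans an angle below \<open>32 * h\<close>, and an angle of \<open>32 * h\<close> spans a chord of at least \<open>4 * h\<close>, where \<open>weight_ratio_far\<close> applies.\<close>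
    define u where "u = 32 * h"
    have h: "h > 0" using s L by (simp add: h_def)
    have u: "u > 0" "u \<le> \<delta>" "u \<le> d"
    proof -
      have "norm (s - t) < min \<delta> d / (32 * L)"
        using s by (simp add: e_def)
      then have "u < min \<delta> d"
        using L by (simp add: u_def h_def field_simps)
      then show "u \<le> \<delta>" "u \<le> d" by auto
      show "u > 0" using h by (simp add: u_def)
    qed
    have s\<eta>: "norm (s - t) < \<eta>" using s by (simp add: e_def)
    have zs: "norm (z k s - z k t) \<le> h" if "k \<in> {1..m}" for k
      unfolding h_def by (rule Lip[OF that s(1) s\<eta>])
    define \<theta> where "\<theta> = \<alpha> + Arg (\<zeta> / z j t)"
    have zj0: "z j t \<noteq> 0" using True by auto
    have cis\<theta>: "cis \<theta> = \<zeta>"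
      unfolding \<theta>_def using \<zeta>(1) True zj0
      by (simp add: cis_mult[symmetric] \<alpha> cis_Arg_unit norm_divide)
    have "\<bar>\<theta> - \<alpha>\<bar> \<le> pi"
      using Arg_bounded[of "\<zeta> / z j t"] unfolding \<theta>_def by linarith
    then have \<theta>_le: "\<bar>\<theta> - \<alpha>\<bar> \<le> 8 * norm (\<zeta> - z j t)"
      using norm_cis_diff_ge[of \<theta> \<alpha>] by (simp add: cis\<theta> \<alpha>)
    then have \<theta>_less: "\<bar>\<theta> - \<alpha>\<bar> < u"
      using \<zeta>(4) by (simp add: u_def h_def)
    have \<theta>_pos: "0 < \<bar>\<theta> - \<alpha>\<bar>"
      using cis\<theta> \<alpha> \<zeta>(3) j by auto
    have near: "norm (cis \<theta>' - z j t) \<le> u" if "\<bar>\<theta>' - \<alpha>\<bar> \<le> u" for \<theta>'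
      using norm_cis_diff_le[of \<theta>' \<alpha>] that by (simp add: \<alpha>)
    have far_t: "3 * d \<le> norm (cis \<theta>' - z k t)" if "\<bar>\<theta>' - \<alpha>\<bar> \<le> u" "k \<in> {1..m}" "k \<noteq> j" for \<theta>' k
    proof -
      have "4 * d \<le> norm (cis \<theta>' - z k t) + norm (cis \<theta>' - z j t)"
        using d(3)[OF that(2,3)] norm_triangle_ineq4[of "cis \<theta>' - z k t" "cis \<theta>' - z j t"] by simp
      then show ?thesis using near[OF that(1)] u(3) by linarith
    qed
    have far_s: "d \<le> norm (cis \<theta>' - z k s) \<and> norm (cis \<theta>' - z k s) \<le> B"
      if "\<bar>\<theta>' - \<alpha>\<bar> \<le> u" "k \<in> {1..m}" "k \<noteq> j" for \<theta>' k
    proof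
      have "3 * d \<le> norm (cis \<theta>' - z k s) + norm (z k s - z k t)"
        using far_t[OF that] norm_triangle_ineq[of "cis \<theta>' - z k s" "z k s - z k t"] by simp
      then show "d \<le> norm (cis \<theta>' - z k s)"
        using zs[OF that(2)] u(3) h d(1) by (simp add: u_def)
      have "norm (cis \<theta>' - z k s) \<le> norm (cis \<theta>' - z k t) + norm (z k s - z k t)"
        using norm_triangle_ineq4[of "cis \<theta>' - z k t" "z k s - z k t"] by simp
      also have "norm (cis \<theta>' - z k t) \<le> 1 + norm (z k t)"
        using norm_triangle_ineq4[of "cis \<theta>'" "z k t"] by simp
      also have "norm (z k t) \<le> (\<Sum>k=1..m. norm (z k t))"
        using that by (intro member_le_sum) auto
      also have "norm (z k s - z k t) \<le> 1"
        using zs[OF that(2)] u(3) d(2) h by (simp add: u_def)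
      finally show "norm (cis \<theta>' - z k s) \<le> B" by (simp add: B_def)
    qed
    have seg: "\<bar>\<theta>' - \<alpha>\<bar> \<le> u" if "\<theta>' \<in> closed_segment \<theta>0 \<theta>" "\<bar>\<theta>0 - \<alpha>\<bar> \<le> u" for \<theta>0 \<theta>'
      using that \<theta>_less by (auto simp: closed_segment_eq_real_ivl split: if_splits)
    \<comment> \<open>At most one angle \<open>\<xi>\<close> of the range lies over \<open>z j s\<close>; the end point is taken on the side of \<open>\<theta>\<close> away from \<open>\<xi>\<close>.\<close>
    obtain \<theta>0 where \<theta>0: "\<bar>\<theta>0 - \<alpha>\<bar> = u" "\<And>\<theta>'. \<theta>' \<in> closed_segment \<theta>0 \<theta> \<Longrightarrow> cis \<theta>' \<noteq> z j s"
    proof (cases "\<exists>\<xi>. \<bar>\<xi> - \<alpha>\<bar> \<le> u \<and> cis \<xi> = z j s")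
      case False
      have *: "\<bar>(\<alpha> + u) - \<alpha>\<bar> = u" using u by simp
      show thesis
        by (rule that[OF *]) (use False seg[of _ "\<alpha> + u"] * in auto)
    next
      case True
      then obtain \<xi> where \<xi>: "\<bar>\<xi> - \<alpha>\<bar> \<le> u" "cis \<xi> = z j s" by blast
      have "\<xi> \<noteq> \<theta>" using \<xi>(2) cis\<theta> \<zeta>(2) j by auto
      have uniq: "\<theta>' = \<xi>" if "\<bar>\<theta>' - \<alpha>\<bar> \<le> u" "cis \<theta>' = z j s" for \<theta>'
      proof -
        have "\<bar>\<theta>' - \<xi>\<bar> \<le> pi"
          using that(1) \<xi>(1) u(2) \<delta>(2) pi_ge_two by linarith
        then show ?thesis
          using norm_cis_diff_ge[of \<theta>' \<xi>] that(2) \<xi>(2) by simp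
      qed
      show thesis
      proof (cases "\<xi> < \<theta>")
        case True
        have *: "\<bar>(\<alpha> + u) - \<alpha>\<bar> = u" using u by simp
        have "\<theta> \<le> \<alpha> + u" using \<theta>_less by linarith
        then show thesis
          using True uniq seg[of _ "\<alpha> + u"] *
          by (intro that[OF *]) (fastforce simp: closed_segment_eq_real_ivl split: if_splits)
      next
        case False
        have *: "\<bar>(\<alpha> - u) - \<alpha>\<bar> = u" using u by simp
        have "\<alpha> - u \<le> \<theta>" using \<theta>_less by linarith
        then show thesis
          using False \<open>\<xi> \<noteq> \<theta>\<close> uniq seg[of _ "\<alpha> - u"] *
          by (intro that[OF *]) (fastforce simp: closed_segment_eq_real_ivl split: if_splits)
      qed
    qed
    have \<theta>0': "0 < \<bar>\<theta>0 - \<alpha>\<bar>" "\<bar>\<theta>0 - \<alpha>\<bar> \<le> \<delta>" "\<bar>\<theta>0 - \<alpha>\<bar> \<le> u"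
      using \<theta>0(1) u by auto
    have arc: "cis \<theta>' \<notin> (\<lambda>j. z j s) ` {1..m}" if "\<theta>' \<in> closed_segment \<theta>0 \<theta>" for \<theta>'
    proof
      assume "cis \<theta>' \<in> (\<lambda>j. z j s) ` {1..m}"
      then obtain k where k: "k \<in> {1..m}" "cis \<theta>' = z k s" by auto
      then have "k \<noteq> j" using \<theta>0(2)[OF that] by auto
      then show False
        using far_s[OF seg[OF that \<theta>0'(3)] k(1)] k(2) d(1) by simp
    qed
    have chord0: "4 * h \<le> norm (cis \<theta>0 - z j t)" "norm (cis \<theta>0 - z j t) \<le> u"
    proof -
      have "\<bar>\<theta>0 - \<alpha>\<bar> \<le> 8 * norm (cis \<theta>0 - cis \<alpha>)"
        using \<theta>0'(2) \<delta>(2) pi_ge_two by (intro norm_cis_diff_ge) linarith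
      then show "4 * h \<le> norm (cis \<theta>0 - z j t)"
        using \<theta>0(1) by (simp add: \<alpha> u_def)
      show "norm (cis \<theta>0 - z j t) \<le> u"
        by (rule near[OF \<theta>0'(3)])
    qed
    have ratio: "norm (cis \<theta> - z j s) / norm (cis \<theta>0 - z j s) \<le> 2"
    proof -
      have "norm (cis \<theta> - z j s) \<le> norm (\<zeta> - z j t) + norm (z j s - z j t)"
        using norm_triangle_ineq4[of "\<zeta> - z j t" "z j s - z j t"] by (simp add: cis\<theta>)
      then have 1: "norm (cis \<theta> - z j s) \<le> 5 * h"
        using \<zeta>(4) zs[OF j] by (simp add: h_def)
      have "norm (cis \<theta>0 - z j t) \<le> norm (cis \<theta>0 - z j s) + norm (z j s - z j t)"
        using norm_triangle_ineq[of "cis \<theta>0 - z j s" "z j s - z j t"] by simp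
      then have 2: "3 * h \<le> norm (cis \<theta>0 - z j s)"
        using chord0 zs[OF j] by linarith
      have "norm (cis \<theta> - z j s) / norm (cis \<theta>0 - z j s) \<le> 5 * h / (3 * h)"
        using 1 2 h by (intro frac_le) auto
      also have "5 * h / (3 * h) \<le> 2" using h by simp
      finally show ?thesis .
    qed
    have compare: "norm (S.v \<theta>) \<le> K * (norm (cis \<theta> - z j s) / norm (cis \<theta>0 - z j s)) powr r * norm (S.v \<theta>0)"
      unfolding K_def r_def
    proof (rule S.norm_v_compare[OF arc])
      show "\<bar>\<theta>\<bar> \<le> R" "\<bar>\<theta>0\<bar> \<le> R"
        using \<theta>_less \<theta>0' u(2) \<delta>(2) by (auto simp: R_def)
      fix k assume k: "k \<in> {1..m}" "k \<noteq> j"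
      show "d \<le> norm (cis \<theta> - z k s) \<and> norm (cis \<theta> - z k s) \<le> B \<and>
          d \<le> norm (cis \<theta>0 - z k s) \<and> norm (cis \<theta>0 - z k s) \<le> B"
        using far_s[OF less_imp_le[OF \<theta>_less] k] far_s[OF \<theta>0'(3) k] by blast
    qed (use j d dB in auto)
    have v\<theta>: "S.v \<theta> = w s \<zeta>" "T.v \<theta> = w t \<zeta>"
      using S.v_eq_w[of \<theta>] T.v_eq_w[of \<theta>] \<zeta>(2,3) by (simp_all only: cis\<theta> not_False_eq_True)
    have sing0: "cis \<theta>0 \<notin> singularities t"
      by (rule sing[OF \<theta>0'(1,2)])
    then have v\<theta>0: "S.v \<theta>0 = w s (cis \<theta>0)" "T.v \<theta>0 = w t (cis \<theta>0)"
      using arc[OF ends_in_segment(1)] S.v_eq_w[of \<theta>0] T.v_eq_w[of \<theta>0] by auto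
    have w0: "norm (w s (cis \<theta>0)) \<le> growth * norm (w t (cis \<theta>0))"
    proof (rule weight_ratio_far(1)[OF s(1) conv[OF s\<eta>] _ L])
      show "norm (z k s' - z k t) \<le> L * norm (s' - t)"
        if "k \<in> {1..m}" "s' \<in> D \<inter> cball t (norm (s - t))" for k s'
        using that s\<eta> by (intro Lip) (auto simp: dist_norm norm_minus_commute)
      show "4 * L * norm (s - t) \<le> norm (cis \<theta>0 - z k t) \<and> cis \<theta>0 \<noteq> z k t" if k: "k \<in> {1..m}" for k
      proof -
        have "4 * h \<le> norm (cis \<theta>0 - z k t)"
        proof (cases "k = j")
          case True
          then show ?thesis using chord0 by simp
        next
          case False
          then show ?thesis
            using far_t[OF \<theta>0'(3) k] u(3) d(1) h by (simp add: u_def)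
        qed
        then show ?thesis using sing0 k by (auto simp: h_def)
      qed
    qed (use sing0 in auto)
    have ws: "norm (w s \<zeta>) \<le> K * 2 powr r * (growth * (C * u powr r))"
    proof -
      have "norm (w t (cis \<theta>0)) \<le> C * norm (cis \<theta>0 - z j t) powr r"
        using upper[OF \<theta>0'(1,2)] by (simp add: v\<theta>0)
      also have "\<dots> \<le> C * u powr r"
        using chord0(2) r \<delta> by (intro mult_left_mono powr_mono2) auto
      finally have "growth * norm (w t (cis \<theta>0)) \<le> growth * (C * u powr r)"
        using growth_ge by (intro mult_left_mono) auto
      then have "norm (w s (cis \<theta>0)) \<le> growth * (C * u powr r)"
        using w0 by linarith
      then have "K * (norm (cis \<theta> - z j s) / norm (cis \<theta>0 - z j s)) powr r * norm (w s (cis \<theta>0)) \<le>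
          K * 2 powr r * (growth * (C * u powr r))"
        using K ratio r by (intro mult_mono mult_left_mono powr_mono2) auto
      then show ?thesis
        using compare by (simp only: v\<theta> v\<theta>0)
    qed
    have x: "norm (\<zeta> - z j t) > 0" "norm (\<zeta> - z j t) \<le> u"
      using \<zeta>(3) j near[OF less_imp_le[OF \<theta>_less]] by (auto simp: cis\<theta>)
    have \<theta>\<delta>: "\<bar>\<theta> - \<alpha>\<bar> \<le> \<delta>" using \<theta>_less u(2) by simp
    have wt: "norm (w t \<zeta>) \<le> C * u powr r"
    proof -
      have "norm (w t \<zeta>) \<le> C * norm (\<zeta> - z j t) powr r"
        using upper[OF \<theta>_pos \<theta>\<delta>] by (simp only: v\<theta> cis\<theta>)
      also have "\<dots> \<le> C * u powr r"
        using x r \<delta> by (intro mult_left_mono powr_mono2) auto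
      finally show ?thesis .
    qed
    have "norm (w s \<zeta> - w t \<zeta>) \<le> C1 * u powr r"
      using norm_triangle_ineq4[of "w s \<zeta>" "w t \<zeta>"] ws wt by (simp add: C1_def algebra_simps)
    \<comment> \<open>For \<open>r < 1\<close> the power \<open>u powr (r - 1)\<close> is decreasing in \<open>u\<close>, and \<open>|\<zeta> - z j t| \<le> u\<close>.\<close>
    also have "u powr r \<le> u * ((1 + C) * (1 + norm (w t \<zeta>) * (1 / norm (\<zeta> - z j t))))"
    proof (cases "r \<ge> 1")
      case True
      have "u powr r \<le> u powr 1"
        using True u \<delta> by (intro powr_mono') auto
      also have "\<dots> = u * (1 * 1)" using u by simp
      also have "\<dots> \<le> u * ((1 + C) * (1 + norm (w t \<zeta>) * (1 / norm (\<zeta> - z j t))))"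
        using u \<delta> by (intro mult_left_mono mult_mono) auto
      finally show ?thesis .
    next
      case False
      have "u powr r = u * u powr (r - 1)"
        using u by (simp add: powr_diff)
      also have "\<dots> \<le> u * norm (\<zeta> - z j t) powr (r - 1)"
      proof (rule mult_left_mono[OF _ less_imp_le[OF u(1)]])
        show "u powr (r - 1) \<le> norm (\<zeta> - z j t) powr (r - 1)"
          using x False by (intro powr_mono2') auto
      qed
      also have "norm (\<zeta> - z j t) powr (r - 1) = norm (\<zeta> - z j t) powr r * (1 / norm (\<zeta> - z j t))"
        using x by (simp add: powr_diff)
      also have "u * \<dots> \<le> u * (C * norm (w t \<zeta>) * (1 / norm (\<zeta> - z j t)))"
        using lower[OF \<theta>_pos \<theta>\<delta>] u unfolding v\<theta> cis\<theta> by (intro mult_left_mono mult_right_mono) auto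
      also have "\<dots> \<le> u * ((1 + C) * (1 + norm (w t \<zeta>) * (1 / norm (\<zeta> - z j t))))"
      proof (rule mult_left_mono)
        have "C * (norm (w t \<zeta>) * (1 / norm (\<zeta> - z j t))) \<le> (1 + C) * (1 + norm (w t \<zeta>) * (1 / norm (\<zeta> - z j t)))"
          using \<delta> by (intro mult_mono) auto
        then show "C * norm (w t \<zeta>) * (1 / norm (\<zeta> - z j t)) \<le> (1 + C) * (1 + norm (w t \<zeta>) * (1 / norm (\<zeta> - z j t)))"
          by (simp only: mult.assoc)
      qed (use u in simp)
      finally show ?thesis .
    qed
    finally have "norm (w s \<zeta> - w t \<zeta>) \<le> C1 * (u * ((1 + C) * (1 + norm (w t \<zeta>) * (1 / norm (\<zeta> - z j t)))))"
      using C1 by (simp add: mult_left_mono)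
    then show "norm (w s \<zeta> - w t \<zeta>) \<le>
        C1 * (32 * L) * (1 + C) * norm (s - t) * (1 + norm (w t \<zeta>) * (1 / norm (\<zeta> - z j t)))"
      by (simp only: u_def h_def mult_ac)
  qed
qed

lemma increment_bound:
  obtains C where "\<forall>\<^sub>F s in at t within D. \<forall>\<zeta>. norm \<zeta> = 1 \<longrightarrow> \<zeta> \<notin> singularities s \<union> singularities t \<longrightarrow>
      norm (w s \<zeta> - w t \<zeta>) \<le> norm (s - t) * (C * (1 + norm (w t \<zeta>) * (\<Sum>j=1..m. 1 / norm (\<zeta> - z j t))))"
proof -
  obtain L \<eta> where L: "L > 0" and \<eta>: "\<eta> > 0" and conv: "\<And>r. r < \<eta> \<Longrightarrow> convex (D \<inter> cball t r)"
    and Lip: "\<And>j s. j \<in> {1..m} \<Longrightarrow> s \<in> D \<Longrightarrow> norm (s - t) < \<eta> \<Longrightarrow> norm (z j s - z j t) \<le> L * norm (s - t)"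
    using Lipschitz_neighbourhood by metis
  have "\<forall>j\<in>{1..m}. \<exists>C e. e > 0 \<and> C \<ge> 0 \<and>
    (\<forall>s \<zeta>. s \<in> D \<longrightarrow> s \<noteq> t \<longrightarrow> norm (s - t) < e \<longrightarrow> norm \<zeta> = 1 \<longrightarrow>
        \<zeta> \<notin> singularities s \<longrightarrow> \<zeta> \<notin> singularities t \<longrightarrow> norm (\<zeta> - z j t) < 4 * L * norm (s - t) \<longrightarrow>
        norm (w s \<zeta> - w t \<zeta>) \<le> C * norm (s - t) * (1 + norm (w t \<zeta>) * (1 / norm (\<zeta> - z j t))))"
    by (intro ballI, rule increment_bound_near_singularity[OF L \<eta> conv Lip]) (assumption+, metis)
  then obtain C e where Ce: "\<And>j. j \<in> {1..m} \<Longrightarrow> e j > 0" "\<And>j. j \<in> {1..m} \<Longrightarrow> C j \<ge> 0"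
    and near: "\<And>j s \<zeta>. j \<in> {1..m} \<Longrightarrow> s \<in> D \<Longrightarrow> s \<noteq> t \<Longrightarrow> norm (s - t) < e j \<Longrightarrow> norm \<zeta> = 1 \<Longrightarrow>
        \<zeta> \<notin> singularities s \<Longrightarrow> \<zeta> \<notin> singularities t \<Longrightarrow> norm (\<zeta> - z j t) < 4 * L * norm (s - t) \<Longrightarrow>
        norm (w s \<zeta> - w t \<zeta>) \<le> C j * norm (s - t) * (1 + norm (w t \<zeta>) * (1 / norm (\<zeta> - z j t)))"
    unfolding bchoice_iff by metis
  define A where "A = growth * (\<Sum>j=1..m. norm (\<rho> j)) * 2 * L"
  have A: "A \<ge> 0"
    using growth_ge L by (simp add: A_def sum_nonneg)
  define K where "K = A + (\<Sum>j=1..m. C j)"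
  have CK: "C j \<le> K" if "j \<in> {1..m}" for j
  proof -
    have "C j \<le> (\<Sum>j=1..m. C j)"
      using that Ce(2) by (intro member_le_sum) auto
    then show ?thesis using A by (simp add: K_def)
  qed
  have AK: "A \<le> K"
    unfolding K_def using sum_nonneg[of "{1..m}" C] Ce(2) by simp
  have "\<forall>\<^sub>F s in at t within D. s \<in> D \<and> s \<noteq> t"
    by (simp add: eventually_at_filter)
  moreover have "\<forall>\<^sub>F s in at t within D. norm (s - t) < \<eta>"
    using \<eta> by (auto simp: eventually_at dist_norm)
  moreover have "\<forall>\<^sub>F s in at t within D. \<forall>j\<in>{1..m}. norm (s - t) < e j"
    using Ce(1) by (intro eventually_ball_finite ballI) (auto simp: eventually_at dist_norm)
  ultimately have "\<forall>\<^sub>F s in at t within D. \<forall>\<zeta>. norm \<zeta> = 1 \<longrightarrow> \<zeta> \<notin> singularities s \<union> singularities t \<longrightarrow>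
      norm (w s \<zeta> - w t \<zeta>) \<le> norm (s - t) * (K * (1 + norm (w t \<zeta>) * (\<Sum>j=1..m. 1 / norm (\<zeta> - z j t))))"
  proof (eventually_elim, intro allI impI)
    fix s \<zeta> assume s: "s \<in> D \<and> s \<noteq> t" "norm (s - t) < \<eta>" "\<forall>j\<in>{1..m}. norm (s - t) < e j"
      and \<zeta>: "norm \<zeta> = 1" "\<zeta> \<notin> singularities s \<union> singularities t"
    let ?P = "norm (w t \<zeta>) * (\<Sum>j=1..m. 1 / norm (\<zeta> - z j t))"
    have P: "?P \<ge> 0" by (simp add: sum_nonneg)
    show "norm (w s \<zeta> - w t \<zeta>) \<le> norm (s - t) * (K * (1 + ?P))"
    proof (cases "\<exists>j\<in>{1..m}. norm (\<zeta> - z j t) < 4 * L * norm (s - t)")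
      case True
      then obtain j where j: "j \<in> {1..m}" "norm (\<zeta> - z j t) < 4 * L * norm (s - t)" by blast
      have "norm (w s \<zeta> - w t \<zeta>) \<le> C j * norm (s - t) * (1 + norm (w t \<zeta>) * (1 / norm (\<zeta> - z j t)))"
        using s \<zeta> j by (intro near) auto
      also have "\<dots> \<le> K * norm (s - t) * (1 + ?P)"
      proof (intro mult_mono add_left_mono mult_left_mono)
        show "1 / norm (\<zeta> - z j t) \<le> (\<Sum>j=1..m. 1 / norm (\<zeta> - z j t))"
          using j by (intro member_le_sum[of j _ "\<lambda>j. 1 / norm (\<zeta> - z j t)"]) auto
      qed (use CK[OF j(1)] Ce(2)[OF j(1)] A AK in auto)
      finally show ?thesis by (simp add: mult_ac)
    next
      case False
      have "norm (w s \<zeta> - w t \<zeta>) \<le> A * norm (s - t) * ?P"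
        unfolding A_def
      proof (rule weight_ratio_far(2)[OF _ conv[OF s(2)] _ L])
        show "norm (z k s' - z k t) \<le> L * norm (s' - t)"
          if "k \<in> {1..m}" "s' \<in> D \<inter> cball t (norm (s - t))" for k s'
          using that s by (intro Lip) (auto simp: dist_norm norm_minus_commute)
        show "4 * L * norm (s - t) \<le> norm (\<zeta> - z k t) \<and> \<zeta> \<noteq> z k t" if "k \<in> {1..m}" for k
          using that False \<zeta>(2) by (auto simp: not_less)
      qed (use s \<zeta> in auto)
      also have "\<dots> \<le> K * norm (s - t) * (1 + ?P)"
        using A AK P by (intro mult_mono) auto
      finally show ?thesis by (simp add: mult_ac)
    qed
  qed
  then show thesis by (rule that)
qed

text \<open>
  Differentiation under the integral sign. The difference quotients of the weight converge
  pointwise off the singularities and are dominated by means of \<open>increment_bound\<close>; the majorant is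
  integrable because \<open>w t / (\<zeta> - z j t)\<close> is.
\<close>
lemma circle_int_weight_has_field_derivative:
  assumes f: "continuous_on (sphere 0 1) f"
  shows "((\<lambda>s. circle_int (\<lambda>\<zeta>. w s \<zeta> * f \<zeta>)) has_field_derivative
      (- (\<Sum>j=1..m. \<rho> j * dz j t * circle_int (\<lambda>\<zeta>. w t \<zeta> * (f \<zeta> / (\<zeta> - z j t)))))) (at t within D)"
proof -
  interpret T: integrable_circle_weight m "\<lambda>j. z j t" \<rho> "w t"
    by (rule weight[OF t])
  obtain C where C: "\<forall>\<^sub>F s in at t within D. \<forall>\<zeta>. norm \<zeta> = 1 \<longrightarrow> \<zeta> \<notin> singularities s \<union> singularities t \<longrightarrow>
      norm (w s \<zeta> - w t \<zeta>) \<le> norm (s - t) * (C * (1 + norm (w t \<zeta>) * (\<Sum>j=1..m. 1 / norm (\<zeta> - z j t))))"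
    by (rule increment_bound)
  have "compact (f ` sphere 0 1)"
    by (intro compact_continuous_image f compact_sphere)
  then obtain B where B: "\<And>\<zeta>. \<zeta> \<in> sphere 0 1 \<Longrightarrow> norm (f \<zeta>) \<le> B"
    using bounded_iff compact_imp_bounded by (metis imageI)
  define g where "g = (\<lambda>\<zeta>. C * (1 + norm (w t \<zeta>) * (\<Sum>j=1..m. 1 / norm (\<zeta> - z j t))) * \<bar>B\<bar>)"
  have sL1: "circle_L1 (\<lambda>\<zeta>. w s \<zeta> * f \<zeta>)" if "s \<in> D" for s
  proof -
    interpret S: integrable_circle_weight m "\<lambda>j. z j s" \<rho> "w s"
      by (rule weight[OF that])
    show ?thesis by (rule S.circle_L1_w_mult[OF f])
  qed
  have pole_L1: "circle_L1 (\<lambda>\<zeta>. w t \<zeta> * (f \<zeta> / (\<zeta> - z j t)))" if "j \<in> {1..m}" for j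
    using circle_L1_mult_continuous[OF T.circle_L1_pole[OF that] f] by simp
  have gi: "integrable circle_measure (\<lambda>\<theta>. g (cis \<theta>))"
  proof -
    interpret finite_measure circle_measure
      unfolding circle_measure_def by (rule finite_measure_lebesgue_on) simp
    have "integrable circle_measure (\<lambda>\<theta>. norm (w t (cis \<theta>) / (cis \<theta> - z j t)))" if "j \<in> {1..m}" for j
      using T.circle_L1_pole[OF that] unfolding circle_L1_iff_integrable by (rule integrable_norm)
    then have "integrable circle_measure (\<lambda>\<theta>. C * (1 + (\<Sum>j=1..m. norm (w t (cis \<theta>) / (cis \<theta> - z j t)))) * \<bar>B\<bar>)"
      by (intro integrable_mult_left integrable_mult_right Bochner_Integration.integrable_add
          Bochner_Integration.integrable_sum) auto
    then show ?thesis
      by (simp add: g_def sum_distrib_left norm_divide)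
  qed
  define l where "l = (\<lambda>\<zeta>. (- 1) * (\<Sum>j=1..m. \<rho> j * dz j t * (w t \<zeta> * (f \<zeta> / (\<zeta> - z j t)))))"
  have l_L1: "circle_L1 l"
    unfolding l_def by (intro circle_L1_cmult circle_L1_sum pole_L1)
  have lim: "((\<lambda>s. circle_int (\<lambda>\<zeta>. 1 / (s - t) * (w s \<zeta> * f \<zeta> - w t \<zeta> * f \<zeta>))) \<longlongrightarrow> circle_int l) (at t within D)"
  proof (rule tendsto_circle_int_dominated[OF _ _ gi l_L1 finite_singularities[of t]])
    have ev: "\<forall>\<^sub>F s in at t within D. s \<in> D \<and> s \<noteq> t"
      by (simp add: eventually_at_filter)
    then show "\<forall>\<^sub>F s in at t within D. circle_L1 (\<lambda>\<zeta>. 1 / (s - t) * (w s \<zeta> * f \<zeta> - w t \<zeta> * f \<zeta>))"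
      by eventually_elim (intro circle_L1_cmult circle_L1_diff sL1 t; simp)
    show "\<forall>\<^sub>F s in at t within D. \<exists>S. finite S \<and>
        (\<forall>\<zeta>\<in>sphere 0 1 - S. norm (1 / (s - t) * (w s \<zeta> * f \<zeta> - w t \<zeta> * f \<zeta>)) \<le> g \<zeta>)"
      using C ev
    proof eventually_elim
      case (elim s)
      show ?case
      proof (intro exI conjI ballI)
        show "finite (singularities s \<union> singularities t)" by simp
        fix \<zeta> assume \<zeta>: "\<zeta> \<in> sphere 0 1 - (singularities s \<union> singularities t)"
        have "norm (1 / (s - t) * (w s \<zeta> * f \<zeta> - w t \<zeta> * f \<zeta>)) = norm (w s \<zeta> - w t \<zeta>) / norm (s - t) * norm (f \<zeta>)"
          by (simp add: left_diff_distrib[symmetric] norm_mult norm_divide)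
        also have "\<dots> \<le> C * (1 + norm (w t \<zeta>) * (\<Sum>j=1..m. 1 / norm (\<zeta> - z j t))) * \<bar>B\<bar>"
        proof (rule mult_mono)
          show le: "norm (w s \<zeta> - w t \<zeta>) / norm (s - t) \<le> C * (1 + norm (w t \<zeta>) * (\<Sum>j=1..m. 1 / norm (\<zeta> - z j t)))"
            using elim \<zeta> by (simp add: divide_le_eq mult.commute)
          show "norm (f \<zeta>) \<le> \<bar>B\<bar>"
            using B[of \<zeta>] \<zeta> by simp
          show "0 \<le> C * (1 + norm (w t \<zeta>) * (\<Sum>j=1..m. 1 / norm (\<zeta> - z j t)))"
            by (rule order.trans[OF _ le]) simp
        qed simp
        finally show "norm (1 / (s - t) * (w s \<zeta> * f \<zeta> - w t \<zeta> * f \<zeta>)) \<le> g \<zeta>"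
          by (simp only: g_def)
      qed
    qed
    fix \<zeta> assume \<zeta>: "\<zeta> \<in> sphere 0 1 - singularities t"
    have "((\<lambda>u. w u \<zeta>) has_field_derivative - (\<Sum>j=1..m. \<rho> j * dz j t / (\<zeta> - z j t)) * w t \<zeta>) (at t within D)"
      using \<zeta> t by (intro w_t_deriv) auto
    then have "((\<lambda>s. (w s \<zeta> - w t \<zeta>) / (s - t) * f \<zeta>) \<longlongrightarrow>
        - (\<Sum>j=1..m. \<rho> j * dz j t / (\<zeta> - z j t)) * w t \<zeta> * f \<zeta>) (at t within D)"
      unfolding has_field_derivative_iff by (intro tendsto_mult tendsto_const)
    moreover have "- (\<Sum>j=1..m. \<rho> j * dz j t / (\<zeta> - z j t)) * w t \<zeta> * f \<zeta> = l \<zeta>"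
      by (simp add: l_def sum_distrib_left sum_distrib_right mult_ac sum_negf)
    moreover have "(w s \<zeta> - w t \<zeta>) / (s - t) * f \<zeta> = 1 / (s - t) * (w s \<zeta> * f \<zeta> - w t \<zeta> * f \<zeta>)" for s
      by (simp add: left_diff_distrib[symmetric])
    ultimately show "((\<lambda>s. 1 / (s - t) * (w s \<zeta> * f \<zeta> - w t \<zeta> * f \<zeta>)) \<longlongrightarrow> l \<zeta>) (at t within D)"
      by (simp only:)
  qed
  have "circle_int l = - (\<Sum>j=1..m. \<rho> j * dz j t * circle_int (\<lambda>\<zeta>. w t \<zeta> * (f \<zeta> / (\<zeta> - z j t))))"
  proof -
    have "circle_int (\<lambda>\<zeta>. \<Sum>j=1..m. \<rho> j * dz j t * (w t \<zeta> * (f \<zeta> / (\<zeta> - z j t)))) =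
        (\<Sum>j=1..m. circle_int (\<lambda>\<zeta>. \<rho> j * dz j t * (w t \<zeta> * (f \<zeta> / (\<zeta> - z j t)))))"
      by (intro circle_int_sum circle_L1_cmult pole_L1) simp_all
    then show ?thesis
      unfolding l_def by (subst circle_int_cmult) (simp only: circle_int_cmult mult_minus1)
  qed
  moreover have "\<forall>\<^sub>F s in at t within D. circle_int (\<lambda>\<zeta>. 1 / (s - t) * (w s \<zeta> * f \<zeta> - w t \<zeta> * f \<zeta>)) =
      (circle_int (\<lambda>\<zeta>. w s \<zeta> * f \<zeta>) - circle_int (\<lambda>\<zeta>. w t \<zeta> * f \<zeta>)) / (s - t)"
  proof -
    have "\<forall>\<^sub>F s in at t within D. s \<in> D"
      by (simp add: eventually_at_filter)
    then show ?thesis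
      by eventually_elim (simp only: circle_int_cmult circle_int_diff sL1 t, simp)
  qed
  ultimately show ?thesis
    unfolding has_field_derivative_iff using Lim_transform_eventually[OF lim] by simp
qed

end

section \<open>Associated functions as Cauchy transforms\<close>

context biorthonormal_weight
begin

text \<open>
  The closed form is a quotient of two expressions antisymmetric in \<open>x\<close> and \<open>z\<close>.
\<close>
lemma kernel_commute: "kernel n z x = kernel n x z"
proof (cases "x = z")
  case False
  have "(x - z) * kernel n x z = - ((z - x) * kernel n x z)"
    by (simp add: algebra_simps)
  also have "\<dots> = (x - z) * kernel n z x"
    unfolding christoffel_darboux by simp
  finally show ?thesis using False by simp
qed simp

text \<open>
  The Cauchy transform, at \<open>x\<close>, of \<open>w\<close> times the kernel with parameter \<open>z\<close>.
\<close>
definition cauchy_kernel :: "nat \<Rightarrow> complex \<Rightarrow> complex \<Rightarrow> complex" where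
  "cauchy_kernel n z x = (x * poly (ps n) z * cauchy (p n) x - z * poly (p n) z * cauchy (ps n) x - z ^ n) / (x - z)"

lemma cauchy_add:
  "pole_integrable x \<Longrightarrow> cauchy (f + g) x = cauchy f x + cauchy g x"
  unfolding cauchy_def poly_add add_divide_distrib by (intro pairing_add paired_poly_pole)

text \<open>
  Partial fractions reduce the two poles at \<open>x\<close> and \<open>z\<close> to Cauchy transforms of the
  Christoffel-Darboux numerator \<open>N\<close>; the one at \<open>z\<close> is \<open>z ^ n\<close> by the Casoratian identity.
\<close>
lemma pairing_kernel_pole:
  assumes x: "pole_integrable x" and z: "pole_integrable z" and xz: "x \<noteq> z" and n: "n \<ge> 1"
  shows "pairing (\<lambda>\<zeta>. kernel n z \<zeta> / (\<zeta> - x)) = cauchy_kernel n z x"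
proof -
  define N where "N = Polynomial.smult (poly (ps n) z) (pCons 0 (p n)) + Polynomial.smult (- z * poly (p n) z) (ps n)"
  have CN: "cauchy N y = y * poly (ps n) z * cauchy (p n) y - z * poly (p n) z * cauchy (ps n) y"
    if "pole_integrable y" for y
    unfolding N_def cauchy_add[OF that] cauchy_smult cauchy_pCons[OF that]
    using n by (simp add: pairing_p_zero)
  have CNz: "cauchy N z = z ^ n"
    using casoratian[OF z n] by (simp add: CN[OF z] right_diff_distrib mult_ac)
  have "pairing (\<lambda>\<zeta>. kernel n z \<zeta> / (\<zeta> - x)) = pairing (\<lambda>\<zeta>. poly N \<zeta> / ((\<zeta> - x) * (\<zeta> - z)))"
  proof (rule pairing_cong[of "{z}"])
    fix \<zeta> assume \<zeta>: "\<zeta> \<notin> {z}"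
    have "poly N \<zeta> = (\<zeta> - z) * kernel n z \<zeta>"
      unfolding christoffel_darboux by (simp add: N_def)
    then show "kernel n z \<zeta> / (\<zeta> - x) = poly N \<zeta> / ((\<zeta> - x) * (\<zeta> - z))"
      using \<zeta> by simp
  qed simp
  also have "\<dots> = (cauchy N x - cauchy N z) / (x - z)"
    by (rule pole_integrable_two(2)[OF x z xz])
  finally show ?thesis
    by (simp add: CN[OF x] CNz cauchy_kernel_def)
qed

lemma sum_cauchy_p:
  assumes "pole_integrable x" "pole_integrable z" "x \<noteq> z" "n \<ge> 1"
  shows "(\<Sum>k\<le>n. poly (rev_poly n (q k)) z * cauchy (p k) x) = cauchy_kernel n z x"
proof -
  have "pairing (\<lambda>\<zeta>. kernel n z \<zeta> / (\<zeta> - x)) =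
      pairing (\<lambda>\<zeta>. \<Sum>k\<le>n. poly (rev_poly n (q k)) z * (poly (p k) \<zeta> / (\<zeta> - x)))"
    by (rule pairing_cong[of "{}"]) (simp_all add: kernel_def sum_divide_distrib)
  also have "\<dots> = (\<Sum>k\<le>n. poly (rev_poly n (q k)) z * cauchy (p k) x)"
    unfolding cauchy_def using assms(1) by (intro pairing_lincomb_sum paired_poly_pole) simp_all
  finally show ?thesis
    using pairing_kernel_pole[OF assms] by simp
qed

lemma sum_cauchy_rev_q:
  assumes "pole_integrable x" "pole_integrable z" "x \<noteq> z" "n \<ge> 1"
  shows "(\<Sum>k\<le>n. poly (p k) z * cauchy (rev_poly n (q k)) x) = cauchy_kernel n z x"
proof -
  have "pairing (\<lambda>\<zeta>. kernel n z \<zeta> / (\<zeta> - x)) =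
      pairing (\<lambda>\<zeta>. \<Sum>k\<le>n. poly (p k) z * (poly (rev_poly n (q k)) \<zeta> / (\<zeta> - x)))"
    by (rule pairing_cong[of "{}"])
       (simp, subst kernel_commute, simp add: kernel_def sum_divide_distrib mult_ac)
  also have "\<dots> = (\<Sum>k\<le>n. poly (p k) z * cauchy (rev_poly n (q k)) x)"
    unfolding cauchy_def using assms(1) by (intro pairing_lincomb_sum paired_poly_pole) simp_all
  finally show ?thesis
    using pairing_kernel_pole[OF assms] by simp
qed

end

text \<open>
  Limiting values at a point of the circle are limits along a nontrivial filter, hence unique.
\<close>
lemma circle_point_islimpt_complement:
  assumes "norm a = 1"
  shows "(a::complex) islimpt - sphere 0 1"
  unfolding islimpt_approachable
proof (intro allI impI)
  fix e :: real assume "e > 0"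
  let ?x = "complex_of_real (1 + e / 2) * a"
  have n: "norm ?x = 1 + e / 2"
    unfolding norm_mult norm_of_real using assms \<open>e > 0\<close> by simp
  have "dist ?x a = norm (complex_of_real (e / 2) * a)"
    by (simp add: dist_norm algebra_simps)
  also have "\<dots> = e / 2"
    unfolding norm_mult norm_of_real using assms \<open>e > 0\<close> by simp
  finally have "dist ?x a < e" using \<open>e > 0\<close> by simp
  moreover have "?x \<in> - sphere 0 1" "?x \<noteq> a"
    using n assms \<open>e > 0\<close> by auto
  ultimately show "\<exists>x'\<in>- sphere 0 1. x' \<noteq> a \<and> dist x' a < e" by blast
qed

locale biorthonormal_circle_weight =
  cw: integrable_circle_weight m a \<rho> w + biorthonormal_weight w \<kappa> p q
  for m a \<rho> w \<kappa> p q
begin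

lemma pole_integrable_singularity: "j \<in> {1..m} \<Longrightarrow> pole_integrable (a j)"
  using cw.circle_L1_pole by (simp add: pole_integrable_def paired_def)

text \<open>
  The recursion \<open>cauchy_pCons\<close> reduces a polynomial factor to the constant \<open>1\<close>.
\<close>
lemma tendsto_cauchy_at_singularity:
  assumes j: "j \<in> {1..m}" and aj: "norm (a j) = 1"
  shows "((\<lambda>x. cauchy f x) \<longlongrightarrow> cauchy f (a j)) (at (a j) within - sphere 0 1)"
proof -
  let ?F = "at (a j) within - sphere 0 1"
  have off: "\<forall>\<^sub>F x in ?F. x \<in> - sphere 0 1"
    by (simp add: eventually_at_filter)
  have aj0: "a j \<noteq> 0" using aj by auto
  have x_nz: "\<forall>\<^sub>F x in ?F. x \<noteq> 0"
    using aj0 tendsto_imp_eventually_ne[of "\<lambda>x. x" "a j" ?F 0] by (simp add: tendsto_ident_at)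
  have int: "circle_int (\<lambda>\<zeta>. w \<zeta> * (\<zeta> / (\<zeta> - x))) = pairing (poly 1) + x * cauchy 1 x"
    if "pole_integrable x" for x
    using cauchy_pCons[OF that, of 0 1] by (simp add: cauchy_def pairing_def)
  note int_a = int[OF pole_integrable_singularity[OF j]]
  have "((\<lambda>x. (circle_int (\<lambda>\<zeta>. w \<zeta> * (\<zeta> / (\<zeta> - x))) - pairing (poly 1)) / x) \<longlongrightarrow>
      (circle_int (\<lambda>\<zeta>. w \<zeta> * (\<zeta> / (\<zeta> - a j))) - pairing (poly 1)) / a j) ?F"
    using aj0
    by (intro tendsto_divide tendsto_diff cw.tendsto_cauchy_transform_at_singularity[OF j aj]
        tendsto_const tendsto_ident_at)
  then have "((\<lambda>x. (circle_int (\<lambda>\<zeta>. w \<zeta> * (\<zeta> / (\<zeta> - x))) - pairing (poly 1)) / x) \<longlongrightarrow> cauchy 1 (a j)) ?F"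
    unfolding int_a using aj0 by simp
  then have one: "((\<lambda>x. cauchy 1 x) \<longlongrightarrow> cauchy 1 (a j)) ?F"
  proof (rule Lim_transform_eventually)
    show "\<forall>\<^sub>F x in ?F. (circle_int (\<lambda>\<zeta>. w \<zeta> * (\<zeta> / (\<zeta> - x))) - pairing (poly 1)) / x = cauchy 1 x"
      using off x_nz
    proof eventually_elim
      case (elim x)
      then show ?case
        using int[of x] by (simp add: pole_integrable_off_circle)
    qed
  qed
  show ?thesis
  proof (induction f)
    case 0
    have "cauchy 0 x = 0" for x by (simp add: cauchy_def pairing_def circle_int_eq)
    then show ?case by simp
  next
    case (pCons c f)
    have "((\<lambda>x. c * cauchy 1 x + pairing (poly f) + x * cauchy f x) \<longlongrightarrow>
        c * cauchy 1 (a j) + pairing (poly f) + a j * cauchy f (a j)) ?F"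
      by (intro tendsto_intros one pCons.IH tendsto_ident_at)
    then have "((\<lambda>x. c * cauchy 1 x + pairing (poly f) + x * cauchy f x) \<longlongrightarrow> cauchy (pCons c f) (a j)) ?F"
      by (simp add: cauchy_pCons[OF pole_integrable_singularity[OF j]])
    then show ?case
    proof (rule Lim_transform_eventually)
      show "\<forall>\<^sub>F x in ?F. c * cauchy 1 x + pairing (poly f) + x * cauchy f x = cauchy (pCons c f) x"
        using off by eventually_elim (simp add: cauchy_pCons pole_integrable_off_circle)
    qed
  qed
qed

lemma off_circle_ext_eq_cauchy:
  assumes eq: "\<And>x. x \<notin> sphere 0 1 \<Longrightarrow> F x = c * x * cauchy f x"
    and x: "x \<notin> sphere 0 1 \<or> x \<in> a ` {1..m}"
  shows "off_circle_ext F x = c * x * cauchy f x"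
proof (cases "x \<in> sphere 0 1")
  case True
  then obtain j where j: "j \<in> {1..m}" "x = a j" using x by auto
  have n: "norm (a j) = 1" using True j by simp
  let ?F = "at (a j) within - sphere 0 1"
  have "((\<lambda>x. c * x * cauchy f x) \<longlongrightarrow> c * a j * cauchy f (a j)) ?F"
    by (intro tendsto_intros tendsto_cauchy_at_singularity[OF j(1) n] tendsto_ident_at)
  then have "(F \<longlongrightarrow> c * a j * cauchy f (a j)) ?F"
    by (rule Lim_transform_eventually) (auto simp: eventually_at_filter eq)
  moreover have "\<not> trivial_limit ?F"
    using circle_point_islimpt_complement[OF n] by (simp add: trivial_limit_within)
  ultimately have "Lim ?F F = c * a j * cauchy f (a j)"
    by (intro tendsto_Lim)
  then show ?thesis
    using True by (simp add: off_circle_ext_def j(2))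
qed (simp add: off_circle_ext_def eq)

lemma assoc_fun_eq_cauchy:
  assumes "n \<ge> 1" "x \<notin> sphere 0 1 \<or> x \<in> a ` {1..m}"
  shows "assoc_fun w (p n) x = 2 * x * cauchy (p n) x"
  unfolding assoc_fun_def
  using assms by (intro off_circle_ext_eq_cauchy assoc_integral_eq_cauchy pole_integrable_off_circle) auto

lemma recip_assoc_fun_eq_cauchy:
  assumes "n \<ge> 1" "x \<notin> sphere 0 1 \<or> x \<in> a ` {1..m}"
  shows "recip_assoc_fun w n (q n) x = - 2 * x * cauchy (ps n) x"
  unfolding recip_assoc_fun_def
  using assms by (intro off_circle_ext_eq_cauchy recip_assoc_integral_eq_cauchy pole_integrable_off_circle) auto

end

section \<open>Deforming the bi-orthogonal polynomials\<close>

lemma deformation_set_islimpt: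
  assumes "deformation_set D" "t \<in> D"
  shows "t islimpt D"
  using assms(1) unfolding deformation_set_def
proof (elim disjE exE conjE)
  assume "open D"
  then show ?thesis
    using assms(2) by (rule open_imp_islimpt)
next
  fix I :: "real set" assume I: "open I" "D = complex_of_real ` I"
  then obtain x where x: "x \<in> I" "t = complex_of_real x" using assms(2) by auto
  have "x islimpt I"
    using I(1) x(1) by (rule open_imp_islimpt)
  then show ?thesis
    unfolding islimpt_approachable I(2) x(2) by (auto simp: dist_of_real)
qed

lemma has_field_derivative_cong_on:
  assumes "(f has_field_derivative d) (at t within D)" "t \<in> D" "\<And>s. s \<in> D \<Longrightarrow> f s = g s"
  shows "(g has_field_derivative d) (at t within D)"
  by (rule has_field_derivative_transform_within[OF assms(1), of 1]) (use assms(2,3) in auto)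

text \<open>
  The sublocale \<open>B\<close> below collects the facts at the fixed time \<open>t\<close>.
\<close>
locale biorthonormal_deformation = weight_deformation D m z dz \<rho> w t
  for D m z dz \<rho> w t +
  fixes \<kappa> d\<kappa> :: "nat \<Rightarrow> complex \<Rightarrow> complex" and \<phi> \<phi>b :: "nat \<Rightarrow> complex \<Rightarrow> complex poly" and n :: nat
  assumes biorth: "\<And>s. s \<in> D \<Longrightarrow> biorthonormal (w s) (\<lambda>k. \<kappa> k s) (\<lambda>k. \<phi> k s) (\<lambda>k. \<phi>b k s)"
    and \<kappa>_deriv: "(\<kappa> n has_field_derivative d\<kappa> n t) (at t within D)"
    and n: "n \<ge> 1"
    and m: "m \<ge> 2"
    and origin: "\<And>s. s \<in> D \<Longrightarrow> z 1 s = 0"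
begin

lemma bcw: "s \<in> D \<Longrightarrow> biorthonormal_circle_weight m (\<lambda>j. z j s) \<rho> (w s) (\<lambda>k. \<kappa> k s) (\<lambda>k. \<phi> k s) (\<lambda>k. \<phi>b k s)"
  unfolding biorthonormal_circle_weight_def biorthonormal_weight_def
  using weight integrable_circle_weight.w_L1[OF weight] biorth by blast

sublocale B: biorthonormal_circle_weight m "\<lambda>j. z j t" \<rho> "w t" "\<lambda>k. \<kappa> k t" "\<lambda>k. \<phi> k t" "\<lambda>k. \<phi>b k t"
  by (rule bcw[OF t])

lemma dz_origin: "dz 1 t = 0"
proof -
  have "((\<lambda>s. (z 1 s - z 1 t) / (s - t)) \<longlongrightarrow> dz 1 t) (at t within D)"
    using z_deriv[of 1 t] m t by (simp add: has_field_derivative_iff)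
  moreover have "((\<lambda>s. (z 1 s - z 1 t) / (s - t)) \<longlongrightarrow> 0) (at t within D)"
    by (rule Lim_transform_eventually[OF tendsto_const])
       (use origin t in \<open>auto simp: eventually_at_filter\<close>)
  moreover have "\<not> trivial_limit (at t within D)"
    using deformation_set_islimpt[OF D t] by (simp add: trivial_limit_within)
  ultimately show ?thesis
    using tendsto_unique by blast
qed

lemma z_nonzero: "j \<in> {2..m} \<Longrightarrow> z j t \<noteq> 0"
  using inj_onD[OF B.cw.a_inj, of j 1] origin[OF t] by fastforce

text \<open>
  The singularity at the origin does not move, so terms that would divide by \<open>z 1 t = 0\<close> are
  multiplied by zero.
\<close>
lemma sum_dz:
  assumes "\<And>j. j \<in> {2..m} \<Longrightarrow> f j = g j"
  shows "(\<Sum>j=1..m. \<rho> j * dz j t * f j) = (\<Sum>j=1..m. \<rho> j * dz j t * g j)"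
proof (rule sum.cong[OF refl])
  fix j assume "j \<in> {1..m}"
  then show "\<rho> j * dz j t * f j = \<rho> j * dz j t * g j"
    using assms[of j] dz_origin by (cases "j = 1") auto
qed

definition moment :: "complex \<Rightarrow> complex poly \<Rightarrow> complex poly \<Rightarrow> complex" where
  "moment s f g = circle_int (\<lambda>\<zeta>. w s \<zeta> * (poly f \<zeta> * poly g (inverse \<zeta>)))"

text \<open>
  The pairing with the derivative of the weight at time \<open>t\<close>.
\<close>
definition dmoment :: "complex poly \<Rightarrow> complex poly \<Rightarrow> complex" where
  "dmoment f g = - (\<Sum>j=1..m. \<rho> j * dz j t * B.pairing (\<lambda>\<zeta>. poly f \<zeta> * poly g (inverse \<zeta>) / (\<zeta> - z j t)))"

lemma moment_has_field_derivative:
  "((\<lambda>s. moment s f g) has_field_derivative dmoment f g) (at t within D)"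
  unfolding moment_def dmoment_def B.pairing_def
  by (rule circle_int_weight_has_field_derivative) (intro B.poly_inverse_intros)

lemma moment_eq_pairing:
  assumes "s \<in> D"
  shows "moment s f g = biorthonormal_weight.pairing (w s) (\<lambda>\<zeta>. poly f \<zeta> * poly g (inverse \<zeta>))"
proof -
  interpret S: biorthonormal_circle_weight m "\<lambda>j. z j s" \<rho> "w s" "\<lambda>k. \<kappa> k s" "\<lambda>k. \<phi> k s" "\<lambda>k. \<phi>b k s"
    by (rule bcw[OF assms])
  show ?thesis by (simp only: moment_def S.pairing_def)
qed

lemma moment_sum_left:
  assumes "s \<in> D"
  shows "moment s (\<Sum>k\<le>n. Polynomial.smult (c k) (f k)) g = (\<Sum>k\<le>n. c k * moment s (f k) g)"
proof -
  interpret S: biorthonormal_circle_weight m "\<lambda>j. z j s" \<rho> "w s" "\<lambda>k. \<kappa> k s" "\<lambda>k. \<phi> k s" "\<lambda>k. \<phi>b k s"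
    by (rule bcw[OF assms])
  have "moment s (\<Sum>k\<le>n. Polynomial.smult (c k) (f k)) g =
      S.pairing (\<lambda>\<zeta>. \<Sum>k\<le>n. c k * (poly (f k) \<zeta> * poly g (inverse \<zeta>)))"
    unfolding moment_eq_pairing[OF assms]
    by (simp add: poly_sum sum_distrib_right mult.assoc)
  then show ?thesis
    unfolding moment_eq_pairing[OF assms] by (simp add: S.pairing_lincomb_sum S.paired_poly)
qed

lemma moment_sum_right:
  assumes "s \<in> D"
  shows "moment s f (\<Sum>k\<le>n. Polynomial.smult (c k) (g k)) = (\<Sum>k\<le>n. c k * moment s f (g k))"
proof -
  interpret S: biorthonormal_circle_weight m "\<lambda>j. z j s" \<rho> "w s" "\<lambda>k. \<kappa> k s" "\<lambda>k. \<phi> k s" "\<lambda>k. \<phi>b k s"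
    by (rule bcw[OF assms])
  have "moment s f (\<Sum>k\<le>n. Polynomial.smult (c k) (g k)) =
      S.pairing (\<lambda>\<zeta>. \<Sum>k\<le>n. c k * (poly f \<zeta> * poly (g k) (inverse \<zeta>)))"
    unfolding moment_eq_pairing[OF assms]
    by (simp add: poly_sum sum_distrib_left mult.left_commute)
  then show ?thesis
    unfolding moment_eq_pairing[OF assms] by (simp add: S.pairing_lincomb_sum S.paired_poly)
qed

abbreviation q where "q \<equiv> d\<kappa> n t / \<kappa> n t"

lemma \<phi>_expansion:
  "\<exists>c. (\<forall>s\<in>D. \<phi> n s = (\<Sum>k\<le>n. Polynomial.smult (c k s) (\<phi> k t))) \<and>
     (\<forall>k\<le>n. (c k has_field_derivative
        (if k = n then - q else 0) - dmoment (\<phi> n t) (\<phi>b k t)) (at t within D)) \<and>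
     (\<forall>k\<le>n. c k t = (if k = n then 1 else 0))"
proof (rule dual_basis_expansion_derivative[where B = moment and p = "\<lambda>k. \<phi> k t" and q = "\<lambda>k. \<phi>b k t"
      and P = "\<phi> n" and \<kappa> = "\<kappa> n" and B' = dmoment and d\<kappa> = "d\<kappa> n t"])
  fix s g assume s: "s \<in> D"
  interpret S: biorthonormal_circle_weight m "\<lambda>j. z j s" \<rho> "w s" "\<lambda>k. \<kappa> k s" "\<lambda>k. \<phi> k s" "\<lambda>k. \<phi>b k s"
    by (rule bcw[OF s])
  show "degree (\<phi> n s) \<le> n" by simp
  show "moment s (\<phi> n s) g = coeff g n / \<kappa> n s" if "degree g \<le> n"
    unfolding moment_eq_pairing[OF s] by (rule S.pairing_p[OF that])
  show "moment s (\<Sum>k\<le>n. Polynomial.smult (c k) (\<phi> k t)) g = (\<Sum>k\<le>n. c k * moment s (\<phi> k t) g)" for c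
    by (rule moment_sum_left[OF s])
next
  show "moment t (\<phi> k t) (\<phi>b j t) = (if j = k then 1 else 0)" for j k
    unfolding moment_eq_pairing[OF t] B.pairing_p_q by auto
qed (use \<kappa>_deriv t moment_has_field_derivative in auto)

lemma \<phi>b_expansion:
  "\<exists>c. (\<forall>s\<in>D. \<phi>b n s = (\<Sum>k\<le>n. Polynomial.smult (c k s) (\<phi>b k t))) \<and>
     (\<forall>k\<le>n. (c k has_field_derivative
        (if k = n then - q else 0) - dmoment (\<phi> k t) (\<phi>b n t)) (at t within D)) \<and>
     (\<forall>k\<le>n. c k t = (if k = n then 1 else 0))"
proof (rule dual_basis_expansion_derivative[where B = "\<lambda>s f g. moment s g f" and p = "\<lambda>k. \<phi>b k t" and q = "\<lambda>k. \<phi> k t"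
      and P = "\<phi>b n" and \<kappa> = "\<kappa> n" and B' = "\<lambda>f g. dmoment g f" and d\<kappa> = "d\<kappa> n t"])
  fix s g assume s: "s \<in> D"
  interpret S: biorthonormal_circle_weight m "\<lambda>j. z j s" \<rho> "w s" "\<lambda>k. \<kappa> k s" "\<lambda>k. \<phi> k s" "\<lambda>k. \<phi>b k s"
    by (rule bcw[OF s])
  show "degree (\<phi>b n s) \<le> n" by simp
  show "moment s g (\<phi>b n s) = coeff g n / \<kappa> n s" if "degree g \<le> n"
    unfolding moment_eq_pairing[OF s] by (rule S.pairing_q[OF that])
  show "moment s g (\<Sum>k\<le>n. Polynomial.smult (c k) (\<phi>b k t)) = (\<Sum>k\<le>n. c k * moment s g (\<phi>b k t))" for c
    by (rule moment_sum_right[OF s])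
next
  show "moment t (\<phi> j t) (\<phi>b k t) = (if j = k then 1 else 0)" for j k
    unfolding moment_eq_pairing[OF t] B.pairing_p_q by auto
qed (use \<kappa>_deriv t moment_has_field_derivative in auto)

lemma sum_expansion_derivatives:
  "(\<Sum>k\<le>n. ((if k = n then - q else 0) - - (\<Sum>j=1..m. \<rho> j * dz j t * b j k)) * y k) =
     - q * y n + (\<Sum>j=1..m. \<rho> j * dz j t * (\<Sum>k\<le>n. b j k * y k))"
proof -
  have "(\<Sum>k\<le>n. ((if k = n then - q else 0) - - (\<Sum>j=1..m. \<rho> j * dz j t * b j k)) * y k) =
      (\<Sum>k\<le>n. (if k = n then - q * y n else 0) + (\<Sum>j=1..m. \<rho> j * dz j t * (b j k * y k)))"
    by (intro sum.cong refl) (simp add: distrib_right sum_distrib_right mult.assoc)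
  also have "\<dots> = - q * y n + (\<Sum>k\<le>n. \<Sum>j=1..m. \<rho> j * dz j t * (b j k * y k))"
    by (simp add: sum.distrib)
  also have "(\<Sum>k\<le>n. \<Sum>j=1..m. \<rho> j * dz j t * (b j k * y k)) =
      (\<Sum>j=1..m. \<rho> j * dz j t * (\<Sum>k\<le>n. b j k * y k))"
    by (subst sum.swap) (simp add: sum_distrib_left)
  finally show ?thesis .
qed

lemma pole_z: "j \<in> {2..m} \<Longrightarrow> B.pole_integrable (z j t)"
  by (rule B.pole_integrable_singularity) auto

lemma \<phi>_deriv:
  "((\<lambda>s. poly (\<phi> n s) x) has_field_derivative
     - q * poly (\<phi> n t) x + (\<Sum>j=1..m. \<rho> j * dz j t *
        (B.cauchy (\<phi> n t) (z j t) / z j t ^ n * B.kernel n (z j t) x - poly (\<phi> n t) x / z j t)))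
   (at t within D)"
proof -
  obtain c where "\<forall>s\<in>D. \<phi> n s = (\<Sum>k\<le>n. Polynomial.smult (c k s) (\<phi> k t))"
    and "\<forall>k\<le>n. (c k has_field_derivative
        (if k = n then - q else 0) - dmoment (\<phi> n t) (\<phi>b k t)) (at t within D)"
    and "\<forall>k\<le>n. c k t = (if k = n then 1 else 0)"
    using \<phi>_expansion by (elim exE conjE) (rule that, assumption+)
  note c = this(1)[rule_format] and c' = this(2)[rule_format] and c_t = this(3)[rule_format]
  have "((\<lambda>s. \<Sum>k\<le>n. c k s * poly (\<phi> k t) x) has_field_derivative
      (\<Sum>k\<le>n. ((if k = n then - q else 0) - dmoment (\<phi> n t) (\<phi>b k t)) * poly (\<phi> k t) x)) (at t within D)"
    by (intro DERIV_sum DERIV_cmult_right c') simp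
  also have "(\<Sum>k\<le>n. ((if k = n then - q else 0) - dmoment (\<phi> n t) (\<phi>b k t)) * poly (\<phi> k t) x) =
      - q * poly (\<phi> n t) x + (\<Sum>j=1..m. \<rho> j * dz j t *
        (B.cauchy (\<phi> n t) (z j t) / z j t ^ n * B.kernel n (z j t) x - poly (\<phi> n t) x / z j t))"
    unfolding dmoment_def sum_expansion_derivatives
    by (intro arg_cong2[of _ _ _ _ "(+)"] refl sum_dz B.sum_pairing_p_pole pole_z z_nonzero n)
  finally show ?thesis
    by (rule has_field_derivative_cong_on[OF _ t]) (simp add: c poly_sum)
qed

text \<open>
  Reversing \<open>\<phi>b\<close> at every time with respect to the same \<open>n\<close> turns its expansion into one of
  \<open>\<phi>\<^sub>n\<^sup>*\<close> in the reversed basis.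
\<close>
lemma \<phi>s_deriv:
  "((\<lambda>s. poly (reflect_poly (\<phi>b n s)) x) has_field_derivative
     - q * poly (B.ps n) x + (\<Sum>j=1..m. \<rho> j * dz j t *
        (B.cauchy (B.ps n) (z j t) / z j t ^ n * B.kernel n x (z j t))))
   (at t within D)"
proof -
  obtain c where "\<forall>s\<in>D. \<phi>b n s = (\<Sum>k\<le>n. Polynomial.smult (c k s) (\<phi>b k t))"
    and "\<forall>k\<le>n. (c k has_field_derivative
        (if k = n then - q else 0) - dmoment (\<phi> k t) (\<phi>b n t)) (at t within D)"
    and "\<forall>k\<le>n. c k t = (if k = n then 1 else 0)"
    using \<phi>b_expansion by (elim exE conjE) (rule that, assumption+)
  note c = this(1)[rule_format] and c' = this(2)[rule_format] and c_t = this(3)[rule_format]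
  have "((\<lambda>s. \<Sum>k\<le>n. c k s * poly (rev_poly n (\<phi>b k t)) x) has_field_derivative
      (\<Sum>k\<le>n. ((if k = n then - q else 0) - dmoment (\<phi> k t) (\<phi>b n t)) * poly (rev_poly n (\<phi>b k t)) x)) (at t within D)"
    by (intro DERIV_sum DERIV_cmult_right c') simp
  also have "(\<Sum>k\<le>n. ((if k = n then - q else 0) - dmoment (\<phi> k t) (\<phi>b n t)) * poly (rev_poly n (\<phi>b k t)) x) =
      - q * poly (B.ps n) x + (\<Sum>j=1..m. \<rho> j * dz j t *
        (B.cauchy (B.ps n) (z j t) / z j t ^ n * B.kernel n x (z j t)))"
    unfolding dmoment_def sum_expansion_derivatives B.rev_poly_q
    by (intro arg_cong2[of _ _ _ _ "(+)"] refl sum_dz B.sum_pairing_q_pole pole_z z_nonzero)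
  finally show ?thesis
  proof (rule has_field_derivative_cong_on[OF _ t])
    fix s assume s: "s \<in> D"
    interpret S: biorthonormal_circle_weight m "\<lambda>j. z j s" \<rho> "w s" "\<lambda>k. \<kappa> k s" "\<lambda>k. \<phi> k s" "\<lambda>k. \<phi>b k s"
      by (rule bcw[OF s])
    have "reflect_poly (\<phi>b n s) = rev_poly n (\<phi>b n s)"
      by (simp add: S.rev_poly_q)
    also have "\<dots> = (\<Sum>k\<le>n. Polynomial.smult (c k s) (rev_poly n (\<phi>b k t)))"
      unfolding c[OF s] by (rule rev_poly_sum)
    finally show "(\<Sum>k\<le>n. c k s * poly (rev_poly n (\<phi>b k t)) x) = poly (reflect_poly (\<phi>b n s)) x"
      by (simp add: poly_sum)
  qed
qed

lemma cauchy_has_field_derivative: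
  assumes x: "x \<notin> sphere 0 1" "x \<notin> (\<lambda>j. z j t) ` {2..m}"
  shows "((\<lambda>s. circle_int (\<lambda>\<zeta>. w s \<zeta> * (poly f \<zeta> / (\<zeta> - x)))) has_field_derivative
      - (\<Sum>j=1..m. \<rho> j * dz j t * ((B.cauchy f x - B.cauchy f (z j t)) / (x - z j t)))) (at t within D)"
proof -
  have "((\<lambda>s. circle_int (\<lambda>\<zeta>. w s \<zeta> * (poly f \<zeta> / (\<zeta> - x)))) has_field_derivative
      - (\<Sum>j=1..m. \<rho> j * dz j t * circle_int (\<lambda>\<zeta>. w t \<zeta> * (poly f \<zeta> / (\<zeta> - x) / (\<zeta> - z j t))))) (at t within D)"
    by (rule circle_int_weight_has_field_derivative) (intro continuous_intros continuous_on_poly; use x in auto)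
  also have "(\<Sum>j=1..m. \<rho> j * dz j t * circle_int (\<lambda>\<zeta>. w t \<zeta> * (poly f \<zeta> / (\<zeta> - x) / (\<zeta> - z j t)))) =
      (\<Sum>j=1..m. \<rho> j * dz j t * ((B.cauchy f x - B.cauchy f (z j t)) / (x - z j t)))"
  proof (rule sum_dz)
    fix j assume j: "j \<in> {2..m}"
    have "circle_int (\<lambda>\<zeta>. w t \<zeta> * (poly f \<zeta> / (\<zeta> - x) / (\<zeta> - z j t))) =
        B.pairing (\<lambda>\<zeta>. poly f \<zeta> / ((\<zeta> - x) * (\<zeta> - z j t)))"
      by (simp add: B.pairing_def)
    also have "\<dots> = (B.cauchy f x - B.cauchy f (z j t)) / (x - z j t)"
      using x j by (intro B.pole_integrable_two(2) B.pole_integrable_off_circle pole_z) auto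
    finally show "circle_int (\<lambda>\<zeta>. w t \<zeta> * (poly f \<zeta> / (\<zeta> - x) / (\<zeta> - z j t))) =
        (B.cauchy f x - B.cauchy f (z j t)) / (x - z j t)" .
  qed
  finally show ?thesis .
qed

lemma cauchy_eq:
  assumes "s \<in> D" "x \<notin> sphere 0 1"
  shows "biorthonormal_weight.cauchy (w s) (\<Sum>k\<le>n. Polynomial.smult (c k) (f k)) x =
     (\<Sum>k\<le>n. c k * circle_int (\<lambda>\<zeta>. w s \<zeta> * (poly (f k) \<zeta> / (\<zeta> - x))))"
proof -
  interpret S: biorthonormal_circle_weight m "\<lambda>j. z j s" \<rho> "w s" "\<lambda>k. \<kappa> k s" "\<lambda>k. \<phi> k s" "\<lambda>k. \<phi>b k s"
    by (rule bcw[OF assms(1)])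
  show ?thesis
    using S.cauchy_sum[of x "{..n}" c f] S.pole_integrable_off_circle[OF assms(2)]
    by (simp add: S.cauchy_def S.pairing_def)
qed

lemma cauchy_t: "circle_int (\<lambda>\<zeta>. w t \<zeta> * (poly f \<zeta> / (\<zeta> - x))) = B.cauchy f x"
  by (simp add: B.cauchy_def B.pairing_def)

text \<open>
  Both the coefficients of the expansion and the weight depend on \<open>s\<close>. At \<open>s = t\<close> the expansion
  has one term only, so that the derivative of the weight meets \<open>f n\<close> alone.
\<close>
lemma expansion_cauchy_derivative:
  assumes c': "\<And>k. k \<le> n \<Longrightarrow> (c k has_field_derivative c' k) (at t within D)"
    and c_t: "\<And>k. k \<le> n \<Longrightarrow> c k t = (if k = n then 1 else 0)"
    and x: "x \<notin> sphere 0 1" "x \<notin> (\<lambda>j. z j t) ` {2..m}"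
  shows "((\<lambda>s. \<Sum>k\<le>n. c k s * circle_int (\<lambda>\<zeta>. w s \<zeta> * (poly (f k) \<zeta> / (\<zeta> - x)))) has_field_derivative
      (\<Sum>k\<le>n. c' k * B.cauchy (f k) x) -
      (\<Sum>j=1..m. \<rho> j * dz j t * ((B.cauchy (f n) x - B.cauchy (f n) (z j t)) / (x - z j t)))) (at t within D)"
proof -
  let ?d = "\<lambda>k. - (\<Sum>j=1..m. \<rho> j * dz j t * ((B.cauchy (f k) x - B.cauchy (f k) (z j t)) / (x - z j t)))"
  have "((\<lambda>s. \<Sum>k\<le>n. c k s * circle_int (\<lambda>\<zeta>. w s \<zeta> * (poly (f k) \<zeta> / (\<zeta> - x)))) has_field_derivative
      (\<Sum>k\<le>n. c' k * circle_int (\<lambda>\<zeta>. w t \<zeta> * (poly (f k) \<zeta> / (\<zeta> - x))) + ?d k * c k t)) (at t within D)"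
    by (intro DERIV_sum DERIV_mult c' cauchy_has_field_derivative x) simp
  also have "(\<Sum>k\<le>n. c' k * circle_int (\<lambda>\<zeta>. w t \<zeta> * (poly (f k) \<zeta> / (\<zeta> - x))) + ?d k * c k t) =
      (\<Sum>k\<le>n. c' k * B.cauchy (f k) x + (if k = n then ?d n else 0))"
    unfolding cauchy_t by (intro sum.cong refl) (simp add: c_t)
  also have "\<dots> = (\<Sum>k\<le>n. c' k * B.cauchy (f k) x) + ?d n"
    by (simp add: sum.distrib)
  finally show ?thesis by simp
qed

lemma E_deriv:
  assumes x: "x \<notin> sphere 0 1" "x \<notin> (\<lambda>j. z j t) ` {2..m}"
  shows "((\<lambda>s. assoc_fun (w s) (\<phi> n s) x) has_field_derivative
     2 * x * (- q * B.cauchy (\<phi> n t) x + (\<Sum>j=1..m. \<rho> j * dz j t *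
        (B.cauchy (\<phi> n t) (z j t) / z j t ^ n * B.cauchy_kernel n (z j t) x - B.cauchy (\<phi> n t) x / z j t
          - (B.cauchy (\<phi> n t) x - B.cauchy (\<phi> n t) (z j t)) / (x - z j t)))))
   (at t within D)"
proof -
  obtain c where "\<forall>s\<in>D. \<phi> n s = (\<Sum>k\<le>n. Polynomial.smult (c k s) (\<phi> k t))"
    and "\<forall>k\<le>n. (c k has_field_derivative
        (if k = n then - q else 0) - dmoment (\<phi> n t) (\<phi>b k t)) (at t within D)"
    and "\<forall>k\<le>n. c k t = (if k = n then 1 else 0)"
    using \<phi>_expansion by (elim exE conjE) (rule that, assumption+)
  note c = this(1)[rule_format] and c' = this(2)[rule_format] and c_t = this(3)[rule_format]
  have sum: "(\<Sum>k\<le>n. ((if k = n then - q else 0) - dmoment (\<phi> n t) (\<phi>b k t)) * B.cauchy (\<phi> k t) x) =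
      - q * B.cauchy (\<phi> n t) x + (\<Sum>j=1..m. \<rho> j * dz j t *
        (B.cauchy (\<phi> n t) (z j t) / z j t ^ n * B.cauchy_kernel n (z j t) x - B.cauchy (\<phi> n t) x / z j t))"
    unfolding dmoment_def sum_expansion_derivatives
  proof (intro arg_cong2[of _ _ _ _ "(+)"] refl sum_dz)
    fix j assume j: "j \<in> {2..m}"
    note P = pole_z[OF j] and X = B.pole_integrable_off_circle[OF x(1)]
    have xz: "x \<noteq> z j t" using x(2) j by auto
    let ?b = "\<lambda>k. B.pairing (\<lambda>\<zeta>. poly (\<phi> n t) \<zeta> * poly (\<phi>b k t) (inverse \<zeta>) / (\<zeta> - z j t))"
    have "(\<Sum>k\<le>n. ?b k * B.cauchy (\<phi> k t) x) = B.cauchy (\<Sum>k\<le>n. Polynomial.smult (?b k) (\<phi> k t)) x"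
      by (simp add: B.cauchy_sum X)
    also have "(\<Sum>k\<le>n. Polynomial.smult (?b k) (\<phi> k t)) =
        (\<Sum>k\<le>n. Polynomial.smult (B.cauchy (\<phi> n t) (z j t) / z j t ^ n * poly (rev_poly n (\<phi>b k t)) (z j t)) (\<phi> k t))
         + Polynomial.smult (- 1 / z j t) (\<phi> n t)"
    proof (rule poly_eqI_off_finite[of "{}"])
      show "poly (\<Sum>k\<le>n. Polynomial.smult (?b k) (\<phi> k t)) y =
          poly ((\<Sum>k\<le>n. Polynomial.smult (B.cauchy (\<phi> n t) (z j t) / z j t ^ n * poly (rev_poly n (\<phi>b k t)) (z j t)) (\<phi> k t))
           + Polynomial.smult (- 1 / z j t) (\<phi> n t)) y" for y
        using B.sum_pairing_p_pole[OF P z_nonzero[OF j] n, of y]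
        by (simp add: poly_sum B.kernel_def sum_distrib_left mult.assoc)
    qed simp
    also have "B.cauchy \<dots> x = B.cauchy (\<phi> n t) (z j t) / z j t ^ n * B.cauchy_kernel n (z j t) x - B.cauchy (\<phi> n t) x / z j t"
      unfolding B.cauchy_add[OF X] B.cauchy_sum[OF X finite_atMost] B.cauchy_smult
      by (simp add: B.sum_cauchy_p[OF X P xz n, symmetric] sum_distrib_left mult.assoc)
    finally show "(\<Sum>k\<le>n. ?b k * B.cauchy (\<phi> k t) x) = B.cauchy (\<phi> n t) (z j t) / z j t ^ n *
        B.cauchy_kernel n (z j t) x - B.cauchy (\<phi> n t) x / z j t" .
  qed
  have "((\<lambda>s. 2 * x * (\<Sum>k\<le>n. c k s * circle_int (\<lambda>\<zeta>. w s \<zeta> * (poly (\<phi> k t) \<zeta> / (\<zeta> - x))))) has_field_derivative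
      2 * x * (- q * B.cauchy (\<phi> n t) x + (\<Sum>j=1..m. \<rho> j * dz j t *
        (B.cauchy (\<phi> n t) (z j t) / z j t ^ n * B.cauchy_kernel n (z j t) x - B.cauchy (\<phi> n t) x / z j t)) -
      (\<Sum>j=1..m. \<rho> j * dz j t * ((B.cauchy (\<phi> n t) x - B.cauchy (\<phi> n t) (z j t)) / (x - z j t))))) (at t within D)"
    unfolding sum[symmetric]
    by (intro DERIV_cmult expansion_cauchy_derivative c' c_t x)
  also have "- q * B.cauchy (\<phi> n t) x + (\<Sum>j=1..m. \<rho> j * dz j t *
        (B.cauchy (\<phi> n t) (z j t) / z j t ^ n * B.cauchy_kernel n (z j t) x - B.cauchy (\<phi> n t) x / z j t)) -
      (\<Sum>j=1..m. \<rho> j * dz j t * ((B.cauchy (\<phi> n t) x - B.cauchy (\<phi> n t) (z j t)) / (x - z j t))) =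
      - q * B.cauchy (\<phi> n t) x + (\<Sum>j=1..m. \<rho> j * dz j t *
        (B.cauchy (\<phi> n t) (z j t) / z j t ^ n * B.cauchy_kernel n (z j t) x - B.cauchy (\<phi> n t) x / z j t
          - (B.cauchy (\<phi> n t) x - B.cauchy (\<phi> n t) (z j t)) / (x - z j t)))"
    by (simp only: add_diff_eq[symmetric] sum_subtractf[symmetric] right_diff_distrib[symmetric])
  finally show ?thesis
  proof (rule has_field_derivative_cong_on[OF _ t])
    fix s assume s: "s \<in> D"
    interpret S: biorthonormal_circle_weight m "\<lambda>j. z j s" \<rho> "w s" "\<lambda>k. \<kappa> k s" "\<lambda>k. \<phi> k s" "\<lambda>k. \<phi>b k s"
      by (rule bcw[OF s])
    have "assoc_fun (w s) (\<phi> n s) x = 2 * x * S.cauchy (\<phi> n s) x"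
      using S.assoc_fun_eq_cauchy[OF n] x by simp
    also have "S.cauchy (\<phi> n s) x = (\<Sum>k\<le>n. c k s * circle_int (\<lambda>\<zeta>. w s \<zeta> * (poly (\<phi> k t) \<zeta> / (\<zeta> - x))))"
      by (subst c[OF s]) (rule cauchy_eq[OF s x(1)])
    finally show "2 * x * (\<Sum>k\<le>n. c k s * circle_int (\<lambda>\<zeta>. w s \<zeta> * (poly (\<phi> k t) \<zeta> / (\<zeta> - x)))) =
        assoc_fun (w s) (\<phi> n s) x" by simp
  qed
qed

lemma Es_deriv:
  assumes x: "x \<notin> sphere 0 1" "x \<notin> (\<lambda>j. z j t) ` {2..m}"
  shows "((\<lambda>s. recip_assoc_fun (w s) n (\<phi>b n s) x) has_field_derivative
     - 2 * x * (- q * B.cauchy (B.ps n) x + (\<Sum>j=1..m. \<rho> j * dz j t *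
        (B.cauchy (B.ps n) (z j t) / z j t ^ n * B.cauchy_kernel n (z j t) x
          - (B.cauchy (B.ps n) x - B.cauchy (B.ps n) (z j t)) / (x - z j t)))))
   (at t within D)"
proof -
  obtain c where "\<forall>s\<in>D. \<phi>b n s = (\<Sum>k\<le>n. Polynomial.smult (c k s) (\<phi>b k t))"
    and "\<forall>k\<le>n. (c k has_field_derivative
        (if k = n then - q else 0) - dmoment (\<phi> k t) (\<phi>b n t)) (at t within D)"
    and "\<forall>k\<le>n. c k t = (if k = n then 1 else 0)"
    using \<phi>b_expansion by (elim exE conjE) (rule that, assumption+)
  note c = this(1)[rule_format] and c' = this(2)[rule_format] and c_t = this(3)[rule_format]
  let ?r = "\<lambda>k. rev_poly n (\<phi>b k t)"
  have sum: "(\<Sum>k\<le>n. ((if k = n then - q else 0) - dmoment (\<phi> k t) (\<phi>b n t)) * B.cauchy (?r k) x) =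
      - q * B.cauchy (B.ps n) x + (\<Sum>j=1..m. \<rho> j * dz j t *
        (B.cauchy (B.ps n) (z j t) / z j t ^ n * B.cauchy_kernel n (z j t) x))"
    unfolding dmoment_def sum_expansion_derivatives B.rev_poly_q
  proof (intro arg_cong2[of _ _ _ _ "(+)"] refl sum_dz)
    fix j assume j: "j \<in> {2..m}"
    note P = pole_z[OF j] and X = B.pole_integrable_off_circle[OF x(1)]
    have xz: "x \<noteq> z j t" using x(2) j by auto
    have "(\<Sum>k\<le>n. B.pairing (\<lambda>\<zeta>. poly (\<phi> k t) \<zeta> * poly (\<phi>b n t) (inverse \<zeta>) / (\<zeta> - z j t)) * B.cauchy (?r k) x) =
        (\<Sum>k\<le>n. B.cauchy (B.ps n) (z j t) / z j t ^ n * (poly (\<phi> k t) (z j t) * B.cauchy (?r k) x))"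
      using P z_nonzero[OF j] by (intro sum.cong refl) (simp add: B.pairing_q_pole)
    also have "\<dots> = B.cauchy (B.ps n) (z j t) / z j t ^ n * B.cauchy_kernel n (z j t) x"
      by (simp only: sum_distrib_left[symmetric] B.sum_cauchy_rev_q[OF X P xz n])
    finally show "(\<Sum>k\<le>n. B.pairing (\<lambda>\<zeta>. poly (\<phi> k t) \<zeta> * poly (\<phi>b n t) (inverse \<zeta>) / (\<zeta> - z j t)) * B.cauchy (?r k) x) =
        B.cauchy (B.ps n) (z j t) / z j t ^ n * B.cauchy_kernel n (z j t) x" .
  qed
  have "((\<lambda>s. - 2 * x * (\<Sum>k\<le>n. c k s * circle_int (\<lambda>\<zeta>. w s \<zeta> * (poly (?r k) \<zeta> / (\<zeta> - x))))) has_field_derivative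
      - 2 * x * ((\<Sum>k\<le>n. ((if k = n then - q else 0) - dmoment (\<phi> k t) (\<phi>b n t)) * B.cauchy (?r k) x) -
      (\<Sum>j=1..m. \<rho> j * dz j t * ((B.cauchy (?r n) x - B.cauchy (?r n) (z j t)) / (x - z j t))))) (at t within D)"
    by (intro DERIV_cmult expansion_cauchy_derivative c' c_t x)
  also have "(\<Sum>k\<le>n. ((if k = n then - q else 0) - dmoment (\<phi> k t) (\<phi>b n t)) * B.cauchy (?r k) x) -
      (\<Sum>j=1..m. \<rho> j * dz j t * ((B.cauchy (?r n) x - B.cauchy (?r n) (z j t)) / (x - z j t))) =
      - q * B.cauchy (B.ps n) x + (\<Sum>j=1..m. \<rho> j * dz j t *
        (B.cauchy (B.ps n) (z j t) / z j t ^ n * B.cauchy_kernel n (z j t) x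
          - (B.cauchy (B.ps n) x - B.cauchy (B.ps n) (z j t)) / (x - z j t)))"
    unfolding sum B.rev_poly_q
    by (simp only: add_diff_eq[symmetric] sum_subtractf[symmetric] right_diff_distrib[symmetric])
  finally show ?thesis
  proof (rule has_field_derivative_cong_on[OF _ t])
    fix s assume s: "s \<in> D"
    interpret S: biorthonormal_circle_weight m "\<lambda>j. z j s" \<rho> "w s" "\<lambda>k. \<kappa> k s" "\<lambda>k. \<phi> k s" "\<lambda>k. \<phi>b k s"
      by (rule bcw[OF s])
    have "recip_assoc_fun (w s) n (\<phi>b n s) x = - 2 * x * S.cauchy (reflect_poly (\<phi>b n s)) x"
      using S.recip_assoc_fun_eq_cauchy[OF n] x by simp
    also have "reflect_poly (\<phi>b n s) = rev_poly n (\<phi>b n s)"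
      by (simp add: S.rev_poly_q)
    also have "\<dots> = (\<Sum>k\<le>n. Polynomial.smult (c k s) (?r k))"
      unfolding c[OF s] by (rule rev_poly_sum)
    also have "S.cauchy \<dots> x = (\<Sum>k\<le>n. c k s * circle_int (\<lambda>\<zeta>. w s \<zeta> * (poly (?r k) \<zeta> / (\<zeta> - x))))"
      by (rule cauchy_eq[OF s x(1)])
    finally show "- 2 * x * (\<Sum>k\<le>n. c k s * circle_int (\<lambda>\<zeta>. w s \<zeta> * (poly (?r k) \<zeta> / (\<zeta> - x)))) =
        recip_assoc_fun (w s) n (\<phi>b n s) x" by simp
  qed
qed

end

section \<open>The deformation equations\<close>

text \<open>
  The sums of the deformation equations are gathered into one sum over the singularities, to be
  compared term by term with the derivatives computed above.
\<close>
lemma collect_phi: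
  fixes r F G :: "nat \<Rightarrow> complex"
  shows "(- q - (\<Sum>j\<in>A. r j) + 1/2 * (\<Sum>j\<in>A. F j)) * P - (1/2 * (\<Sum>j\<in>A. G j)) * S =
    - q * P + (\<Sum>j\<in>A. - r j * P + 1/2 * F j * P - 1/2 * G j * S)"
  by (simp add: sum.distrib sum_subtractf sum_negf sum_distrib_left sum_distrib_right
      sum_divide_distrib algebra_simps)

lemma collect_phis:
  fixes F G :: "nat \<Rightarrow> complex"
  shows "(- q + 1/2 * (\<Sum>j\<in>A. F j)) * P - (1/2 * (\<Sum>j\<in>A. G j)) * S =
    - q * P + (\<Sum>j\<in>A. 1/2 * F j * P - 1/2 * G j * S)"
  by (simp add: sum.distrib sum_subtractf sum_distrib_left sum_distrib_right
      sum_divide_distrib algebra_simps)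

lemma collect_eps:
  fixes F G :: "nat \<Rightarrow> complex"
  shows "(- q - 1/2 * (\<Sum>j\<in>A. F j)) * P + (1/2 * (\<Sum>j\<in>A. G j)) * S =
    - q * P + (\<Sum>j\<in>A. - (1/2 * F j * P) + 1/2 * G j * S)"
  by (simp add: sum.distrib sum_subtractf sum_negf sum_distrib_left sum_distrib_right
      sum_divide_distrib algebra_simps)

text \<open>
  The contribution of one singularity \<open>z\<close> to the equations for the polynomials. Here \<open>Z\<close> stands
  for \<open>z ^ n\<close> and \<open>d\<close> for \<open>\<rho>\<^sub>j z\<^sub>j'\<close>. The polynomial and its reciprocal have the values \<open>p\<close>, \<open>ps\<close>
  at \<open>z\<close> and \<open>P\<close>, \<open>S\<close> at \<open>x\<close>; \<open>C\<close> is the Cauchy transform at \<open>z\<close> of the one being differentiated.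
\<close>
lemma phi_term:
  fixes x z :: complex
  assumes "x \<noteq> z" "z \<noteq> 0" "Z \<noteq> 0"
  shows "d * (C / Z * ((x * P * ps - z * p * S) / (x - z)) - P / z) =
    - (d / z) * P + 1/2 * (d / z * (1 / Z) * (2 * z * C) * ps * (x / (x - z))) * P
      - 1/2 * (d / z * (z / Z) * (2 * z * C) * p * (1 / (x - z))) * S"
  using assms by (simp add: divide_simps) (simp add: algebra_simps)

lemma phis_term:
  fixes x z :: complex
  assumes "x \<noteq> z" "z \<noteq> 0" "Z \<noteq> 0"
  shows "d * (C / Z * ((x * P * ps - z * p * S) / (x - z))) =
    1/2 * (d / z * (z / Z) * (- 2 * z * C) * p * (1 / (x - z))) * S
      - 1/2 * (d / z * (1 / Z) * (- 2 * z * C) * ps * (x / (x - z))) * P"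
  using assms by (simp add: divide_simps) (simp add: algebra_simps)

text \<open>
  The contribution of one singularity to the equations for the associated functions. Here \<open>c\<close>,
  \<open>c'\<close> are the Cauchy transforms at \<open>x\<close> of the polynomial and of its reciprocal, and \<open>g\<close>, \<open>g'\<close>
  those at \<open>z\<close>. The inhomogeneous terms, without \<open>c\<close> and \<open>c'\<close>, are \<open>- g / (x - z)\<close> from the kernel
  and \<open>g / (x - z)\<close> from the derivative of the weight; the coefficient of \<open>c\<close> reduces to its final
  form by the Casoratian identity.
\<close>
lemma eps_term:
  fixes x z :: complex
  assumes "x \<noteq> z" "z \<noteq> 0" "Z \<noteq> 0" and Z: "z * (ps * g - p * g') = Z"
  shows "2 * x * (d * (g / Z * ((x * ps * c - z * p * c' - Z) / (x - z)) - c / z - (c - g) / (x - z))) =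
    - (1/2 * (d / z * (1 / Z) * (- 2 * z * g') * p * (x / (x - z))) * (2 * x * c))
      + 1/2 * (d / z * (z / Z) * (2 * z * g) * p * (1 / (x - z))) * (- 2 * x * c')"
  using assms(1-3) unfolding Z[symmetric] by (simp add: divide_simps) (simp add: algebra_simps)

lemma epss_term:
  fixes x z :: complex
  assumes "x \<noteq> z" "z \<noteq> 0" "Z \<noteq> 0" and Z: "z * (ps * g - p * g') = Z"
  shows "- 2 * x * (d * (g' / Z * ((x * ps * c - z * p * c' - Z) / (x - z)) - (c' - g') / (x - z))) =
    - (1/2 * (d / z * (z / Z) * (2 * z * g) * ps * (1 / (x - z))) * (- 2 * x * c'))
      + 1/2 * (d / z * (1 / Z) * (- 2 * z * g') * ps * (x / (x - z))) * (2 * x * c)"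
  using assms(1-3) unfolding Z[symmetric] by (simp add: divide_simps) (simp add: algebra_simps)

theorem proposition3p3:
  fixes D :: "complex set"
    and m n :: nat
    and z dz :: "nat \<Rightarrow> complex \<Rightarrow> complex"
    and \<rho> :: "nat \<Rightarrow> complex"
    and U :: "complex \<Rightarrow> complex set"
    and w :: "complex \<Rightarrow> complex \<Rightarrow> complex"
    and \<kappa> d\<kappa> :: "nat \<Rightarrow> complex \<Rightarrow> complex"
    and \<phi> \<phi>b :: "nat \<Rightarrow> complex \<Rightarrow> complex poly"
    and t :: complex
  assumes "deformation_set D"
    and "m \<ge> 2"
    and rho: "\<forall>j\<in>{1..m}. \<rho> j \<notin> \<nat>"
    and z_deriv: "\<forall>j\<in>{1..m}. \<forall>s\<in>D. (z j has_field_derivative dz j s) (at s within D)"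
    and z_distinct: "\<forall>s\<in>D. inj_on (\<lambda>j. z j s) {1..m}"
    and z_origin: "\<forall>s\<in>D. z 1 s = 0"
    and cuts: "\<forall>s\<in>D. cut_plane (U s)"
    and branch: "\<forall>s\<in>D. is_power_product_branch m (\<lambda>j. z j s) \<rho> (U s) (w s)"
    and cuts_circle: "\<forall>s\<in>D. sphere 0 1 - insert (-1) ((\<lambda>j. z j s) ` {1..m}) \<subseteq> U s"
    and w_deriv: "\<forall>s\<in>D. \<forall>\<zeta>\<in>sphere 0 1 - insert (-1) ((\<lambda>j. z j s) ` {1..m}).
          ((\<lambda>u. w u \<zeta>) has_field_derivative
             - (\<Sum>j=1..m. \<rho> j * dz j s / (\<zeta> - z j s)) * w s \<zeta>) (at s within D)"
    and w_periodic: "\<forall>s\<in>D. \<exists>c. ((\<lambda>\<theta>. w s (cis \<theta>)) \<longlongrightarrow> c) (at_left pi) \<and>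
          ((\<lambda>\<theta>. w s (cis \<theta>)) \<longlongrightarrow> c) (at_right (- pi))"
    and w_L1: "\<forall>s\<in>D. \<forall>k::int. circle_L1 (\<lambda>\<zeta>. \<zeta> powi k * w s \<zeta>) \<and>
          circle_L1 (\<lambda>\<zeta>. \<zeta> powi k * deriv (w s) \<zeta>)"
    and toeplitz: "\<forall>s\<in>D. \<forall>k\<ge>1. toeplitz_det (w s) k \<noteq> 0"
    and biorth: "\<forall>s\<in>D. biorthonormal (w s) (\<lambda>k. \<kappa> k s) (\<lambda>k. \<phi> k s) (\<lambda>k. \<phi>b k s)"
    and kappa_deriv: "\<forall>k. \<forall>s\<in>D. (\<kappa> k has_field_derivative d\<kappa> k s) (at s within D)"
    and "n \<ge> 1"
    and "t \<in> D"
  shows "let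
      P = (\<lambda>s. poly (\<phi> n s));
      Ps = (\<lambda>s. poly (reflect_poly (\<phi>b n s)));
      E = (\<lambda>s. assoc_fun (w s) (\<phi> n s));
      Es = (\<lambda>s. recip_assoc_fun (w s) n (\<phi>b n s));
      a = (\<lambda>j. z j t);
      r = (\<lambda>j. \<rho> j * (if j = 1 then 0 else dz j t / z j t));
      q = d\<kappa> n t / \<kappa> n t
    in
    (\<forall>x. x \<notin> a ` {2..m} \<longrightarrow>
      ((\<lambda>s. P s x) has_field_derivative
         (- q - (\<Sum>j=1..m. r j)
            + 1/2 * (\<Sum>j=1..m. r j * a j powi (- int n) * E t (a j) * Ps t (a j) * (x / (x - a j)))) * P t x
         - (1/2 * (\<Sum>j=1..m. r j * a j powi (1 - int n) * E t (a j) * P t (a j) * (1 / (x - a j)))) * Ps t x)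
        (at t within D) \<and>
      ((\<lambda>s. Ps s x) has_field_derivative
         (- q
            + 1/2 * (\<Sum>j=1..m. r j * a j powi (1 - int n) * Es t (a j) * P t (a j) * (1 / (x - a j)))) * Ps t x
         - (1/2 * (\<Sum>j=1..m. r j * a j powi (- int n) * Es t (a j) * Ps t (a j) * (x / (x - a j)))) * P t x)
        (at t within D)) \<and>
    (\<forall>x. x \<notin> a ` {2..m} \<longrightarrow> x \<notin> sphere 0 1 \<longrightarrow>
      ((\<lambda>s. E s x) has_field_derivative
         (- q
            - 1/2 * (\<Sum>j=1..m. r j * a j powi (- int n) * Es t (a j) * P t (a j) * (x / (x - a j)))) * E t x
         + (1/2 * (\<Sum>j=1..m. r j * a j powi (1 - int n) * E t (a j) * P t (a j) * (1 / (x - a j)))) * Es t x)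
        (at t within D) \<and>
      ((\<lambda>s. Es s x) has_field_derivative
         (- q
            - 1/2 * (\<Sum>j=1..m. r j * a j powi (1 - int n) * E t (a j) * Ps t (a j) * (1 / (x - a j)))) * Es t x
         + (1/2 * (\<Sum>j=1..m. r j * a j powi (- int n) * Es t (a j) * Ps t (a j) * (x / (x - a j)))) * E t x)
        (at t within D))"
proof -
  have U_open: "open (U s)" if "s \<in> D" for s
    using cuts that by (auto intro: open_cut_plane)
  have weights: "integrable_circle_weight m (\<lambda>j. z j s) \<rho> (w s)" if s: "s \<in> D" for s
  proof (intro integrable_circle_weight.intro circle_weight.intro integrable_circle_weight_axioms.intro)
    have br: "is_power_product_branch m (\<lambda>j. z j s) \<rho> (U s) (w s)"
      using branch s by blast
    fix \<zeta> assume "\<zeta> \<in> sphere 0 1" "\<zeta> \<notin> insert (- 1) ((\<lambda>j. z j s) ` {1..m})"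
    then have "\<zeta> \<in> U s" using cuts_circle s by blast
    then show "(w s has_field_derivative w s \<zeta> * (\<Sum>j=1..m. \<rho> j / (\<zeta> - z j s))) (at \<zeta>)" "w s \<zeta> \<noteq> 0"
      using power_product_branch_has_field_derivative[OF br U_open[OF s]] power_product_branch_nonzero[OF br]
      by blast+
  next
    show "circle_L1 (w s)" "circle_L1 (deriv (w s))"
      using w_L1[rule_format, OF s, of 0] by simp_all
    show "\<rho> j \<noteq> 0" if "j \<in> {1..m}" for j
      using rho that by (metis Nats_0)
  qed (use w_periodic z_distinct s in auto)
  interpret biorthonormal_deformation D m z dz \<rho> w t \<kappa> d\<kappa> \<phi> \<phi>b n
    by (intro biorthonormal_deformation.intro weight_deformation.intro biorthonormal_deformation_axioms.intro)
       (use assms weights in auto)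
  define r where "r = (\<lambda>j. \<rho> j * (if j = 1 then 0 else dz j t / z j t))"
  have E_eq: "assoc_fun (w t) (\<phi> n t) x = 2 * x * B.cauchy (\<phi> n t) x"
    and Es_eq: "recip_assoc_fun (w t) n (\<phi>b n t) x = - 2 * x * B.cauchy (B.ps n) x"
    if "x \<notin> sphere 0 1 \<or> x \<in> (\<lambda>j. z j t) ` {1..m}" for x
    using B.assoc_fun_eq_cauchy[OF n that] B.recip_assoc_fun_eq_cauchy[OF n that] by auto
  have E_z: "assoc_fun (w t) (\<phi> n t) (z j t) = 2 * z j t * B.cauchy (\<phi> n t) (z j t)"
    and Es_z: "recip_assoc_fun (w t) n (\<phi>b n t) (z j t) = - 2 * z j t * B.cauchy (B.ps n) (z j t)"
    if "j \<in> {1..m}" for j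
    by (rule E_eq Es_eq, use that in blast)+
  have powi: "z j t powi (- int n) = 1 / z j t ^ n" "z j t powi (1 - int n) = z j t / z j t ^ n"
    if "j \<in> {2..m}" for j
    using z_nonzero[OF that] by (simp_all add: power_int_minus power_int_diff inverse_eq_divide)
  have kernel_eq: "B.kernel n (z j t) x =
      (x * poly (\<phi> n t) x * poly (B.ps n) (z j t) - z j t * poly (\<phi> n t) (z j t) * poly (B.ps n) x) / (x - z j t)"
    if "x \<noteq> z j t" for j x
    using B.christoffel_darboux[of x "z j t" n] that by (simp add: field_simps)
  have cas: "z j t * (poly (B.ps n) (z j t) * B.cauchy (\<phi> n t) (z j t) - poly (\<phi> n t) (z j t) * B.cauchy (B.ps n) (z j t)) = z j t ^ n"
    if "j \<in> {2..m}" for j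
    by (rule B.casoratian[OF pole_z[OF that] n])
  have r1: "r 1 = 0"
    by (simp add: r_def)
  have r2: "r j = \<rho> j * dz j t / z j t" if "j \<in> {2..m}" for j
    using that by (auto simp: r_def)
  \<comment> \<open>For \<open>j = 1\<close> both sides vanish: on the left because \<open>z 1\<close> is constant, on the right because \<open>r 1\<close> is zero by convention.\<close>
  have termwise: "(\<Sum>j=1..m. \<rho> j * dz j t * f j) = (\<Sum>j=1..m. g j)"
    if "g 1 = 0" "\<And>j. j \<in> {2..m} \<Longrightarrow> \<rho> j * dz j t * f j = g j" for f g
  proof (rule sum.cong[OF refl])
    fix j assume "j \<in> {1..m}"
    then show "\<rho> j * dz j t * f j = g j"
      using that dz_origin by (cases "j = 1") auto
  qed
  let ?P = "\<lambda>x. poly (\<phi> n t) x" and ?Ps = "\<lambda>x. poly (B.ps n) x"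
    and ?E = "\<lambda>x. assoc_fun (w t) (\<phi> n t) x" and ?Es = "\<lambda>x. recip_assoc_fun (w t) n (\<phi>b n t) x"
    and ?C = "B.cauchy (\<phi> n t)" and ?Cs = "B.cauchy (B.ps n)"
  let ?F = "\<lambda>e f x j. r j * z j t powi (- int n) * e (z j t) * f (z j t) * (x / (x - z j t))"
    and ?G = "\<lambda>e f x j. r j * z j t powi (1 - int n) * e (z j t) * f (z j t) * (1 / (x - z j t))"
  show ?thesis
    unfolding Let_def r_def[symmetric]
  proof (intro conjI allI impI)
    fix x assume x: "x \<notin> (\<lambda>j. z j t) ` {2..m}"
    then have xz: "x \<noteq> z j t" if "j \<in> {2..m}" for j using that by auto
    show "((\<lambda>s. poly (\<phi> n s) x) has_field_derivative
         (- q - (\<Sum>j=1..m. r j) + 1/2 * (\<Sum>j=1..m. ?F ?E ?Ps x j)) * ?P x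
         - (1/2 * (\<Sum>j=1..m. ?G ?E ?P x j)) * ?Ps x) (at t within D)"
      unfolding collect_phi
    proof (rule DERIV_cong[OF \<phi>_deriv], intro arg_cong2[of _ _ _ _ "(+)"] refl termwise)
      fix j assume j: "j \<in> {2..m}"
      then have j1: "j \<in> {1..m}" by auto
      show "\<rho> j * dz j t * (?C (z j t) / z j t ^ n * B.kernel n (z j t) x - ?P x / z j t) =
          - r j * ?P x + 1/2 * ?F ?E ?Ps x j * ?P x - 1/2 * ?G ?E ?P x j * ?Ps x"
        unfolding kernel_eq[OF xz[OF j]] E_z[OF j1] powi[OF j] r2[OF j]
        by (rule phi_term) (use xz[OF j] z_nonzero[OF j] in auto)
    qed (simp add: r1 del: One_nat_def)
    show "((\<lambda>s. poly (reflect_poly (\<phi>b n s)) x) has_field_derivative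
         (- q + 1/2 * (\<Sum>j=1..m. ?G ?Es ?P x j)) * ?Ps x
         - (1/2 * (\<Sum>j=1..m. ?F ?Es ?Ps x j)) * ?P x) (at t within D)"
      unfolding collect_phis
    proof (rule DERIV_cong[OF \<phi>s_deriv], intro arg_cong2[of _ _ _ _ "(+)"] refl termwise)
      fix j assume j: "j \<in> {2..m}"
      then have j1: "j \<in> {1..m}" by auto
      show "\<rho> j * dz j t * (?Cs (z j t) / z j t ^ n * B.kernel n x (z j t)) =
          1/2 * ?G ?Es ?P x j * ?Ps x - 1/2 * ?F ?Es ?Ps x j * ?P x"
        unfolding B.kernel_commute[of n x] kernel_eq[OF xz[OF j]] Es_z[OF j1] powi[OF j] r2[OF j]
        by (rule phis_term) (use xz[OF j] z_nonzero[OF j] in auto)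
    qed (simp add: r1 del: One_nat_def)
  next
    fix x :: complex assume x: "x \<notin> (\<lambda>j. z j t) ` {2..m}" "x \<notin> sphere 0 1"
    then have xz: "x \<noteq> z j t" if "j \<in> {2..m}" for j using that by auto
    have E_x: "?E x = 2 * x * ?C x" and Es_x: "?Es x = - 2 * x * ?Cs x"
      by (rule E_eq Es_eq, use x(2) in blast)+
    show "((\<lambda>s. assoc_fun (w s) (\<phi> n s) x) has_field_derivative
         (- q - 1/2 * (\<Sum>j=1..m. ?F ?Es ?P x j)) * ?E x
         + (1/2 * (\<Sum>j=1..m. ?G ?E ?P x j)) * ?Es x) (at t within D)"
      unfolding collect_eps
    proof (rule DERIV_cong[OF E_deriv[OF x(2,1)]])
      let ?f = "\<lambda>j. ?C (z j t) / z j t ^ n * B.cauchy_kernel n (z j t) x - ?C x / z j t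
          - (?C x - ?C (z j t)) / (x - z j t)"
      let ?g = "\<lambda>j. - (1/2 * ?F ?Es ?P x j * ?E x) + 1/2 * ?G ?E ?P x j * ?Es x"
      have "(\<Sum>j=1..m. \<rho> j * dz j t * (2 * x * ?f j)) = (\<Sum>j=1..m. ?g j)"
      proof (rule termwise)
        fix j assume j: "j \<in> {2..m}"
        then have j1: "j \<in> {1..m}" by auto
        show "\<rho> j * dz j t * (2 * x * ?f j) = ?g j"
          unfolding E_z[OF j1] Es_z[OF j1] powi[OF j] r2[OF j] E_x Es_x B.cauchy_kernel_def
            mult.left_commute[of "\<rho> j * dz j t" "2 * x"]
          by (rule eps_term) (use xz[OF j] z_nonzero[OF j] cas[OF j] in auto)
      qed (simp add: r1 del: One_nat_def)
      then have "2 * x * (\<Sum>j=1..m. \<rho> j * dz j t * ?f j) = (\<Sum>j=1..m. ?g j)"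
        by (simp only: sum_distrib_left mult.left_commute[of "2 * x"])
      then show "2 * x * (- q * ?C x + (\<Sum>j=1..m. \<rho> j * dz j t * ?f j)) =
          - q * ?E x + (\<Sum>j=1..m. ?g j)"
        unfolding distrib_left by (simp only: E_x mult_ac)
    qed
    show "((\<lambda>s. recip_assoc_fun (w s) n (\<phi>b n s) x) has_field_derivative
         (- q - 1/2 * (\<Sum>j=1..m. ?G ?E ?Ps x j)) * ?Es x
         + (1/2 * (\<Sum>j=1..m. ?F ?Es ?Ps x j)) * ?E x) (at t within D)"
      unfolding collect_eps
    proof (rule DERIV_cong[OF Es_deriv[OF x(2,1)]])
      let ?f = "\<lambda>j. ?Cs (z j t) / z j t ^ n * B.cauchy_kernel n (z j t) x
          - (?Cs x - ?Cs (z j t)) / (x - z j t)"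
      let ?g = "\<lambda>j. - (1/2 * ?G ?E ?Ps x j * ?Es x) + 1/2 * ?F ?Es ?Ps x j * ?E x"
      have "(\<Sum>j=1..m. \<rho> j * dz j t * (- 2 * x * ?f j)) = (\<Sum>j=1..m. ?g j)"
      proof (rule termwise)
        fix j assume j: "j \<in> {2..m}"
        then have j1: "j \<in> {1..m}" by auto
        show "\<rho> j * dz j t * (- 2 * x * ?f j) = ?g j"
          unfolding E_z[OF j1] Es_z[OF j1] powi[OF j] r2[OF j] E_x Es_x B.cauchy_kernel_def
            mult.left_commute[of "\<rho> j * dz j t" "- 2 * x"]
          by (rule epss_term) (use xz[OF j] z_nonzero[OF j] cas[OF j] in auto)
      qed (simp add: r1 del: One_nat_def)
      then have "- 2 * x * (\<Sum>j=1..m. \<rho> j * dz j t * ?f j) = (\<Sum>j=1..m. ?g j)"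
        by (simp only: sum_distrib_left mult.left_commute[of "- 2 * x"])
      then show "- 2 * x * (- q * ?Cs x + (\<Sum>j=1..m. \<rho> j * dz j t * ?f j)) =
          - q * ?Es x + (\<Sum>j=1..m. ?g j)"
        unfolding distrib_left by (simp only: Es_x mult_ac)
    qed
  qed
qed

end
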